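(* Let $\Lambda\in\{\Lambda_G,\Lambda_U\}$ and let $\mathbf{a}_1,\dots,\mathbf{a}_m$ be i.i.d. with distribution $\Lambda$. Let $\mathcal{A}:S_d(\mathbb{R})\to\mathbb{R}^m$ be the rank-one projection operator $\mathcal{A}(\mathbf{M})=\frac1m\big(\langle\mathbf{a}_j\mathbf{a}_j^\top,\mathbf{M}\rangle\big)_{j=1}^m$, where $S_d(\mathbb{R})$ is equipped with $\|\cdot\|_\Lambda$ and $\mathbb{R}^m$ with $\|\cdot\|_1$. For all $\delta,\rho\in(0,1)$ there exists a constant $C=C(\delta,\rho,b/a)>0$, depending only on $\delta$, $\rho$ and the ratio $b/a$ (independent of $m$, $k$ and $d$), such that whenever $$m\ge C(d+2k)\log d,$$ the operator $\mathcal{A}$ satisfies $\operatorname{RIP}_\delta$ on $\mathfrak{S}_{k,a,b}$ with probability at least $1-\rho$. In particular, with probability at least $1-\rho$ the following holds uniformly over $\boldsymbol\Sigma\in\mathfrak{S}_{k,a,b}$: for any $\mathbf{x}_1,\dots,\mathbf{x}_n$ drawn from a centered distribution $\mu$ with covariance $\boldsymbol\Sigma$, with $\widehat{\boldsymbol\Sigma}=\frac1n\sum_i\mathbf{x}_i\mathbf{x}_i^\top$ and $\mathbf{s}=\mathcal{A}(\widehat{\boldsymbol\Sigma})$, the estimator $\boldsymbol\Sigma^\star=\Delta[\mathbf{s}]\in\arg\min_{\boldsymbol\Sigma'\in\mathfrak{S}_{k,a,b}}\|\mathcal{A}(\boldsymbol\Sigma')-\mathbf{s}\|_1$ (assumed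 to exist) satisfies $$\|\boldsymbol\Sigma^\star-\boldsymbol\Sigma\|_\Lambda\le\frac{2}{1-\delta}\|\mathcal{A}(\widehat{\boldsymbol\Sigma})-\mathcal{A}(\boldsymbol\Sigma)\|_1.$$
   Context: $S_d(\mathbb{R})$ is the space of real symmetric $d\times d$ matrices, $S_d^{++}(\mathbb{R})$ the symmetric positive definite ones, $\langle\cdot,\cdot\rangle$ the Frobenius inner product, $\|\mathbf{M}\|_0$ the number of nonzero entries. $\Lambda_G=\mathcal{N}(0,\frac1d\mathbf{I}_d)$ and $\Lambda_U$ is the uniform distribution on the unit sphere $\mathbb{S}^{d-1}$. For $\Lambda\in\{\Lambda_G,\Lambda_U\}$, $\|\mathbf{M}\|_\Lambda=\mathbb{E}_{\mathbf{a}\sim\Lambda}[|\mathbf{a}^\top\mathbf{M}\mathbf{a}|]$ (a norm on $S_d(\mathbb{R})$). For an integer $k\ge0$ and $0<a\le b$, the model set is $\mathfrak{S}_{k,a,b}=\{\boldsymbol\Sigma\in S_d^{++}(\mathbb{R}):\ \boldsymbol\Theta=\boldsymbol\Sigma^{-1},\ \|\boldsymbol\Theta\|_0\le d+2k,\ \operatorname{spec}(\boldsymbol\Theta)\subseteq[a,b]\}$. $\mathcal{A}$ satisfies $\operatorname{RIP}_\delta$ on a set $\mathfrak{S}$ if for all $\boldsymbol\Sigma_1,\boldsymbol\Sigma_2\in\mathfrak{S}$: $(1-\delta)\|\boldsymbol\Sigma_1-\boldsymbol\Sigma_2\|_\Lambda\le\|\mathcal{A}(\boldsymbol\Sigma_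1-\boldsymbol\Sigma_2)\|_1\le(1+\delta)\|\boldsymbol\Sigma_1-\boldsymbol\Sigma_2\|_\Lambda$.
   Formalization: The dimension is assumed to satisfy d ≥ 2; for d = 1 one has log d = 0, so the condition on m is vacuous and the claim fails (e.g. Gaussian case, m = 1, δ = ρ = 1/2, a < b). *)

theory Defs
  imports "HOL-Probability.Probability"
begin

text \<open>Conventions. Dimension d varies inside the statement, so vectors of R^d are
  functions nat => real (only indices < d matter) and d x d matrices are
  functions nat => nat => real (only indices < d matter).\<close>

definition vnorm :: "nat \<Rightarrow> (nat \<Rightarrow> real) \<Rightarrow> real" where
  "vnorm d x = sqrt (\<Sum>i<d. (x i)\<^sup>2)"

definition qform :: "nat \<Rightarrow> (nat \<Rightarrow> nat \<Rightarrow> real) \<Rightarrow> (nat \<Rightarrow> real) \<Rightarrow> real" where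
  "qform d M x = (\<Sum>i<d. \<Sum>j<d. x i * M i j * x j)"

definition msub :: "(nat \<Rightarrow> nat \<Rightarrow> real) \<Rightarrow> (nat \<Rightarrow> nat \<Rightarrow> real) \<Rightarrow> (nat \<Rightarrow> nat \<Rightarrow> real)" where
  "msub M N = (\<lambda>i j. M i j - N i j)"

definition mmult :: "nat \<Rightarrow> (nat \<Rightarrow> nat \<Rightarrow> real) \<Rightarrow> (nat \<Rightarrow> nat \<Rightarrow> real) \<Rightarrow> (nat \<Rightarrow> nat \<Rightarrow> real)" where
  "mmult d M N = (\<lambda>i j. \<Sum>l<d. M i l * N l j)"

definition idm :: "nat \<Rightarrow> nat \<Rightarrow> real" where
  "idm = (\<lambda>i j. if i = j then 1 else 0)"

definition symmetric :: "nat \<Rightarrow> (nat \<Rightarrow> nat \<Rightarrow> real) \<Rightarrow> bool" where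
  "symmetric d M \<longleftrightarrow> (\<forall>i<d. \<forall>j<d. M i j = M j i)"

definition spd :: "nat \<Rightarrow> (nat \<Rightarrow> nat \<Rightarrow> real) \<Rightarrow> bool" where
  "spd d M \<longleftrightarrow> symmetric d M \<and>
     (\<forall>x. (\<exists>i<d. x i \<noteq> 0) \<longrightarrow> qform d M x > 0)"

definition is_inverse :: "nat \<Rightarrow> (nat \<Rightarrow> nat \<Rightarrow> real) \<Rightarrow> (nat \<Rightarrow> nat \<Rightarrow> real) \<Rightarrow> bool" where
  "is_inverse d S T \<longleftrightarrow> (\<forall>i<d. \<forall>j<d. mmult d S T i j = idm i j \<and> mmult d T S i j = idm i j)"

definition nnz :: "nat \<Rightarrow> (nat \<Rightarrow> nat \<Rightarrow> real) \<Rightarrow> nat" where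
  "nnz d M = card {(i, j). i < d \<and> j < d \<and> M i j \<noteq> 0}"

definition is_eigenvalue :: "nat \<Rightarrow> (nat \<Rightarrow> nat \<Rightarrow> real) \<Rightarrow> real \<Rightarrow> bool" where
  "is_eigenvalue d M t \<longleftrightarrow>
     (\<exists>v. (\<exists>i<d. v i \<noteq> 0) \<and> (\<forall>i<d. (\<Sum>j<d. M i j * v j) = t * v i))"

text \<open>The model set S_{k,a,b} (Theta = Sigma^{-1}; as Sigma is symmetric, so is Theta,
  hence all eigenvalues of Theta are real).\<close>
definition model_set :: "nat \<Rightarrow> nat \<Rightarrow> real \<Rightarrow> real \<Rightarrow> (nat \<Rightarrow> nat \<Rightarrow> real) set" where
  "model_set d k a b = {S. spd d S \<and> (\<exists>T. is_inverse d S T \<and> nnz d T \<le> d + 2 * k \<and>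
      (\<forall>t. is_eigenvalue d T t \<longrightarrow> a \<le> t \<and> t \<le> b))}"

definition borel_d :: "nat \<Rightarrow> (nat \<Rightarrow> real) measure" where
  "borel_d d = PiM {..<d} (\<lambda>_. borel)"

definition lebesgue_d :: "nat \<Rightarrow> (nat \<Rightarrow> real) measure" where
  "lebesgue_d d = PiM {..<d} (\<lambda>_. lborel)"

definition Lambda_G :: "nat \<Rightarrow> (nat \<Rightarrow> real) measure" where
  "Lambda_G d = PiM {..<d} (\<lambda>_. density lborel (normal_density 0 (1 / sqrt (real d))))"

text \<open>Lambda_U = normalized surface (cone) measure on the unit sphere S^{d-1}:
  the image of the uniform distribution on the closed unit ball under x |-> x/|x|.\<close>
definition Lambda_U :: "nat \<Rightarrow> (nat \<Rightarrow> real) measure" where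
  "Lambda_U d = distr (uniform_measure (lebesgue_d d) {x \<in> space (lebesgue_d d). vnorm d x \<le> 1})
      (borel_d d) (\<lambda>x. restrict (\<lambda>i. x i / vnorm d x) {..<d})"

datatype ensemble = Gauss | Unif

definition Lambda :: "ensemble \<Rightarrow> nat \<Rightarrow> (nat \<Rightarrow> real) measure" where
  "Lambda e d = (case e of Gauss \<Rightarrow> Lambda_G d | Unif \<Rightarrow> Lambda_U d)"

definition Lnorm :: "ensemble \<Rightarrow> nat \<Rightarrow> (nat \<Rightarrow> nat \<Rightarrow> real) \<Rightarrow> real" where
  "Lnorm e d M = (\<integral>x. \<bar>qform d M x\<bar> \<partial>Lambda e d)"

text \<open>Rank-one projection operator A(M) = (1/m) (<a_j a_j^T, M>)_{j<m}, with
  <a a^T, M> = a^T M a.\<close>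
definition Aop :: "nat \<Rightarrow> nat \<Rightarrow> (nat \<Rightarrow> nat \<Rightarrow> real) \<Rightarrow> (nat \<Rightarrow> nat \<Rightarrow> real) \<Rightarrow> nat \<Rightarrow> real" where
  "Aop d m as M = (\<lambda>j. qform d M (as j) / real m)"

definition l1norm :: "nat \<Rightarrow> (nat \<Rightarrow> real) \<Rightarrow> real" where
  "l1norm m y = (\<Sum>j<m. \<bar>y j\<bar>)"

definition RIP :: "ensemble \<Rightarrow> nat \<Rightarrow> nat \<Rightarrow> (nat \<Rightarrow> nat \<Rightarrow> real) \<Rightarrow> real \<Rightarrow>
    (nat \<Rightarrow> nat \<Rightarrow> real) set \<Rightarrow> bool" where
  "RIP e d m as \<delta> S \<longleftrightarrow> (\<forall>S1\<in>S. \<forall>S2\<in>S.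
     (1 - \<delta>) * Lnorm e d (msub S1 S2) \<le> l1norm m (Aop d m as (msub S1 S2)) \<and>
     l1norm m (Aop d m as (msub S1 S2)) \<le> (1 + \<delta>) * Lnorm e d (msub S1 S2))"

definition sample_cov :: "nat \<Rightarrow> (nat \<Rightarrow> nat \<Rightarrow> real) \<Rightarrow> (nat \<Rightarrow> nat \<Rightarrow> real)" where
  "sample_cov n xs = (\<lambda>i j. (\<Sum>l<n. xs l i * xs l j) / real n)"

definition sample_measure :: "ensemble \<Rightarrow> nat \<Rightarrow> nat \<Rightarrow> (nat \<Rightarrow> nat \<Rightarrow> real) measure" where
  "sample_measure e d m = PiM {..<m} (\<lambda>_. Lambda e d)"

end

theory Submission
  imports Defs
begin

text \<open>
  The secants \<open>S\<^sub>1 - S\<^sub>2 = S\<^sub>1 (T\<^sub>2 - T\<^sub>1) S\<^sub>2\<close> of the model set, where \<open>T\<^sub>i\<close> is the inverse of \<open>S\<^sub>i\<close>, are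
  parametrized by the sparse matrices \<open>T\<^sub>1\<close>, \<open>T\<^sub>2\<close> and the normalized difference \<open>T\<^sub>2 - T\<^sub>1\<close>. Rounding
  the entries of these three to precision \<open>1/K\<close> with \<open>K\<close> of order \<open>d^8\<close> gives a net of the normalized
  secants whose cardinality is at most \<open>exp (O ((d + 2k) log d))\<close>. Since the precision is polynomial in \<open>d\<close>,
  crude estimates (entrywise norms, Markov's inequality for the mean of \<open>|a\<^sub>j|\<^sup>2\<close>) suffice to pass
  from the net to all secants, and \<open>d\<close>-dependent losses are absorbed by the factor \<open>log d\<close>.

  At a single matrix \<open>M\<close> the measurements concentrate exponentially, because \<open>|a\<^sup>T M a|\<close> is
  subexponential at the scale of its own mean. For Gaussian \<open>a\<close> the moment generating
  function of \<open>a\<^sup>T M a\<close> is bounded by integrating out one coordinate at a time, and the mean is bounded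
  below by comparing second and fourth moments. The sphere reduces to the Gaussian case by the polar
  decomposition: norm and direction are independent, the mean of \<open>|a|\<^sup>2\<close> is 1, so both ensembles
  have the same norm, and Jensen's inequality transfers the exponential moment.
\<close>

section \<open>Entry bounds from the spectrum\<close>

text \<open>Covariances in the model set are dense; only their inverses are sparse, so the counting
  has to take place on the side of the inverses. The isometry property is homogeneous and two model
  matrices may be arbitrarily close, so a net of the model set itself, with its additive error,
  would not do: the difference \<open>T2 - T1\<close> is normalized and rounded as a third sparse
  matrix. The rounding error becomes relative to the size of the secant through the identity
  \<open>T1 (S1 H S2) T2 = H\<close>: since \<open>H\<close> has largest entry 1 and the entries of
  \<open>T1\<close> and \<open>T2\<close> are at most \<open>b\<close>, no normalized secant is
  small. Spectral information enters only through the entry bounds \<open>b\<close> for the inverses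
  and \<open>1 / a\<close> for the covariances, and the combined estimate depends on
  \<open>b / a\<close> alone. The exponent 8 is 6 + 2: six powers of \<open>d\<close> are lost in
  perturbing a triple product and in its lower bound, two more in passing from entries to
  \<open>Lnorm\<close> and back.\<close>

lemma quadratic_nonpos_linear_zero:
  fixes A B :: real
  assumes "\<And>h. 2 * h * A + h\<^sup>2 * B \<le> 0"
  shows "A = 0"
proof (rule ccontr)
  assume A: "A \<noteq> 0"
  \<comment> \<open>The step is small enough for the quadratic term to cost at most
    \<open>h * A\<close>, half of the linear gain.\<close>
  define h where "h = A / (\<bar>B\<bar> + 1)"
  have "h\<^sup>2 * (- B) \<le> h\<^sup>2 * (\<bar>B\<bar> + 1)" by (intro mult_left_mono) auto
  also have "\<dots> = h * A" by (simp add: h_def power2_eq_square)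
  finally have "h * A \<le> 2 * h * A + h\<^sup>2 * B" by (simp add: algebra_simps)
  also have "\<dots> \<le> 0" by (rule assms)
  finally have "h * A \<le> 0" .
  moreover have "h * A > 0" using A by (auto simp: h_def zero_less_divide_iff mult_less_0_iff zero_less_mult_iff linorder_neq_iff)
  ultimately show False by simp
qed

text \<open>\<open>idm i\<close> plays the i-th standard basis vector. Variations along single
  coordinates are enough: they give the eigenvector equation at a maximizer and read off individual
  entries of \<open>M\<close>.\<close>

lemma qform_add_unit:
  assumes "symmetric d M" "i < d"
  shows "qform d M (\<lambda>j. v j + h * idm i j) = qform d M v + 2 * h * (\<Sum>j<d. M i j * v j) + h\<^sup>2 * M i i"
proof -
  have d: "(\<Sum>j<d. f j * idm i j) = f i" for f :: "nat \<Rightarrow> real"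
    using assms(2) by (simp add: idm_def if_distrib cong: if_cong)
  have "qform d M (\<lambda>j. v j + h * idm i j) = (\<Sum>k<d. \<Sum>j<d. v k * M k j * v j) +
     h * (\<Sum>k<d. \<Sum>j<d. (v k * M k j) * idm i j) + h * (\<Sum>k<d. (\<Sum>j<d. M k j * v j) * idm i k)
     + h\<^sup>2 * (\<Sum>k<d. (\<Sum>j<d. M k j * idm i j) * idm i k)"
    by (simp add: qform_def sum.distrib sum_distrib_left sum_distrib_right algebra_simps power2_eq_square)
  also have "\<dots> = qform d M v + h * (\<Sum>k<d. v k * M k i) + h * (\<Sum>j<d. M i j * v j) + h\<^sup>2 * M i i"
    unfolding d by (simp add: qform_def)
  also have "(\<Sum>k<d. v k * M k i) = (\<Sum>j<d. M i j * v j)"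
    using assms by (intro sum.cong) (auto simp: symmetric_def)
  finally show ?thesis by simp
qed

lemma sum_square_add_unit:
  assumes "i < d"
  shows "(\<Sum>j<d. (v j + h * idm i j)\<^sup>2) = (\<Sum>j<d. (v j)\<^sup>2) + 2 * h * v i + h\<^sup>2"
proof -
  have q: "qform d idm x = (\<Sum>j<d. (x j)\<^sup>2)" for x
  proof -
    have "x i * idm i j * x j = (if i = j then (x i)\<^sup>2 else 0)" for i j
      by (simp add: idm_def power2_eq_square)
    then show ?thesis by (simp add: qform_def)
  qed
  have "symmetric d idm" by (auto simp: symmetric_def idm_def)
  from qform_add_unit[OF this assms, of v h] assms show ?thesis
    unfolding q by (simp add: idm_def if_distrib[of "\<lambda>z. z * _"] cong: if_cong)
qed

text \<open>A maximizer of the quadratic form on the unit sphere is an eigenvector, by first-order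
  optimality in each coordinate. The model set restricts eigenvalues only; this is how that
  restriction becomes an inequality between quadratic forms.\<close>

lemma max_rayleigh_eigenvalue:
  assumes "0 < d" "symmetric d M"
  obtains t v where "\<exists>i<d. v i \<noteq> 0" "\<And>i. i < d \<Longrightarrow> (\<Sum>j<d. M i j * v j) = t * v i"
    "\<And>x. qform d M x \<le> t * (\<Sum>i<d. (x i)\<^sup>2)" "qform d M v = t * (\<Sum>i<d. (v i)\<^sup>2)"
proof -
  \<comment> \<open>Vectors are functions on all of \<open>nat\<close>, so the coordinates from
    \<open>d\<close> on are frozen at 0; the set is then a product of compact sets and Tychonoff's
    theorem applies.\<close>
  define K :: "(nat \<Rightarrow> real) set" where "K = PiE UNIV (\<lambda>i. if i < d then {-1..1} else {0})"
  define S where "S = {x \<in> K. (\<Sum>i<d. (x i)\<^sup>2) = 1}"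
  have K: "compact K"
  proof -
    have "compactin (product_topology (\<lambda>_::nat. euclidean :: real topology) UNIV) K"
      unfolding K_def by (subst compactin_PiE) auto
    then show ?thesis by (simp add: euclidean_product_topology)
  qed
  have cont: "continuous_on UNIV (\<lambda>x::nat \<Rightarrow> real. x i)" for i
    by (rule continuous_on_product_coordinates)
  have cs: "continuous_on UNIV (\<lambda>x::nat \<Rightarrow> real. \<Sum>i<d. (x i)\<^sup>2)"
    by (intro continuous_intros cont)
  have "S = K \<inter> (\<lambda>x. \<Sum>i<d. (x i)\<^sup>2) -` {1}" by (auto simp: S_def)
  moreover have "closed ((\<lambda>x::nat \<Rightarrow> real. \<Sum>i<d. (x i)\<^sup>2) -` {1})"
    by (intro closed_vimage cs) auto
  ultimately have S: "compact S" using K by (simp add: compact_Int_closed)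
  have "(\<lambda>i. if i = 0 then 1 else 0) \<in> S"
    using assms(1) by (auto simp: S_def K_def if_distrib[of "\<lambda>z. z ^ _"] cong: if_cong)
  then have "S \<noteq> {}" by auto
  moreover have "continuous_on S (qform d M)"
    unfolding qform_def[abs_def] by (intro continuous_intros continuous_on_subset[OF cont]) auto
  ultimately obtain v where v: "v \<in> S" "\<And>x. x \<in> S \<Longrightarrow> qform d M x \<le> qform d M v"
    using continuous_attains_sup[OF S] by metis
  define t where "t = qform d M v"
  have v1: "(\<Sum>i<d. (v i)\<^sup>2) = 1" using v(1) by (simp add: S_def)
  have bound: "qform d M x \<le> t * (\<Sum>i<d. (x i)\<^sup>2)" for x
  proof (cases "(\<Sum>i<d. (x i)\<^sup>2) = 0")
    case True
    then have "x i = 0" if "i < d" for i using that by (simp add: sum_nonneg_eq_0_iff)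
    then show ?thesis using True by (simp add: qform_def)
  next
    case False
    define r where "r = sqrt (\<Sum>i<d. (x i)\<^sup>2)"
    have r: "r > 0" "r\<^sup>2 = (\<Sum>i<d. (x i)\<^sup>2)"
      using False by (auto simp: r_def sum_nonneg order_less_le)
    let ?y = "\<lambda>i. if i < d then x i / r else 0"
    have y1: "(\<Sum>i<d. (?y i)\<^sup>2) = 1"
    proof -
      have "(\<Sum>i<d. (?y i)\<^sup>2) = (\<Sum>i<d. (x i)\<^sup>2) / r\<^sup>2"
        by (simp add: power_divide sum_divide_distrib)
      then show ?thesis using False by (simp add: r(2))
    qed
    have yb: "\<bar>?y i\<bar> \<le> 1" for i
    proof (cases "i < d")
      case True
      then have "(?y i)\<^sup>2 \<le> (\<Sum>i<d. (?y i)\<^sup>2)" by (intro member_le_sum) auto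
      then show ?thesis unfolding y1 by (simp add: abs_square_le_1)
    qed simp
    have "?y i \<in> (if i < d then {-1..1} else {0})" for i
      using yb[of i] unfolding abs_le_iff by (cases "i < d") auto
    then have "?y \<in> S" using y1 by (simp add: S_def K_def PiE_def Pi_def)
    then have "qform d M ?y \<le> t" using v(2) by (simp add: t_def)
    moreover have "qform d M ?y = qform d M x / r\<^sup>2"
      by (simp add: qform_def sum_divide_distrib power2_eq_square)
    ultimately have "qform d M x / r\<^sup>2 \<le> t" by simp
    then show ?thesis using r(1) unfolding r(2)[symmetric] by (simp add: divide_le_eq)
  qed
  show ?thesis
  proof (rule that)
    show "\<exists>i<d. v i \<noteq> 0"
    proof (rule ccontr)
      assume "\<not> (\<exists>i<d. v i \<noteq> 0)"
      then show False using v1 by simp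
    qed
    show "(\<Sum>j<d. M i j * v j) = t * v i" if i: "i < d" for i
    proof -
      \<comment> \<open>This is the Rayleigh bound at \<open>v + h * idm i\<close>; its constant
        terms cancel because \<open>v\<close> attains equality.\<close>
      have "2 * h * ((\<Sum>j<d. M i j * v j) - t * v i) + h\<^sup>2 * (M i i - t) \<le> 0" for h
        using bound[of "\<lambda>j. v j + h * idm i j"]
        unfolding qform_add_unit[OF assms(2) i] sum_square_add_unit[OF i] v1 t_def[symmetric]
        by (simp add: algebra_simps)
      then show ?thesis using quadratic_nonpos_linear_zero by fastforce
    qed
    show "qform d M x \<le> t * (\<Sum>i<d. (x i)\<^sup>2)" for x by (rule bound)
    show "qform d M v = t * (\<Sum>i<d. (v i)\<^sup>2)" by (simp add: v1 t_def)
  qed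
qed

text \<open>Testing positivity on the sum and the difference of two basis vectors bounds an
  off-diagonal entry by the mean of two diagonal ones, and the upper bound controls the
  diagonal.\<close>

lemma psd_entry_bound:
  assumes M: "symmetric d M" and psd: "\<And>x. 0 \<le> qform d M x"
    and up: "\<And>x. qform d M x \<le> t * (\<Sum>i<d. (x i)\<^sup>2)" and ij: "i < d" "j < d"
  shows "\<bar>M i j\<bar> \<le> t"
proof -
  have diag: "M l l \<le> t" if "l < d" for l
    using up[of "\<lambda>j. 0 + 1 * idm l j"]
    unfolding qform_add_unit[OF M that] sum_square_add_unit[OF that] by (simp add: qform_def)
  have q: "qform d M (\<lambda>k. h * idm j k + 1 * idm i k) = h\<^sup>2 * M j j + 2 * h * M i j + M i i" for h
  proof -
    have "qform d M (\<lambda>k. h * idm j k) = h\<^sup>2 * M j j"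
      using qform_add_unit[OF M ij(2), of "\<lambda>_. 0" h] by (simp add: qform_def)
    moreover have "(\<Sum>k<d. M i k * (h * idm j k)) = h * M i j"
      using ij by (simp add: idm_def if_distrib cong: if_cong)
    ultimately show ?thesis unfolding qform_add_unit[OF M ij(1)] by simp
  qed
  have "0 \<le> M j j + 2 * M i j + M i i" "0 \<le> M j j - 2 * M i j + M i i"
    using psd[of "\<lambda>k. 1 * idm j k + 1 * idm i k"] psd[of "\<lambda>k. -1 * idm j k + 1 * idm i k"]
    unfolding q by simp_all
  then show ?thesis using diag[OF ij(1)] diag[OF ij(2)] by linarith
qed

section \<open>Inverses of symmetric matrices\<close>

lemma mmult_assoc: "mmult d (mmult d A B) C i j = mmult d A (mmult d B C) i j"
  unfolding mmult_def sum_distrib_left sum_distrib_right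
  by (subst sum.swap) (simp add: mult_ac)

lemma mmult_idm_left: "i < d \<Longrightarrow> mmult d idm A i j = A i j"
  by (simp add: mmult_def idm_def if_distrib[of "\<lambda>z. z * _"] cong: if_cong)

lemma mmult_idm_right: "j < d \<Longrightarrow> mmult d A idm i j = A i j"
  by (simp add: mmult_def idm_def if_distrib cong: if_cong)

lemma mmult_cong:
  assumes "\<And>l. l < d \<Longrightarrow> A i l = A' i l" "\<And>l. l < d \<Longrightarrow> B l j = B' l j"
  shows "mmult d A B i j = mmult d A' B' i j"
  unfolding mmult_def using assms by (intro sum.cong) auto

lemma inverse_symmetric:
  assumes "symmetric d S" "is_inverse d S T"
  shows "symmetric d T"
  unfolding symmetric_def
proof (intro allI impI)
  fix i j assume ij: "i < d" "j < d"
  define Tt where "Tt = (\<lambda>i j. T j i)"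
  have TtS: "mmult d Tt S k l = idm k l" if "k < d" "l < d" for k l
  proof -
    have "mmult d Tt S k l = mmult d S T l k"
      unfolding mmult_def Tt_def using assms(1) that by (intro sum.cong) (auto simp: symmetric_def)
    then show ?thesis using assms(2) that by (simp add: is_inverse_def idm_def)
  qed
  have "T i j = mmult d idm T i j" using ij by (simp add: mmult_idm_left)
  also have "\<dots> = mmult d (mmult d Tt S) T i j" using TtS ij by (intro mmult_cong) auto
  also have "\<dots> = mmult d Tt (mmult d S T) i j" by (rule mmult_assoc)
  also have "\<dots> = mmult d Tt idm i j" using assms(2) ij by (intro mmult_cong) (auto simp: is_inverse_def)
  also have "\<dots> = T j i" using ij by (simp add: mmult_idm_right Tt_def)
  finally show "T i j = T j i" .
qed

text \<open>With y = T x one has S y = x. This lets positivity of \<open>S\<close> pass to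
  \<open>T\<close>.\<close>

lemma qform_inverse:
  assumes "is_inverse d S T" "symmetric d T"
  shows "qform d T x = qform d S (\<lambda>i. \<Sum>j<d. T i j * x j)"
proof -
  let ?y = "\<lambda>i. \<Sum>j<d. T i j * x j"
  have Sy: "(\<Sum>j<d. S i j * ?y j) = x i" if "i < d" for i
  proof -
    have "(\<Sum>j<d. S i j * ?y j) = (\<Sum>k<d. mmult d S T i k * x k)"
      unfolding mmult_def sum_distrib_left sum_distrib_right by (subst sum.swap) (simp add: mult_ac)
    also have "\<dots> = (\<Sum>k<d. idm i k * x k)"
      using assms(1) that by (intro sum.cong) (auto simp: is_inverse_def)
    also have "\<dots> = x i" using that by (simp add: idm_def if_distrib[of "\<lambda>z. z * _"] cong: if_cong)
    finally show ?thesis .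
  qed
  have "qform d S ?y = (\<Sum>i<d. ?y i * (\<Sum>j<d. S i j * ?y j))"
    unfolding qform_def by (simp add: sum_distrib_left mult.assoc)
  also have "\<dots> = (\<Sum>i<d. ?y i * x i)" by (intro sum.cong) (auto simp: Sy)
  also have "\<dots> = qform d T x"
    unfolding qform_def by (intro sum.cong refl) (simp add: sum_distrib_right sum_distrib_left mult_ac)
  finally show ?thesis by simp
qed

text \<open>The largest eigenvalue of \<open>T\<close> is at most \<open>b\<close>. For
  \<open>S\<close>, the inverse of its largest eigenvalue is an eigenvalue of \<open>T\<close>,
  hence at least \<open>a\<close>. Both matrices are positive semidefinite, so
  \<open>psd_entry_bound\<close> turns this into entry bounds.\<close>

lemma model_set_bounds:
  assumes "S \<in> model_set d k a b" "0 < d" "0 < a"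
  obtains T where "symmetric d S" "symmetric d T" "is_inverse d S T" "nnz d T \<le> d + 2 * k"
    "\<And>i j. i < d \<Longrightarrow> j < d \<Longrightarrow> \<bar>T i j\<bar> \<le> b" "\<And>i j. i < d \<Longrightarrow> j < d \<Longrightarrow> \<bar>S i j\<bar> \<le> 1 / a"
proof -
  obtain T where T: "spd d S" "is_inverse d S T" "nnz d T \<le> d + 2 * k"
    and ev: "\<And>t. is_eigenvalue d T t \<Longrightarrow> a \<le> t \<and> t \<le> b"
    using assms(1) by (auto simp: model_set_def)
  have S: "symmetric d S" using T(1) by (simp add: spd_def)
  have symT: "symmetric d T" by (rule inverse_symmetric[OF S T(2)])
  have psdS: "0 \<le> qform d S x" for x
  proof (cases "\<exists>i<d. x i \<noteq> 0")
    case True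
    then show ?thesis using T(1) by (auto simp: spd_def less_imp_le)
  next
    case False
    then show ?thesis by (simp add: qform_def)
  qed
  have psdT: "0 \<le> qform d T x" for x
    unfolding qform_inverse[OF T(2) symT] by (rule psdS)
  obtain t v where t: "\<exists>i<d. v i \<noteq> 0" "\<And>i. i < d \<Longrightarrow> (\<Sum>j<d. T i j * v j) = t * v i"
    "\<And>x. qform d T x \<le> t * (\<Sum>i<d. (x i)\<^sup>2)" "qform d T v = t * (\<Sum>i<d. (v i)\<^sup>2)"
    by (rule max_rayleigh_eigenvalue[OF assms(2) symT]) (rule that)
  have "is_eigenvalue d T t" using t(1,2) by (auto simp: is_eigenvalue_def)
  then have tb: "t \<le> b" using ev by auto
  obtain u w where u: "\<exists>i<d. w i \<noteq> 0" "\<And>i. i < d \<Longrightarrow> (\<Sum>j<d. S i j * w j) = u * w i"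
    "\<And>x. qform d S x \<le> u * (\<Sum>i<d. (x i)\<^sup>2)" "qform d S w = u * (\<Sum>i<d. (w i)\<^sup>2)"
    by (rule max_rayleigh_eigenvalue[OF assms(2) S]) (rule that)
  have "0 < qform d S w" using T(1) u(1) by (auto simp: spd_def)
  then have "0 < u * (\<Sum>i<d. (w i)\<^sup>2)" using u(4) by simp
  moreover have "0 \<le> (\<Sum>i<d. (w i)\<^sup>2)" by (simp add: sum_nonneg)
  ultimately have u0: "0 < u" by (auto simp: zero_less_mult_iff)
  have "(\<Sum>j<d. T i j * w j) = (1 / u) * w i" if i: "i < d" for i
  proof -
    have "u * (\<Sum>j<d. T i j * w j) = (\<Sum>j<d. T i j * (u * w j))"
      by (simp add: sum_distrib_left mult_ac)
    also have "\<dots> = (\<Sum>j<d. T i j * (\<Sum>l<d. S j l * w l))"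
      using u(2) by (intro sum.cong) auto
    also have "\<dots> = (\<Sum>l<d. mmult d T S i l * w l)"
      unfolding mmult_def sum_distrib_left sum_distrib_right by (subst sum.swap) (simp add: mult_ac)
    also have "\<dots> = (\<Sum>l<d. idm i l * w l)"
      using T(2) i by (intro sum.cong) (auto simp: is_inverse_def)
    also have "\<dots> = w i" using i by (simp add: idm_def if_distrib[of "\<lambda>z. z * _"] cong: if_cong)
    finally show ?thesis using u0 by (simp add: field_simps)
  qed
  then have "is_eigenvalue d T (1 / u)" using u(1) unfolding is_eigenvalue_def by blast
  then have "a \<le> 1 / u" using ev by auto
  then have ua: "u \<le> 1 / a" using u0 assms(3) by (simp add: field_simps)
  show ?thesis
  proof (rule that[OF S symT T(2,3)])
    show "\<bar>T i j\<bar> \<le> b" if "i < d" "j < d" for i j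
      using psd_entry_bound[OF symT psdT t(3) that] tb by linarith
    show "\<bar>S i j\<bar> \<le> 1 / a" if "i < d" "j < d" for i j
      using psd_entry_bound[OF S psdS u(3) that] ua by linarith
  qed
qed

section \<open>A net for the normalized secants\<close>

text \<open>Codes vanish outside the d x d square, so that agreement of two codes is equality of
  functions. The bound on the support keeps the count exponential in \<open>n\<close> rather than in
  the number of all entries.\<close>

definition sparse_codes :: "nat \<Rightarrow> nat \<Rightarrow> nat \<Rightarrow> (nat \<times> nat \<Rightarrow> int) set" where
  "sparse_codes d n K = {f. (\<forall>p. f p \<noteq> 0 \<longrightarrow> p \<in> {..<d} \<times> {..<d} \<and> \<bar>f p\<bar> \<le> int K) \<and>
     card {p. f p \<noteq> 0} \<le> n}"

text \<open>A code is recovered from a list of \<open>n\<close> pairs of a position and a value,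
  with \<open>d^2 * (2 * K + 1)\<close> choices for each pair.\<close>

lemma sparse_codes_card:
  assumes "0 < d"
  shows "finite (sparse_codes d n K)" "card (sparse_codes d n K) \<le> (d\<^sup>2 * (2 * K + 1)) ^ n"
proof -
  define A :: "((nat \<times> nat) \<times> int) set" where "A = ({..<d} \<times> {..<d}) \<times> {- int K .. int K}"
  define X where "X = {xs. set xs \<subseteq> A \<and> length xs = n}"
  define g :: "((nat \<times> nat) \<times> int) list \<Rightarrow> nat \<times> nat \<Rightarrow> int"
    where "g xs p = (case map_of xs p of None \<Rightarrow> 0 | Some v \<Rightarrow> v)" for xs p
  have fA: "finite A" by (simp add: A_def)
  have cA: "card A = d\<^sup>2 * (2 * K + 1)"
    by (simp add: A_def card_cartesian_product power2_eq_square nat_add_distrib nat_mult_distrib)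
  have fX: "finite X" unfolding X_def by (rule finite_lists_length_eq[OF fA])
  have cX: "card X = (d\<^sup>2 * (2 * K + 1)) ^ n"
    unfolding X_def card_lists_length_eq[OF fA] cA ..
  have "sparse_codes d n K \<subseteq> g ` X"
  proof
    fix f assume f: "f \<in> sparse_codes d n K"
    have sub: "{p. f p \<noteq> 0} \<subseteq> {..<d} \<times> {..<d}" using f by (auto simp: sparse_codes_def)
    then have "finite {p. f p \<noteq> 0}" by (rule finite_subset) simp
    then obtain ps where ps: "set ps = {p. f p \<noteq> 0}" "distinct ps"
      using finite_distinct_list by blast
    \<comment> \<open>Padding repeats the position (0, 0), which exists because
      \<open>0 < d\<close>; as it is paired with its own value of \<open>f\<close>, repetitions do
      no harm.\<close>
    define ys where "ys = ps @ replicate (n - length ps) (0, 0)"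
    have "length ps \<le> n" using f ps by (simp add: sparse_codes_def distinct_card[symmetric])
    then have len: "length ys = n" by (simp add: ys_def)
    have "g (map (\<lambda>p. (p, f p)) ys) = f"
    proof
      fix p
      have "map_of (map (\<lambda>p. (p, f p)) ys) p = (if p \<in> set ys then Some (f p) else None)"
        by (simp add: map_of_map_restrict restrict_map_def)
      moreover have "p \<notin> set ys \<Longrightarrow> f p = 0" using ps by (auto simp: ys_def)
      ultimately show "g (map (\<lambda>p. (p, f p)) ys) p = f p" by (auto simp: g_def)
    qed
    moreover have "map (\<lambda>p. (p, f p)) ys \<in> X"
    proof -
      have b: "\<bar>f p\<bar> \<le> int K" for p
        using f by (cases p, cases "f p = 0") (auto simp: sparse_codes_def)
      have "set ys \<subseteq> {..<d} \<times> {..<d}"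
        using ps sub assms by (auto simp: ys_def)
      then show ?thesis using b len by (force simp: X_def A_def abs_le_iff minus_le_iff)
    qed
    ultimately show "f \<in> g ` X" by (metis imageI)
  qed
  then show "finite (sparse_codes d n K)" "card (sparse_codes d n K) \<le> (d\<^sup>2 * (2 * K + 1)) ^ n"
    using fX cX surj_card_le[OF fX] by (auto intro: finite_surj)
qed

definition code :: "nat \<Rightarrow> nat \<Rightarrow> (nat \<Rightarrow> nat \<Rightarrow> real) \<Rightarrow> nat \<times> nat \<Rightarrow> int" where
  "code d K M = (\<lambda>(i, j). if i < d \<and> j < d then \<lfloor>real K * M i j\<rfloor> else 0)"

text \<open>Rounding down maps 0 to 0, so it creates no new nonzero entries, and it preserves
  [-K, K] because \<open>K\<close> is an integer.\<close>

lemma code_in_sparse_codes: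
  assumes "\<And>i j. i < d \<Longrightarrow> j < d \<Longrightarrow> \<bar>M i j\<bar> \<le> 1" "nnz d M \<le> n"
  shows "code d K M \<in> sparse_codes d n K"
proof -
  have "{p. code d K M p \<noteq> 0} \<subseteq> {(i, j). i < d \<and> j < d \<and> M i j \<noteq> 0}"
    by (auto simp: code_def split: if_splits)
  moreover have "finite {(i, j). i < d \<and> j < d \<and> M i j \<noteq> 0}"
    by (rule finite_subset[of _ "{..<d} \<times> {..<d}"]) auto
  ultimately have "card {p. code d K M p \<noteq> 0} \<le> n"
    using assms(2) unfolding nnz_def by (meson card_mono le_trans)
  moreover have "\<bar>\<lfloor>real K * M i j\<rfloor>\<bar> \<le> int K" if "i < d" "j < d" for i j
  proof -
    have "\<bar>real K * M i j\<bar> \<le> real K * 1"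
      unfolding abs_mult using assms(1)[OF that] by (intro mult_mono) auto
    then have "- real K \<le> real K * M i j" "real K * M i j \<le> real K" by auto
    then have "- int K \<le> \<lfloor>real K * M i j\<rfloor>" "\<lfloor>real K * M i j\<rfloor> \<le> int K"
      by (simp add: le_floor_iff, simp add: floor_le_iff)
    then show ?thesis by simp
  qed
  ultimately show ?thesis by (auto simp: sparse_codes_def code_def split: if_splits)
qed

lemma code_eq_close:
  assumes "code d K M = code d K M'" "0 < K" "i < d" "j < d"
  shows "\<bar>M i j - M' i j\<bar> \<le> 1 / real K"
proof -
  have "\<lfloor>real K * M i j\<rfloor> = \<lfloor>real K * M' i j\<rfloor>"
    using fun_cong[OF assms(1), of "(i, j)"] assms(3,4) by (simp add: code_def)
  then have "\<bar>real K * M i j - real K * M' i j\<bar> \<le> 1" by linarith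
  then have "real K * \<bar>M i j - M' i j\<bar> \<le> 1"
    by (simp add: abs_mult flip: right_diff_distrib)
  then show ?thesis using assms(2) by (simp add: field_simps)
qed

section \<open>Perturbation of a normalized secant\<close>

lemma mmult_bound:
  assumes "\<And>l. l < d \<Longrightarrow> \<bar>A i l\<bar> \<le> \<alpha>" "\<And>l. l < d \<Longrightarrow> \<bar>B l j\<bar> \<le> \<beta>" "0 \<le> \<alpha>"
  shows "\<bar>mmult d A B i j\<bar> \<le> real d * \<alpha> * \<beta>"
proof -
  have "\<bar>mmult d A B i j\<bar> \<le> (\<Sum>l<d. \<bar>A i l * B l j\<bar>)" unfolding mmult_def by (rule sum_abs)
  also have "\<dots> \<le> (\<Sum>l<d. \<alpha> * \<beta>)"
    unfolding abs_mult using assms by (intro sum_mono mult_mono) auto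
  finally show ?thesis by simp
qed

abbreviation mmult3 :: "nat \<Rightarrow> (nat \<Rightarrow> nat \<Rightarrow> real) \<Rightarrow> (nat \<Rightarrow> nat \<Rightarrow> real) \<Rightarrow> (nat \<Rightarrow> nat \<Rightarrow> real) \<Rightarrow> nat \<Rightarrow> nat \<Rightarrow> real"
  where "mmult3 d A B C \<equiv> mmult d (mmult d A B) C"

lemma mmult3_bound:
  assumes "\<And>i j. i < d \<Longrightarrow> j < d \<Longrightarrow> \<bar>A i j\<bar> \<le> \<alpha>" "\<And>i j. i < d \<Longrightarrow> j < d \<Longrightarrow> \<bar>B i j\<bar> \<le> \<beta>"
    "\<And>i j. i < d \<Longrightarrow> j < d \<Longrightarrow> \<bar>C i j\<bar> \<le> \<gamma>" "0 \<le> \<alpha>" "0 \<le> \<beta>" "i < d" "j < d"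
  shows "\<bar>mmult3 d A B C i j\<bar> \<le> (real d)\<^sup>2 * \<alpha> * \<beta> * \<gamma>"
proof -
  have "\<bar>mmult3 d A B C i j\<bar> \<le> real d * (real d * \<alpha> * \<beta>) * \<gamma>"
    using assms by (intro mmult_bound) auto
  then show ?thesis by (simp add: power2_eq_square mult_ac)
qed

lemma mmult_msub_left: "mmult d (msub A B) C = msub (mmult d A C) (mmult d B C)"
  by (simp add: mmult_def msub_def fun_eq_iff left_diff_distrib sum_subtractf)

lemma mmult_msub_right: "mmult d A (msub B C) = msub (mmult d A B) (mmult d A C)"
  by (simp add: mmult_def msub_def fun_eq_iff right_diff_distrib sum_subtractf)

lemma mmult_assoc_fun: "mmult d (mmult d A B) C = mmult d A (mmult d B C)"
  by (intro ext mmult_assoc)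

text \<open>The resolvent identity. Besides factoring a secant, it bounds the change of a covariance
  by that of its inverse in \<open>secant_perturbation\<close>.\<close>

lemma inverse_diff:
  assumes "is_inverse d S T" "is_inverse d S' T'" "i < d" "j < d"
  shows "msub S S' i j = mmult3 d S (msub T' T) S' i j"
proof -
  have "mmult3 d S (msub T' T) S' i j = mmult d S (mmult d T' S') i j - mmult d (mmult d S T) S' i j"
    unfolding mmult_msub_right mmult_msub_left by (simp add: msub_def mmult_assoc_fun)
  also have "mmult d S (mmult d T' S') i j = mmult d S idm i j"
    using assms by (intro mmult_cong) (auto simp: is_inverse_def)
  also have "mmult d (mmult d S T) S' i j = mmult d idm S' i j"
    using assms by (intro mmult_cong) (auto simp: is_inverse_def)
  finally show ?thesis using assms(3,4) by (simp add: mmult_idm_left mmult_idm_right msub_def)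
qed

lemma mmult3_diff:
  "mmult3 d A B C i j - mmult3 d A' B' C' i j =
   mmult3 d (msub A A') B C i j + mmult3 d A' (msub B B') C i j + mmult3 d A' B' (msub C C') i j"
  unfolding mmult_msub_left mmult_msub_right by (simp add: msub_def)

text \<open>Recovers the sparse factor from the dense product, and so yields a lower bound for the
  size of the product.\<close>

lemma mmult3_inverse_cancel:
  assumes "is_inverse d S1 T1" "is_inverse d S2 T2" "i < d" "j < d"
  shows "mmult3 d T1 (mmult3 d S1 H S2) T2 i j = H i j"
proof -
  have "mmult3 d T1 (mmult3 d S1 H S2) T2 i j = mmult d (mmult d T1 S1) (mmult d H (mmult d S2 T2)) i j"
    by (simp add: mmult_assoc_fun)
  also have "\<dots> = mmult d idm (mmult d H (mmult d S2 T2)) i j"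
    using assms by (intro mmult_cong) (auto simp: is_inverse_def)
  also have "\<dots> = mmult d H (mmult d S2 T2) i j" by (rule mmult_idm_left[OF assms(3)])
  also have "\<dots> = mmult d H idm i j"
    using assms by (intro mmult_cong) (auto simp: is_inverse_def)
  finally show ?thesis using assms(4) by (simp add: mmult_idm_right)
qed

text \<open>The error is relative to \<open>c\<close>, a bound for the net point. The three factors
  are exchanged one at a time, each exchange costing at most d^4 (b/a) / (K a^2); multiplying by the
  lower bound 1 <= d^2 b^2 c makes this proportional to \<open>c\<close> and the constant free of
  scale.\<close>

lemma secant_perturbation:
  assumes ab: "0 < a" "a \<le> b" and K: "0 < K" and d: "0 < d"
    and inv: "is_inverse d S1 T1" "is_inverse d S2 T2" "is_inverse d S1' T1'" "is_inverse d S2' T2'"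
    and S: "\<And>i j. i < d \<Longrightarrow> j < d \<Longrightarrow> \<bar>S1 i j\<bar> \<le> 1 / a" "\<And>i j. i < d \<Longrightarrow> j < d \<Longrightarrow> \<bar>S2 i j\<bar> \<le> 1 / a"
       "\<And>i j. i < d \<Longrightarrow> j < d \<Longrightarrow> \<bar>S1' i j\<bar> \<le> 1 / a" "\<And>i j. i < d \<Longrightarrow> j < d \<Longrightarrow> \<bar>S2' i j\<bar> \<le> 1 / a"
    and T: "\<And>i j. i < d \<Longrightarrow> j < d \<Longrightarrow> \<bar>T1' i j\<bar> \<le> b" "\<And>i j. i < d \<Longrightarrow> j < d \<Longrightarrow> \<bar>T2' i j\<bar> \<le> b"
    and dT: "\<And>i j. i < d \<Longrightarrow> j < d \<Longrightarrow> \<bar>T1 i j - T1' i j\<bar> \<le> b / K" "\<And>i j. i < d \<Longrightarrow> j < d \<Longrightarrow> \<bar>T2 i j - T2' i j\<bar> \<le> b / K"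
    and H: "\<And>i j. i < d \<Longrightarrow> j < d \<Longrightarrow> \<bar>H i j\<bar> \<le> 1" "\<And>i j. i < d \<Longrightarrow> j < d \<Longrightarrow> \<bar>H' i j\<bar> \<le> 1"
    and dH: "\<And>i j. i < d \<Longrightarrow> j < d \<Longrightarrow> \<bar>H i j - H' i j\<bar> \<le> 1 / K"
    and H1: "\<exists>i<d. \<exists>j<d. \<bar>H' i j\<bar> = 1"
    and c: "\<And>i j. i < d \<Longrightarrow> j < d \<Longrightarrow> \<bar>mmult3 d S1' H' S2' i j\<bar> \<le> c"
    and ij: "i < d" "j < d"
  shows "\<bar>mmult3 d S1 H S2 i j - mmult3 d S1' H' S2' i j\<bar> \<le> 3 * (real d)^6 * (b / a)^3 / K * c"
proof -
  have b: "0 < b" using ab by simp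
  have dS: "\<bar>msub S S' k l\<bar> \<le> (real d)\<^sup>2 * (b / K) / a\<^sup>2"
    if "is_inverse d S T" "is_inverse d S' T'" "k < d" "l < d"
      "\<And>i j. i < d \<Longrightarrow> j < d \<Longrightarrow> \<bar>S i j\<bar> \<le> 1 / a" "\<And>i j. i < d \<Longrightarrow> j < d \<Longrightarrow> \<bar>S' i j\<bar> \<le> 1 / a"
      "\<And>i j. i < d \<Longrightarrow> j < d \<Longrightarrow> \<bar>T i j - T' i j\<bar> \<le> b / K" for S T S' T' k l
  proof -
    have "\<bar>mmult3 d S (msub T' T) S' k l\<bar> \<le> (real d)\<^sup>2 * (1 / a) * (b / K) * (1 / a)"
      using that ab b K by (intro mmult3_bound) (auto simp: msub_def abs_minus_commute)
    then show ?thesis unfolding inverse_diff[OF that(1-4)] by (simp add: power2_eq_square mult_ac)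
  qed
  obtain p q where pq: "p < d" "q < d" "\<bar>H' p q\<bar> = 1" using H1 by blast
  have c0: "0 \<le> c" using c[OF ij] abs_ge_zero order.trans by blast
  have "1 \<le> (real d)\<^sup>2 * b * c * b"
  proof -
    have "\<bar>mmult3 d T1' (mmult3 d S1' H' S2') T2' p q\<bar> \<le> (real d)\<^sup>2 * b * c * b"
      using T c b c0 pq by (intro mmult3_bound) auto
    then show ?thesis using pq mmult3_inverse_cancel[OF inv(3,4) pq(1,2), of H'] by simp
  qed
  then have low: "1 \<le> (real d)\<^sup>2 * b\<^sup>2 * c" by (simp add: power2_eq_square mult_ac)
  let ?u = "(real d)\<^sup>2 * ((real d)\<^sup>2 * (b / K) / a\<^sup>2) * (1 / a)"
  let ?w = "(real d)^4 * (b / a) / K / a\<^sup>2"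
  have 1: "\<bar>mmult3 d (msub S1 S1') H S2 i j\<bar> \<le> (real d)\<^sup>2 * ((real d)\<^sup>2 * (b / K) / a\<^sup>2) * 1 * (1 / a)"
    using dS[OF inv(1,3)] S(1,3) dT(1) H(1) S(2) ij ab b K by (intro mmult3_bound) auto
  have 3: "\<bar>mmult3 d S1' H' (msub S2 S2') i j\<bar> \<le> (real d)\<^sup>2 * (1 / a) * 1 * ((real d)\<^sup>2 * (b / K) / a\<^sup>2)"
    using dS[OF inv(2,4)] S(2,4) dT(2) H(2) S(3) ij ab b K by (intro mmult3_bound) auto
  have 2: "\<bar>mmult3 d S1' (msub H H') S2 i j\<bar> \<le> (real d)\<^sup>2 * (1 / a) * (1 / K) * (1 / a)"
    using S(2,3) dH ij ab b K by (intro mmult3_bound) (auto simp: msub_def)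
  have e: "(real d)\<^sup>2 * ((real d)\<^sup>2 * (b / K) / a\<^sup>2) * 1 * (1 / a) = ?w"
    "(real d)\<^sup>2 * (1 / a) * 1 * ((real d)\<^sup>2 * (b / K) / a\<^sup>2) = ?w"
    by (simp_all add: power2_eq_square power4_eq_xxxx mult_ac)
  \<comment> \<open>Exchanging the middle factor involves no inversion and is cheaper; d >= 1 and b
    / a >= 1 raise it to the size of the other two terms.\<close>
  have "(real d)\<^sup>2 * (1 / a) * (1 / K) * (1 / a) = (real d)\<^sup>2 * 1 / K / a\<^sup>2"
    by (simp add: power2_eq_square)
  also have "\<dots> \<le> ?w"
    using ab d K by (intro divide_right_mono mult_mono power_increasing) (auto simp: le_divide_eq)
  finally have e2: "(real d)\<^sup>2 * (1 / a) * (1 / K) * (1 / a) \<le> ?w" .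
  have "\<bar>mmult3 d S1 H S2 i j - mmult3 d S1' H' S2' i j\<bar> \<le> 3 * ?w"
    unfolding mmult3_diff using 1 2 3 e2 unfolding e by linarith
  also have "\<dots> \<le> 3 * ?w * ((real d)\<^sup>2 * b\<^sup>2 * c)"
    using mult_left_mono[OF low, of "3 * ?w"] ab b K by simp
  also have "\<dots> = 3 * (real d)^6 * (b / a)^3 / K * c"
    by (simp add: power_divide power2_eq_square power3_eq_cube power4_eq_xxxx eval_nat_numeral mult_ac)
  finally show ?thesis .
qed

text \<open>Collects what \<open>model_set_bounds\<close> gives for an inverse covariance (precision
  matrix) \<open>T\<close> of \<open>S\<close>, as one predicate from which \<open>T\<close> can be
  chosen.\<close>

definition precision :: "nat \<Rightarrow> nat \<Rightarrow> real \<Rightarrow> real \<Rightarrow> (nat \<Rightarrow> nat \<Rightarrow> real) \<Rightarrow> (nat \<Rightarrow> nat \<Rightarrow> real) \<Rightarrow> bool"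
  where "precision d n b c S T \<longleftrightarrow> symmetric d S \<and> is_inverse d S T \<and> nnz d T \<le> n \<and>
    (\<forall>i<d. \<forall>j<d. \<bar>T i j\<bar> \<le> b) \<and> (\<forall>i<d. \<forall>j<d. \<bar>S i j\<bar> \<le> c)"

lemma nnz_msub_le: "nnz d (msub A B) \<le> nnz d A + nnz d B"
proof -
  have fin: "finite {(i, j). i < d \<and> j < d \<and> M i j \<noteq> 0}" for M :: "nat \<Rightarrow> nat \<Rightarrow> real"
    by (rule finite_subset[of _ "{..<d} \<times> {..<d}"]) auto
  have "nnz d (msub A B) \<le> card ({(i, j). i < d \<and> j < d \<and> A i j \<noteq> 0} \<union> {(i, j). i < d \<and> j < d \<and> B i j \<noteq> 0})"
    unfolding nnz_def by (intro card_mono finite_UnI fin) (auto simp: msub_def)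
  also have "\<dots> \<le> nnz d A + nnz d B" unfolding nnz_def by (rule card_Un_le)
  finally show ?thesis .
qed

lemma nnz_scale_le: "nnz d (\<lambda>i j. M i j / c) \<le> nnz d M"
  unfolding nnz_def
  by (intro card_mono finite_subset[of "{(i, j). i < d \<and> j < d \<and> M i j \<noteq> 0}" "{..<d} \<times> {..<d}"]) auto

definition max_abs :: "nat \<Rightarrow> (nat \<Rightarrow> nat \<Rightarrow> real) \<Rightarrow> real" where
  "max_abs d M = Max ((\<lambda>(i, j). \<bar>M i j\<bar>) ` ({..<d} \<times> {..<d}))"

lemma max_abs_ge: "i < d \<Longrightarrow> j < d \<Longrightarrow> \<bar>M i j\<bar> \<le> max_abs d M"
  unfolding max_abs_def by (intro Max_ge) force+

lemma max_abs_attained: "0 < d \<Longrightarrow> \<exists>i<d. \<exists>j<d. \<bar>M i j\<bar> = max_abs d M"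
proof -
  assume "0 < d"
  then have "(\<lambda>(i, j). \<bar>M i j\<bar>) ` ({..<d} \<times> {..<d}) \<noteq> {}" by auto
  then have "max_abs d M \<in> (\<lambda>(i, j). \<bar>M i j\<bar>) ` ({..<d} \<times> {..<d})"
    unfolding max_abs_def by (intro Max_in) auto
  then show ?thesis by force
qed

text \<open>The net consists of one normalized secant \<open>S\<^sub>1 H S\<^sub>2 = (S\<^sub>1 - S\<^sub>2) / h\<close> for every attained
  rounding of the sparse triple \<open>(T\<^sub>1, T\<^sub>2, H)\<close>, where \<open>T\<^sub>i\<close> is the inverse of \<open>S\<^sub>i\<close> and
  \<open>H = (T\<^sub>2 - T\<^sub>1) / h\<close> has largest entry 1.\<close>

lemma secant_net:
  assumes ab: "0 < a" "a \<le> b" and d: "0 < d" and K: "0 < K"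
  obtains Net where "finite Net" "card Net \<le> (d\<^sup>2 * (2 * K + 1)) ^ (4 * (d + 2 * k))"
    "\<And>N. N \<in> Net \<Longrightarrow> symmetric d N"
    "\<And>S1 S2. S1 \<in> model_set d k a b \<Longrightarrow> S2 \<in> model_set d k a b \<Longrightarrow>
      (\<forall>i<d. \<forall>j<d. msub S1 S2 i j = 0) \<or>
      (\<exists>h N N'. 0 < h \<and> symmetric d N \<and> N' \<in> Net \<and> (\<forall>i<d. \<forall>j<d. msub S1 S2 i j = h * N i j) \<and>
        (\<forall>c. (\<forall>i<d. \<forall>j<d. \<bar>N' i j\<bar> \<le> c) \<longrightarrow>
          (\<forall>i<d. \<forall>j<d. \<bar>msub N N' i j\<bar> \<le> 3 * (real d)^6 * (b / a)^3 / real K * c)))"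
proof -
  let ?n = "d + 2 * k" and ?X = "model_set d k a b"
  have b: "0 < b" using ab by simp
  \<comment> \<open>An inverse is determined only on indices below \<open>d\<close>, so one is
    chosen for each \<open>S\<close>.\<close>
  define \<Theta> where "\<Theta> S = (SOME T. precision d ?n b (1 / a) S T)" for S
  have \<Theta>: "precision d ?n b (1 / a) S (\<Theta> S)" if SX: "S \<in> ?X" for S
  proof -
    obtain T where "symmetric d S" "symmetric d T" "is_inverse d S T" "nnz d T \<le> ?n"
      "\<And>i j. i < d \<Longrightarrow> j < d \<Longrightarrow> \<bar>T i j\<bar> \<le> b" "\<And>i j. i < d \<Longrightarrow> j < d \<Longrightarrow> \<bar>S i j\<bar> \<le> 1 / a"
      by (rule model_set_bounds[OF SX d ab(1)]) (rule that)
    then have "precision d ?n b (1 / a) S T" by (simp add: precision_def)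
    then show ?thesis unfolding \<Theta>_def by (rule someI[of "precision d ?n b (1 / a) S"])
  qed
  define h where "h p = max_abs d (msub (\<Theta> (snd p)) (\<Theta> (fst p)))" for p
  define H where "H p = (\<lambda>i j. msub (\<Theta> (snd p)) (\<Theta> (fst p)) i j / h p)" for p
  define N where "N p = (\<lambda>i j. msub (fst p) (snd p) i j / h p)" for p
  define P where "P = {p \<in> ?X \<times> ?X. 0 < h p}"
  \<comment> \<open>Division by \<open>b\<close> brings the entries into [-1, 1], the range that
    \<open>code_in_sparse_codes\<close> expects; those of \<open>H p\<close> are there by
    normalization.\<close>
  define cd where "cd p = (code d K (\<lambda>i j. \<Theta> (fst p) i j / b), code d K (\<lambda>i j. \<Theta> (snd p) i j / b), code d K (H p))" for p
  \<comment> \<open>The normalized difference may have twice as many nonzero entries; n + n + 2n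
    explains the exponent 4n.\<close>
  let ?C = "sparse_codes d ?n K \<times> sparse_codes d ?n K \<times> sparse_codes d (2 * ?n) K"
  have H1: "\<bar>H p i j\<bar> \<le> 1" if "p \<in> P" "i < d" "j < d" for p i j
    using max_abs_ge[OF that(2,3), of "msub (\<Theta> (snd p)) (\<Theta> (fst p))"] that(1)
    by (simp add: H_def P_def h_def)
  have Hmax: "\<exists>i<d. \<exists>j<d. \<bar>H p i j\<bar> = 1" if "p \<in> P" for p
  proof -
    obtain i j where ij: "i < d" "j < d" "\<bar>msub (\<Theta> (snd p)) (\<Theta> (fst p)) i j\<bar> = h p"
      unfolding h_def using max_abs_attained[OF d] by blast
    then have "\<bar>H p i j\<bar> = 1" using that by (simp add: H_def P_def)
    then show ?thesis using ij by blast
  qed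
  have NH: "N p i j = mmult3 d (fst p) (H p) (snd p) i j" if "p \<in> P" "i < d" "j < d" for p i j
  proof -
    have "is_inverse d (fst p) (\<Theta> (fst p))" "is_inverse d (snd p) (\<Theta> (snd p))"
      using that(1) \<Theta> by (auto simp: P_def precision_def)
    from inverse_diff[OF this that(2,3)]
    show ?thesis by (simp add: N_def H_def mmult_def sum_divide_distrib sum_distrib_right)
  qed
  have cdC: "cd ` P \<subseteq> ?C"
  proof
    fix x assume "x \<in> cd ` P"
    then obtain S1 S2 where x: "x = cd (S1, S2)" and p: "(S1, S2) \<in> P" by auto
    then have pr: "precision d ?n b (1 / a) S1 (\<Theta> S1)" "precision d ?n b (1 / a) S2 (\<Theta> S2)"
      using \<Theta> by (auto simp: P_def)
    have c: "code d K (\<lambda>i j. \<Theta> S i j / b) \<in> sparse_codes d ?n K" if "precision d ?n b (1 / a) S (\<Theta> S)" for S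
    proof (rule code_in_sparse_codes)
      show "\<bar>\<Theta> S i j / b\<bar> \<le> 1" if "i < d" "j < d" for i j
        using \<open>precision d ?n b (1 / a) S (\<Theta> S)\<close> that b by (simp add: precision_def)
      show "nnz d (\<lambda>i j. \<Theta> S i j / b) \<le> ?n"
        using nnz_scale_le[of d "\<Theta> S" b] that by (simp add: precision_def)
    qed
    have "nnz d (H (S1, S2)) \<le> 2 * ?n"
      using nnz_scale_le[of d "msub (\<Theta> S2) (\<Theta> S1)" "h (S1, S2)"] nnz_msub_le[of d "\<Theta> S2" "\<Theta> S1"] pr
      by (simp add: H_def precision_def)
    then have "code d K (H (S1, S2)) \<in> sparse_codes d (2 * ?n) K"
      using H1[OF p] by (intro code_in_sparse_codes) auto
    then show "x \<in> ?C" using c pr by (simp add: x cd_def)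
  qed
  have finC: "finite ?C" using sparse_codes_card(1)[OF d] by auto
  have cardC: "card ?C \<le> (d\<^sup>2 * (2 * K + 1)) ^ (4 * ?n)"
  proof -
    let ?M = "d\<^sup>2 * (2 * K + 1)"
    have "card ?C \<le> ?M ^ ?n * (?M ^ ?n * ?M ^ (2 * ?n))"
      unfolding card_cartesian_product by (intro mult_le_mono sparse_codes_card(2)[OF d])
    also have "\<dots> = ?M ^ (4 * ?n)" by (simp flip: power_add)
    finally show ?thesis .
  qed
  \<comment> \<open>A rounded triple need not come from model matrices and their inverses, so each
    attained code is represented by a genuine pair, to which the entry bounds apply.\<close>
  define rep where "rep c = (SOME p. p \<in> P \<and> cd p = c)" for c
  have rep: "rep c \<in> P \<and> cd (rep c) = c" if "c \<in> cd ` P" for c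
    unfolding rep_def by (rule someI_ex) (use that in auto)
  have symN: "symmetric d (N p)" if "p \<in> P" for p
  proof -
    have "symmetric d (fst p)" "symmetric d (snd p)" using that \<Theta> by (auto simp: P_def precision_def)
    then show ?thesis by (simp add: symmetric_def N_def msub_def)
  qed
  show ?thesis
  proof (rule that[of "(\<lambda>c. N (rep c)) ` cd ` P"])
    have finP: "finite (cd ` P)" by (rule finite_subset[OF cdC finC])
    then show "finite ((\<lambda>c. N (rep c)) ` cd ` P)" by simp
    have "card ((\<lambda>c. N (rep c)) ` cd ` P) \<le> card (cd ` P)" by (rule card_image_le[OF finP])
    also have "\<dots> \<le> card ?C" by (rule card_mono[OF finC cdC])
    finally show "card ((\<lambda>c. N (rep c)) ` cd ` P) \<le> (d\<^sup>2 * (2 * K + 1)) ^ (4 * ?n)" using cardC by simp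
    show "symmetric d M" if "M \<in> (\<lambda>c. N (rep c)) ` cd ` P" for M
      using that rep symN by blast
    fix S1 S2 assume S: "S1 \<in> ?X" "S2 \<in> ?X"
    let ?p = "(S1, S2)"
    show "(\<forall>i<d. \<forall>j<d. msub S1 S2 i j = 0) \<or>
      (\<exists>h M M'. 0 < h \<and> symmetric d M \<and> M' \<in> (\<lambda>c. N (rep c)) ` cd ` P \<and> (\<forall>i<d. \<forall>j<d. msub S1 S2 i j = h * M i j) \<and>
        (\<forall>c. (\<forall>i<d. \<forall>j<d. \<bar>M' i j\<bar> \<le> c) \<longrightarrow>
          (\<forall>i<d. \<forall>j<d. \<bar>msub M M' i j\<bar> \<le> 3 * (real d)^6 * (b / a)^3 / real K * c)))"
    proof (cases "0 < h ?p")
      \<comment> \<open>A zero maximum means that the inverses agree, so by the resolvent identity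
        the secant vanishes. It cannot be normalized and forms the first alternative.\<close>
      case False
      have "is_inverse d S1 (\<Theta> S1)" "is_inverse d S2 (\<Theta> S2)"
        using S \<Theta> by (auto simp: precision_def)
      moreover have z: "msub (\<Theta> S2) (\<Theta> S1) i j = 0" if "i < d" "j < d" for i j
        using max_abs_ge[OF that, of "msub (\<Theta> S2) (\<Theta> S1)"] False by (simp add: h_def)
      ultimately have "msub S1 S2 i j = 0" if "i < d" "j < d" for i j
        using inverse_diff[of d S1 "\<Theta> S1" S2 "\<Theta> S2" i j] that by (simp add: mmult_def)
      then show ?thesis by blast
    next
      case True
      then have p: "?p \<in> P" using S by (simp add: P_def)
      define q where "q = rep (cd ?p)"
      have q: "q \<in> P" "cd q = cd ?p" using rep[of "cd ?p"] p by (auto simp: q_def)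
      have pr: "precision d ?n b (1 / a) S1 (\<Theta> S1)" "precision d ?n b (1 / a) S2 (\<Theta> S2)"
        "precision d ?n b (1 / a) (fst q) (\<Theta> (fst q))" "precision d ?n b (1 / a) (snd q) (\<Theta> (snd q))"
        using S q(1) \<Theta> by (auto simp: P_def)
      have close: "\<bar>\<Theta> A i j - \<Theta> B i j\<bar> \<le> b / real K"
        if "code d K (\<lambda>i j. \<Theta> A i j / b) = code d K (\<lambda>i j. \<Theta> B i j / b)" "i < d" "j < d" for A B i j
        using code_eq_close[OF that(1) K that(2,3)] b K
        by (simp add: field_simps flip: diff_divide_distrib)
      have "\<bar>msub (N ?p) (N q) i j\<bar> \<le> 3 * (real d)^6 * (b / a)^3 / real K * c"
        if c: "\<forall>i<d. \<forall>j<d. \<bar>N q i j\<bar> \<le> c" and ij: "i < d" "j < d" for c i j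
      proof -
        have "\<bar>mmult3 d S1 (H ?p) S2 i j - mmult3 d (fst q) (H q) (snd q) i j\<bar> \<le> 3 * (real d)^6 * (b / a)^3 / real K * c"
        proof (rule secant_perturbation[OF ab _ d])
          show "is_inverse d S1 (\<Theta> S1)" "is_inverse d S2 (\<Theta> S2)" "is_inverse d (fst q) (\<Theta> (fst q))"
            "is_inverse d (snd q) (\<Theta> (snd q))"
            using pr by (auto simp: precision_def)
          show "\<bar>\<Theta> S1 i j - \<Theta> (fst q) i j\<bar> \<le> b / real K" "\<bar>\<Theta> S2 i j - \<Theta> (snd q) i j\<bar> \<le> b / real K"
            if "i < d" "j < d" for i j
            using q(2) that by (auto intro!: close simp: cd_def)
          show "\<bar>H ?p i j - H q i j\<bar> \<le> 1 / real K" if "i < d" "j < d" for i j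
            using q(2) that by (auto intro!: code_eq_close[OF _ K] simp: cd_def)
          show "\<exists>i<d. \<exists>j<d. \<bar>H q i j\<bar> = 1" by (rule Hmax[OF q(1)])
          show "\<bar>mmult3 d (fst q) (H q) (snd q) i j\<bar> \<le> c" if "i < d" "j < d" for i j
            using c[rule_format, OF that] unfolding NH[OF q(1) that] .
        qed (use pr H1[OF p] H1[OF q(1)] K ij in \<open>auto simp: precision_def\<close>)
        then show ?thesis using NH[OF p ij] NH[OF q(1) ij] by (simp add: msub_def)
      qed
      moreover have "\<forall>i<d. \<forall>j<d. msub S1 S2 i j = h ?p * N ?p i j"
        using True by (simp add: N_def)
      moreover have "N q \<in> (\<lambda>c. N (rep c)) ` cd ` P" using p by (auto simp: q_def)
      ultimately show ?thesis using True symN[OF p] by blast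
    qed
  qed
qed

section \<open>Gaussian quadratic forms\<close>

lemma double_sum_lessThan_Suc:
  "(\<Sum>i<Suc n. \<Sum>j<Suc n. f i j) = (\<Sum>i<n. \<Sum>j<n. f i j) + (\<Sum>i<n. f i n) + (\<Sum>j<n. f n j) + (f n n :: real)"
  by (simp add: sum.distrib)

text \<open>In the last coordinate the form is a quadratic polynomial whose linear coefficient is a
  linear form in the others, the shape treated by the one-dimensional integrals below.\<close>

lemma qform_Suc:
  assumes "symmetric (Suc n) M"
  shows "qform (Suc n) M (x(n := y)) =
    qform n M x + 2 * y * (\<Sum>i<n. M i n * x i) + M n n * y\<^sup>2"
proof -
  have "M n j = M j n" if "j < n" for j
    using assms that by (simp add: symmetric_def)
  then have "(\<Sum>j<n. y * M n j * x j) = (\<Sum>i<n. x i * M i n * y)"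
    by (intro sum.cong) auto
  moreover have "(\<Sum>i<n. x i * M i n * y) = y * (\<Sum>i<n. M i n * x i)"
    by (simp add: sum_distrib_left mult_ac)
  ultimately show ?thesis
    by (simp add: qform_def double_sum_lessThan_Suc power2_eq_square sum.distrib)
qed

definition frob2 :: "nat \<Rightarrow> (nat \<Rightarrow> nat \<Rightarrow> real) \<Rightarrow> real" where
  "frob2 d M = (\<Sum>i<d. \<Sum>j<d. (M i j)\<^sup>2)"

definition mtrace :: "nat \<Rightarrow> (nat \<Rightarrow> nat \<Rightarrow> real) \<Rightarrow> real" where
  "mtrace d M = (\<Sum>i<d. M i i)"

text \<open>The standard deviation is a parameter separate from the dimension: in
  \<open>Lambda_G\<close> it depends on \<open>d\<close>, which would block induction on the number
  of coordinates.\<close>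

definition gauss_d :: "real \<Rightarrow> nat \<Rightarrow> (nat \<Rightarrow> real) measure" where
  "gauss_d \<sigma> d = PiM {..<d} (\<lambda>_. density lborel (normal_density 0 \<sigma>))"

lemma frob2_nonneg: "0 \<le> frob2 d M"
  by (simp add: frob2_def sum_nonneg)

lemma frob2_Suc:
  assumes "symmetric (Suc n) M"
  shows "frob2 (Suc n) M = frob2 n M + 2 * (\<Sum>i<n. (M i n)\<^sup>2) + (M n n)\<^sup>2"
proof -
  have "(\<Sum>j<n. (M n j)\<^sup>2) = (\<Sum>i<n. (M i n)\<^sup>2)"
    using assms by (intro sum.cong) (auto simp: symmetric_def)
  then show ?thesis by (simp add: frob2_def double_sum_lessThan_Suc sum.distrib)
qed

lemma measurable_component_gauss [measurable]:
  "i < d \<Longrightarrow> (\<lambda>x. x i) \<in> borel_measurable (PiM {..<d} (\<lambda>_. density lborel f))"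
proof -
  assume "i < d"
  then have "(\<lambda>x. x i) \<in> measurable (PiM {..<d} (\<lambda>_. density lborel f)) (density lborel f)"
    by (intro measurable_component_singleton) auto
  then show ?thesis by simp
qed

lemma qform_measurable_PiM:
  assumes "\<And>i. sets (N i) = sets borel"
  shows "qform d M \<in> borel_measurable (PiM {..<d} N)"
proof -
  have 1: "(\<lambda>x. x i) \<in> borel_measurable (PiM {..<d} N)" if "i < d" for i
    using measurable_component_singleton[of i "{..<d}" N] that assms[of i]
    by (simp cong: measurable_cong_sets)
  show ?thesis unfolding qform_def[abs_def]
    by (intro borel_measurable_sum borel_measurable_times borel_measurable_const 1) auto
qed

lemma qform_measurable_gauss [measurable]: "qform d M \<in> borel_measurable (gauss_d \<sigma> d)"
  unfolding gauss_d_def by (rule qform_measurable_PiM) simp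

lemma linform_measurable_gauss [measurable]:
  "(\<lambda>x. \<Sum>i<d. v i * x i) \<in> borel_measurable (gauss_d \<sigma> d)"
  unfolding gauss_d_def by measurable

lemma nn_integral_gauss_Suc:
  assumes "0 < \<sigma>" "f \<in> borel_measurable (gauss_d \<sigma> (Suc n))"
  shows "(\<integral>\<^sup>+x. f x \<partial>gauss_d \<sigma> (Suc n)) =
    (\<integral>\<^sup>+x. (\<integral>\<^sup>+y. f (x(n := y)) \<partial>density lborel (normal_density 0 \<sigma>)) \<partial>gauss_d \<sigma> n)"
proof -
  interpret prob_space "density lborel (normal_density 0 \<sigma>)"
    by (rule prob_space_normal_density) (rule assms)
  interpret product_sigma_finite "\<lambda>_. density lborel (normal_density 0 \<sigma>)"
    by standard
  show ?thesis
    using assms(2) unfolding gauss_d_def lessThan_Suc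
    by (subst product_nn_integral_insert) auto
qed

text \<open>Completing the square turns the integrand into a multiple of the normal density with
  variance \<open>\<tau>2\<close> and mean \<open>2 * w * \<tau>2\<close>; the second hypothesis
  makes this variance positive.\<close>

lemma gauss_exp_1d:
  fixes \<sigma> \<mu> w :: real
  assumes "0 < \<sigma>" "2 * \<mu> * \<sigma>\<^sup>2 < 1"
  defines "\<tau>2 \<equiv> \<sigma>\<^sup>2 / (1 - 2 * \<mu> * \<sigma>\<^sup>2)"
  shows "(\<integral>\<^sup>+y. ennreal (exp (c + 2 * y * w + \<mu> * y\<^sup>2)) \<partial>density lborel (normal_density 0 \<sigma>))
    = ennreal (exp c * (exp (2 * w\<^sup>2 * \<tau>2) / sqrt (1 - 2 * \<mu> * \<sigma>\<^sup>2)))"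
proof -
  define D where "D = 1 - 2 * \<mu> * \<sigma>\<^sup>2"
  define \<tau> where "\<tau> = sqrt \<tau>2"
  have D: "D > 0" using assms by (simp add: D_def)
  have t2: "\<tau>2 = \<sigma>\<^sup>2 / D" by (simp add: \<tau>2_def D_def)
  have t2p: "\<tau>2 > 0" using D assms by (simp add: t2)
  have t: "\<tau> > 0" "\<tau>\<^sup>2 = \<tau>2" using t2p by (auto simp: \<tau>_def)
  let ?K = "exp c * (exp (2 * w\<^sup>2 * \<tau>2) / sqrt D)"
  have eq: "normal_density 0 \<sigma> y * exp (c + 2 * y * w + \<mu> * y\<^sup>2) =
     ?K * normal_density (2 * w * \<tau>2) \<tau> y" for y
  proof -
    have e1: "- (y\<^sup>2 / (2 * \<sigma>\<^sup>2)) + (c + 2 * y * w + \<mu> * y\<^sup>2) =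
       c + 2 * w\<^sup>2 * \<tau>2 - (y - 2 * w * \<tau>2)\<^sup>2 / (2 * \<tau>2)"
    proof -
      have m: "\<mu> = (1 - D) / (2 * \<sigma>\<^sup>2)" using assms(1) by (simp add: D_def field_simps)
      have "(y - 2 * w * \<tau>2)\<^sup>2 / (2 * \<tau>2) = y\<^sup>2 / (2 * \<tau>2) - 2 * w * y + 2 * w\<^sup>2 * \<tau>2"
        using t2p by (simp add: field_simps power2_eq_square)
      moreover have "y\<^sup>2 / (2 * \<tau>2) = y\<^sup>2 * D / (2 * \<sigma>\<^sup>2)"
        by (simp add: t2)
      moreover have "\<mu> * y\<^sup>2 = y\<^sup>2 / (2 * \<sigma>\<^sup>2) - y\<^sup>2 * D / (2 * \<sigma>\<^sup>2)"
        unfolding m using assms(1) by (simp add: field_simps)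
      ultimately show ?thesis by (simp add: algebra_simps)
    qed
    have e2: "1 / sqrt (2 * pi * \<sigma>\<^sup>2) = 1 / sqrt D * (1 / sqrt (2 * pi * \<tau>2))"
      using D assms(1) by (simp add: t2 real_sqrt_mult real_sqrt_divide)
    have "normal_density 0 \<sigma> y * exp (c + 2 * y * w + \<mu> * y\<^sup>2) =
      1 / sqrt (2 * pi * \<sigma>\<^sup>2) * exp (- (y\<^sup>2 / (2 * \<sigma>\<^sup>2)) + (c + 2 * y * w + \<mu> * y\<^sup>2))"
      unfolding normal_density_def mult.assoc mult_exp_exp by simp
    also have "\<dots> = 1 / sqrt D * (1 / sqrt (2 * pi * \<tau>2)) *
       (exp c * exp (2 * w\<^sup>2 * \<tau>2) * exp (- (y - 2 * w * \<tau>2)\<^sup>2 / (2 * \<tau>2)))"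
      unfolding e1 e2 by (simp add: exp_add[symmetric] exp_diff)
    also have "\<dots> = ?K * normal_density (2 * w * \<tau>2) \<tau> y"
      by (simp add: normal_density_def t(2))
    finally show ?thesis .
  qed
  have K: "0 \<le> ?K" using D by simp
  have "(\<integral>\<^sup>+y. ennreal (exp (c + 2 * y * w + \<mu> * y\<^sup>2)) \<partial>density lborel (normal_density 0 \<sigma>))
    = (\<integral>\<^sup>+y. ennreal (normal_density 0 \<sigma> y) * ennreal (exp (c + 2 * y * w + \<mu> * y\<^sup>2)) \<partial>lborel)"
    by (subst nn_integral_density) auto
  also have "\<dots> = (\<integral>\<^sup>+y. ennreal ?K * ennreal (normal_density (2 * w * \<tau>2) \<tau> y) \<partial>lborel)"
    using K by (simp add: ennreal_mult'[symmetric] eq)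
  also have "\<dots> = ennreal ?K * (\<integral>\<^sup>+y. ennreal (normal_density (2 * w * \<tau>2) \<tau> y) \<partial>lborel)"
    by (rule nn_integral_cmult) auto
  also have "(\<integral>\<^sup>+y. ennreal (normal_density (2 * w * \<tau>2) \<tau> y) \<partial>lborel) = 1"
    using prob_space.emeasure_space_1[OF prob_space_normal_density[OF t(1), of "2 * w * \<tau>2"]]
    by (simp add: emeasure_density)
  finally show ?thesis by (simp add: D_def)
qed

text \<open>After squaring, this follows from exp x >= 1 + x, because (1 - 2 \<mu>) (1 + 2 \<mu> + 8
  \<mu>^2) = 1 + 4 \<mu>^2 - 16 \<mu>^3 and the cubic term is at most \<mu>^2 in modulus.\<close>

lemma inverse_sqrt_le_exp:
  fixes \<mu> :: real
  assumes "\<bar>\<mu>\<bar> \<le> 1/16"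
  shows "1 / sqrt (1 - 2 * \<mu>) \<le> exp (\<mu> + 4 * \<mu>\<^sup>2)"
proof -
  have "0 \<le> \<mu>\<^sup>2 * (1 / 16 - \<mu>)" "0 \<le> \<mu>\<^sup>2 * (1/16 + \<mu>)"
    using assms by (auto intro!: mult_nonneg_nonneg)
  then have "\<bar>\<mu>^3\<bar> \<le> \<mu>\<^sup>2 / 16" by (simp add: algebra_simps power2_eq_square power3_eq_cube)
  then have "1 \<le> (1 - 2 * \<mu>) * (1 + (2 * \<mu> + 8 * \<mu>\<^sup>2))"
    by (simp add: algebra_simps power2_eq_square power3_eq_cube)
  also have "\<dots> \<le> (1 - 2 * \<mu>) * exp (2 * \<mu> + 8 * \<mu>\<^sup>2)"
    using assms by (intro mult_left_mono exp_ge_add_one_self) auto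
  finally have "sqrt 1 \<le> sqrt ((1 - 2 * \<mu>) * exp (2 * \<mu> + 8 * \<mu>\<^sup>2))"
    by (rule real_sqrt_le_mono)
  also have "\<dots> = sqrt (1 - 2 * \<mu>) * sqrt ((exp (\<mu> + 4 * \<mu>\<^sup>2))\<^sup>2)"
    unfolding exp_double[symmetric] by (simp add: real_sqrt_mult distrib_left)
  finally show ?thesis
    using assms by (simp add: field_simps abs_le_iff)
qed

lemma qform_square_le_frob2: "(\<Sum>i<n. \<Sum>j<n. M i j * (v i * v j))\<^sup>2 \<le> frob2 n M * (\<Sum>i<n. (v i)\<^sup>2)\<^sup>2"
proof -
  have "(\<Sum>p\<in>{..<n}\<times>{..<n}. M (fst p) (snd p) * (v (fst p) * v (snd p)))\<^sup>2 \<le>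
    (\<Sum>p\<in>{..<n}\<times>{..<n}. (M (fst p) (snd p))\<^sup>2) * (\<Sum>p\<in>{..<n}\<times>{..<n}. (v (fst p) * v (snd p))\<^sup>2)"
    by (rule Cauchy_Schwarz_ineq_sum)
  then show ?thesis
    by (simp add: frob2_def sum.cartesian_product split_def power_mult_distrib
      power2_eq_square[of "\<Sum>i<n. (v i)\<^sup>2"] sum_product)
qed

text \<open>Integrating out the last coordinate replaces \<open>M\<close> by a rank-one update \<open>M'\<close> of its leading
  block; the constants 4 and 1/256 are chosen so that the bound survives this step.\<close>

lemma gauss_mgf:
  assumes "0 < \<sigma>" "symmetric n M" "\<sigma>^4 * frob2 n M \<le> 1/256"
  shows "(\<integral>\<^sup>+x. ennreal (exp (qform n M x)) \<partial>gauss_d \<sigma> n) \<le>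
    ennreal (exp (\<sigma>\<^sup>2 * mtrace n M + 4 * \<sigma>^4 * frob2 n M))"
  using assms(2,3)
proof (induction n arbitrary: M)
  case 0
  show ?case by (simp add: qform_def mtrace_def frob2_def gauss_d_def PiM_empty)
next
  case (Suc n)
  define V where "V = (\<Sum>i<n. (M i n)\<^sup>2)"
  define \<mu> where "\<mu> = M n n"
  \<comment> \<open>Twice the variance in \<open>gauss_exp_1d\<close>, whose exponent
    \<open>2 * w^2 * \<tau>2\<close> thereby becomes \<open>s * w^2\<close>, a rank-one form in the
    remaining coordinates.\<close>
  define s where "s = 2 * (\<sigma>\<^sup>2 / (1 - 2 * \<mu> * \<sigma>\<^sup>2))"
  define M' where "M' = (\<lambda>i j. M i j + s * (M i n * M j n))"
  define u where "u = \<mu> * \<sigma>\<^sup>2"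
  have s4: "\<sigma>^4 = \<sigma>\<^sup>2 * \<sigma>\<^sup>2" by (simp add: power2_eq_square power4_eq_xxxx)
  have V0: "0 \<le> V" by (simp add: V_def sum_nonneg)
  have F: "frob2 (Suc n) M = frob2 n M + 2 * V + \<mu>\<^sup>2"
    using frob2_Suc[OF Suc.prems(1)] by (simp add: V_def \<mu>_def)
  have F1: "\<sigma>^4 * frob2 n M + 2 * (\<sigma>^4 * V) + u\<^sup>2 \<le> 1/256"
    using Suc.prems(2) by (simp add: F u_def s4 algebra_simps power2_eq_square)
  have nn: "0 \<le> \<sigma>^4 * frob2 n M" "0 \<le> \<sigma>^4 * V"
    using V0 frob2_nonneg by auto
  have "u\<^sup>2 \<le> (1/16)\<^sup>2" using F1 nn by (simp add: power2_eq_square)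
  then have u: "\<bar>u\<bar> \<le> 1/16" by (simp add: abs_le_square_iff[symmetric])
  have sv: "s = 2 * \<sigma>\<^sup>2 / (1 - 2 * u)" by (simp add: s_def u_def)
  have s0: "0 \<le> s" using u by (simp add: sv)
  have s1: "s \<le> 4 * \<sigma>\<^sup>2"
    using u assms(1) by (simp add: sv divide_le_eq) (auto simp: abs_le_iff)
  have sym': "symmetric n M'"
    using Suc.prems(1) by (simp add: symmetric_def M'_def)
  define X where "X = (\<Sum>i<n. \<Sum>j<n. M i j * (M i n * M j n))"
  have FM': "frob2 n M' = frob2 n M + 2 * s * X + s\<^sup>2 * V\<^sup>2"
  proof -
    have "(M' i j)\<^sup>2 = (M i j)\<^sup>2 + 2 * s * (M i j * (M i n * M j n)) + s\<^sup>2 * ((M i n)\<^sup>2 * (M j n)\<^sup>2)" for i j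
      by (simp add: M'_def power2_eq_square algebra_simps)
    moreover have "V\<^sup>2 = (\<Sum>i<n. \<Sum>j<n. (M i n)\<^sup>2 * (M j n)\<^sup>2)"
      by (simp add: V_def power2_eq_square[of "sum _ _"] sum_product)
    ultimately show ?thesis
      by (simp add: frob2_def sum.distrib sum_distrib_left[symmetric] X_def)
  qed
  have TM': "mtrace n M' = mtrace n M + s * V"
    by (simp add: mtrace_def M'_def V_def sum.distrib sum_distrib_left power2_eq_square)
  \<comment> \<open>\<open>X\<close> is the form of the leading block at the last column, hence by
    Cauchy-Schwarz at most the Frobenius norm of the block times \<open>V\<close>; scaled by
    \<sigma>^2 that norm is at most 1/16, the square root of 1/256.\<close>
  have XV: "\<sigma>\<^sup>2 * X \<le> V / 16"
  proof -
    have "(\<sigma>\<^sup>2 * X)\<^sup>2 \<le> \<sigma>^4 * frob2 n M * V\<^sup>2"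
      using qform_square_le_frob2[where v = "\<lambda>i. M i n" and M = M and n = n] assms(1)
      by (simp add: X_def V_def power_mult_distrib flip: power_mult)
    also have "\<dots> \<le> (1/256) * V\<^sup>2"
    proof (rule mult_right_mono)
      show "\<sigma>^4 * frob2 n M \<le> 1/256" using F1 nn zero_le_power2[of u] by linarith
    qed simp
    finally have "(\<sigma>\<^sup>2 * X)\<^sup>2 \<le> (V/16)\<^sup>2" by (simp add: power2_eq_square)
    then show ?thesis using V0 by (simp add: abs_le_square_iff[symmetric])
  qed
  have sX: "\<sigma>^4 * (s * X) \<le> \<sigma>^4 * V / 4"
  proof -
    have "s * (\<sigma>\<^sup>2 * X) \<le> s * (V / 16)" using XV s0 by (rule mult_left_mono)
    also have "\<dots> \<le> 4 * \<sigma>\<^sup>2 * (V / 16)" using s1 V0 by (intro mult_right_mono) auto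
    finally have "\<sigma>\<^sup>2 * (s * (\<sigma>\<^sup>2 * X)) \<le> \<sigma>\<^sup>2 * (4 * \<sigma>\<^sup>2 * (V / 16))"
      by (rule mult_left_mono) simp
    then show ?thesis by (simp add: mult_ac)
  qed
  have sV: "\<sigma>^4 * (s\<^sup>2 * V\<^sup>2) \<le> \<sigma>^4 * V / 16"
  proof -
    have "s\<^sup>2 \<le> (4 * \<sigma>\<^sup>2)\<^sup>2" using s0 s1 by (intro power_mono) auto
    then have "s\<^sup>2 * V\<^sup>2 \<le> 16 * (\<sigma>^4 * V) * V"
      using mult_right_mono[of "s\<^sup>2" "(4 * \<sigma>\<^sup>2)\<^sup>2" "V\<^sup>2"] by (simp add: power_mult_distrib mult_ac power2_eq_square[of V])
    also have "\<dots> \<le> 16 * (1/256) * V"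
    proof (intro mult_right_mono mult_left_mono)
      show "\<sigma>^4 * V \<le> 1/256" using F1 nn zero_le_power2[of u] by linarith
    qed (use V0 in auto)
    finally have "\<sigma>^4 * (s\<^sup>2 * V\<^sup>2) \<le> \<sigma>^4 * (V / 16)"
      by (intro mult_left_mono) auto
    then show ?thesis by simp
  qed
  \<comment> \<open>The update adds at most 9/16 of \<open>V\<close>, less than the
    \<open>2 * V\<close> set free by deleting the last row and column; hence \<open>M'\<close>
    inherits the smallness condition.\<close>
  have FM'le: "\<sigma>^4 * frob2 n M' \<le> \<sigma>^4 * frob2 n M + (9/16) * (\<sigma>^4 * V)"
    using sX sV by (simp add: FM' algebra_simps)
  then have le': "\<sigma>^4 * frob2 n M' \<le> 1/256"
    using F1 nn zero_le_power2[of u] by linarith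
  have t: "2 * \<mu> * \<sigma>\<^sup>2 < 1" using u by (simp add: u_def algebra_simps)
  have qM': "qform n M' x = qform n M x + s * (\<Sum>i<n. M i n * x i)\<^sup>2" for x
  proof -
    have "x i * M' i j * x j = x i * M i j * x j + s * ((M i n * x i) * (M j n * x j))" for i j
      by (simp add: M'_def algebra_simps)
    moreover have "(\<Sum>i<n. M i n * x i)\<^sup>2 = (\<Sum>i<n. \<Sum>j<n. (M i n * x i) * (M j n * x j))"
      by (simp only: power2_eq_square sum_product)
    ultimately show ?thesis
      by (simp only: qform_def sum.distrib sum_distrib_left)
  qed
  have sh: "s / 2 = \<sigma>\<^sup>2 / (1 - 2 * \<mu> * \<sigma>\<^sup>2)" unfolding s_def by (rule nonzero_mult_div_cancel_left) simp
  have inner: "(\<integral>\<^sup>+y. ennreal (exp (qform (Suc n) M (x(n := y)))) \<partial>density lborel (normal_density 0 \<sigma>))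
     = ennreal (1 / sqrt (1 - 2 * u)) * ennreal (exp (qform n M' x))" for x
  proof -
    have "(\<integral>\<^sup>+y. ennreal (exp (qform (Suc n) M (x(n := y)))) \<partial>density lborel (normal_density 0 \<sigma>)) =
      ennreal (exp (qform n M x) * (exp (2 * (\<Sum>i<n. M i n * x i)\<^sup>2 * (s / 2)) / sqrt (1 - 2 * u)))"
      unfolding qform_Suc[OF Suc.prems(1)] \<mu>_def[symmetric] gauss_exp_1d[OF assms(1) t]
      by (simp only: sh u_def mult.assoc)
    also have "exp (qform n M x) * (exp (2 * (\<Sum>i<n. M i n * x i)\<^sup>2 * (s / 2)) / sqrt (1 - 2 * u)) =
      1 / sqrt (1 - 2 * u) * exp (qform n M' x)"
      by (simp add: qM' exp_add mult.commute)
    also have "ennreal (1 / sqrt (1 - 2 * u) * exp (qform n M' x)) =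
      ennreal (1 / sqrt (1 - 2 * u)) * ennreal (exp (qform n M' x))"
      by (rule ennreal_mult'') simp
    finally show ?thesis .
  qed
  have "(\<integral>\<^sup>+x. ennreal (exp (qform (Suc n) M x)) \<partial>gauss_d \<sigma> (Suc n)) =
    ennreal (1 / sqrt (1 - 2 * u)) * (\<integral>\<^sup>+x. ennreal (exp (qform n M' x)) \<partial>gauss_d \<sigma> n)"
    by (subst nn_integral_gauss_Suc[OF assms(1)]) (auto simp: inner nn_integral_cmult)
  also have "\<dots> \<le> ennreal (exp (u + 4 * u\<^sup>2)) * ennreal (exp (\<sigma>\<^sup>2 * mtrace n M' + 4 * \<sigma>^4 * frob2 n M'))"
    using inverse_sqrt_le_exp[OF u] Suc.IH[OF sym' le']
    by (intro mult_mono ennreal_leI) auto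
  also have "\<dots> = ennreal (exp (u + 4 * u\<^sup>2 + (\<sigma>\<^sup>2 * mtrace n M' + 4 * \<sigma>^4 * frob2 n M')))"
    by (simp add: exp_add ennreal_mult')
  \<comment> \<open>In units of \<sigma>^4 V the update costs at most 4 in the trace term and 4 *
    9/16 in the Frobenius term, while the deleted off-diagonal entries contribute 8 to the
    right-hand side.\<close>
  also have "\<dots> \<le> ennreal (exp (\<sigma>\<^sup>2 * mtrace (Suc n) M + 4 * \<sigma>^4 * frob2 (Suc n) M))"
  proof -
    have "\<sigma>\<^sup>2 * (s * V) \<le> 4 * (\<sigma>^4 * V)"
      using mult_right_mono[OF s1, of "\<sigma>\<^sup>2 * V"] V0 by (simp add: mult_ac)
    moreover have "4 * u\<^sup>2 = 4 * (\<sigma>^4 * \<mu>\<^sup>2)"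
      by (simp add: u_def power_mult_distrib flip: power_mult)
    moreover have "\<sigma>\<^sup>2 * mtrace (Suc n) M = \<sigma>\<^sup>2 * mtrace n M + u"
      by (simp add: mtrace_def u_def \<mu>_def algebra_simps)
    ultimately have "u + 4 * u\<^sup>2 + (\<sigma>\<^sup>2 * mtrace n M' + 4 * (\<sigma>^4 * frob2 n M')) \<le>
        \<sigma>\<^sup>2 * mtrace (Suc n) M + 4 * (\<sigma>^4 * frob2 (Suc n) M)"
      using FM'le nn(2) unfolding TM' F distrib_left by linarith
    then show ?thesis by (intro ennreal_leI) simp
  qed
  finally show ?case .
qed

section \<open>Second moments of linear and quadratic forms\<close>

lemma gauss_second_moment_1d:
  fixes \<sigma> c w \<mu> :: real
  assumes "0 < \<sigma>"
  shows "(\<integral>\<^sup>+y. ennreal ((c + 2 * y * w + \<mu> * y\<^sup>2)\<^sup>2) \<partial>density lborel (normal_density 0 \<sigma>))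
    = ennreal ((c + \<mu> * \<sigma>\<^sup>2)\<^sup>2 + 4 * \<sigma>\<^sup>2 * w\<^sup>2 + 2 * \<mu>\<^sup>2 * \<sigma>^4)"
proof -
  let ?n = "normal_density 0 \<sigma>"
  have m: "has_bochner_integral lborel (\<lambda>y. ?n y * y ^ 0) 1"
    "has_bochner_integral lborel (\<lambda>y. ?n y * y ^ 1) 0"
    "has_bochner_integral lborel (\<lambda>y. ?n y * y ^ 2) (\<sigma>\<^sup>2)"
    "has_bochner_integral lborel (\<lambda>y. ?n y * y ^ 3) 0"
    "has_bochner_integral lborel (\<lambda>y. ?n y * y ^ 4) (3 * \<sigma>^4)"
    using normal_moment_even[OF assms, of 0 0] normal_moment_odd[OF assms, of 0 0]
      normal_moment_even[OF assms, of 0 1] normal_moment_odd[OF assms, of 0 1]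
      normal_moment_even[OF assms, of 0 2] assms
    by (simp_all add: fact_numeral power_divide numeral_3_eq_3[symmetric] flip: power_mult)
  have h: "has_bochner_integral lborel
     (\<lambda>y. (?n y * y ^ 0) * c\<^sup>2 + (?n y * y ^ 1) * (4 * c * w) + (?n y * y ^ 2) * (4 * w\<^sup>2 + 2 * c * \<mu>) +
        (?n y * y ^ 3) * (4 * w * \<mu>) + (?n y * y ^ 4) * \<mu>\<^sup>2)
     (1 * c\<^sup>2 + 0 * (4 * c * w) + \<sigma>\<^sup>2 * (4 * w\<^sup>2 + 2 * c * \<mu>) + 0 * (4 * w * \<mu>) + 3 * \<sigma>^4 * \<mu>\<^sup>2)"
    by (intro has_bochner_integral_add has_bochner_integral_mult_left m)
  have "has_bochner_integral lborel (\<lambda>y. ?n y * (c + 2 * y * w + \<mu> * y\<^sup>2)\<^sup>2)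
     ((c + \<mu> * \<sigma>\<^sup>2)\<^sup>2 + 4 * \<sigma>\<^sup>2 * w\<^sup>2 + 2 * \<mu>\<^sup>2 * \<sigma>^4)"
    by (rule has_bochner_integral_cong[THEN iffD1, OF _ _ _ h])
      (auto simp: power2_eq_square power3_eq_cube power4_eq_xxxx algebra_simps)
  then have "(\<integral>\<^sup>+y. ennreal (?n y * (c + 2 * y * w + \<mu> * y\<^sup>2)\<^sup>2) \<partial>lborel) =
      ennreal ((c + \<mu> * \<sigma>\<^sup>2)\<^sup>2 + 4 * \<sigma>\<^sup>2 * w\<^sup>2 + 2 * \<mu>\<^sup>2 * \<sigma>^4)"
    by (subst nn_integral_eq_integral) (auto simp: has_bochner_integral_iff)
  then show ?thesis
    by (subst nn_integral_density) (auto simp: ennreal_mult')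
qed

text \<open>Evaluates the cross term that \<open>gauss_second_moment\<close> meets when the last
  coordinate is split off; with a basis vector for \<open>v\<close> it also gives the variance of a
  coordinate.\<close>

lemma gauss_linear_second_moment:
  assumes "0 < \<sigma>"
  shows "(\<integral>\<^sup>+x. ennreal ((c + (\<Sum>i<n. v i * x i))\<^sup>2) \<partial>gauss_d \<sigma> n) = ennreal (c\<^sup>2 + \<sigma>\<^sup>2 * (\<Sum>i<n. (v i)\<^sup>2))"
proof (induction n arbitrary: c)
  case 0
  show ?case by (simp add: gauss_d_def PiM_empty)
next
  case (Suc n)
  have 1: "(\<integral>\<^sup>+y. ennreal ((c + (\<Sum>i<Suc n. v i * (x(n := y)) i))\<^sup>2) \<partial>density lborel (normal_density 0 \<sigma>))
     = ennreal ((c + (\<Sum>i<n. v i * x i))\<^sup>2) + ennreal (\<sigma>\<^sup>2 * (v n)\<^sup>2)" for x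
    using gauss_second_moment_1d[OF assms, of "c + (\<Sum>i<n. v i * x i)" "v n / 2" 0]
    by (simp add: power_divide ennreal_plus add_ac mult_ac)
  interpret prob_space "gauss_d \<sigma> n"
    unfolding gauss_d_def by (intro prob_space_PiM prob_space_normal_density assms)
  have "(\<integral>\<^sup>+x. ennreal ((c + (\<Sum>i<Suc n. v i * x i))\<^sup>2) \<partial>gauss_d \<sigma> (Suc n)) =
    (\<integral>\<^sup>+x. ennreal ((c + (\<Sum>i<n. v i * x i))\<^sup>2) + ennreal (\<sigma>\<^sup>2 * (v n)\<^sup>2) \<partial>gauss_d \<sigma> n)"
    unfolding 1[symmetric] using linform_measurable_gauss[where d = "Suc n"]
    by (intro nn_integral_gauss_Suc[OF assms]) measurable
  also have "\<dots> = ennreal (c\<^sup>2 + \<sigma>\<^sup>2 * (\<Sum>i<n. (v i)\<^sup>2)) + ennreal (\<sigma>\<^sup>2 * (v n)\<^sup>2)"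
    by (simp add: nn_integral_add Suc.IH emeasure_space_1)
  also have "\<dots> = ennreal (c\<^sup>2 + \<sigma>\<^sup>2 * (\<Sum>i<Suc n. (v i)\<^sup>2))"
    by (simp add: distrib_left sum_nonneg flip: ennreal_plus)
  finally show ?case .
qed

text \<open>The shift \<open>c\<close> varies in the induction, since integrating out the last
  coordinate moves its diagonal contribution into the shift. The cross term supplies the
  off-diagonal part of \<open>frob2\<close>.\<close>

lemma gauss_second_moment:
  assumes "0 < \<sigma>" "symmetric n M"
  shows "(\<integral>\<^sup>+x. ennreal ((c + qform n M x)\<^sup>2) \<partial>gauss_d \<sigma> n) =
    ennreal ((c + \<sigma>\<^sup>2 * mtrace n M)\<^sup>2 + 2 * \<sigma>^4 * frob2 n M)"
  using assms(2)
proof (induction n arbitrary: c)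
  case 0
  show ?case by (simp add: gauss_d_def PiM_empty qform_def mtrace_def frob2_def)
next
  case (Suc n)
  let ?w = "\<lambda>x. \<Sum>i<n. M i n * x i"
  let ?a = "c + M n n * \<sigma>\<^sup>2"
  have sym: "symmetric n M" using Suc.prems by (simp add: symmetric_def)
  have 1: "(\<integral>\<^sup>+y. ennreal ((c + qform (Suc n) M (x(n := y)))\<^sup>2) \<partial>density lborel (normal_density 0 \<sigma>))
     = ennreal ((?a + qform n M x)\<^sup>2) + (ennreal (4 * \<sigma>\<^sup>2) * ennreal ((0 + ?w x)\<^sup>2) + ennreal (2 * (M n n)\<^sup>2 * \<sigma>^4))" for x
    using gauss_second_moment_1d[OF assms(1), of "c + qform n M x" "?w x" "M n n"]
    by (simp add: qform_Suc[OF Suc.prems] add_ac flip: ennreal_plus ennreal_mult)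
  interpret prob_space "gauss_d \<sigma> n"
    unfolding gauss_d_def by (intro prob_space_PiM prob_space_normal_density assms)
  have "(\<integral>\<^sup>+x. ennreal ((c + qform (Suc n) M x)\<^sup>2) \<partial>gauss_d \<sigma> (Suc n)) =
    (\<integral>\<^sup>+x. ennreal ((?a + qform n M x)\<^sup>2) + (ennreal (4 * \<sigma>\<^sup>2) * ennreal ((0 + ?w x)\<^sup>2) + ennreal (2 * (M n n)\<^sup>2 * \<sigma>^4)) \<partial>gauss_d \<sigma> n)"
    unfolding 1[symmetric] using qform_measurable_gauss
    by (intro nn_integral_gauss_Suc[OF assms(1)]) measurable
  also have "\<dots> = ennreal ((?a + \<sigma>\<^sup>2 * mtrace n M)\<^sup>2 + 2 * \<sigma>^4 * frob2 n M) +
    (ennreal (4 * \<sigma>\<^sup>2) * ennreal (0\<^sup>2 + \<sigma>\<^sup>2 * (\<Sum>i<n. (M i n)\<^sup>2)) + ennreal (2 * (M n n)\<^sup>2 * \<sigma>^4))"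
    by (subst nn_integral_add, measurable, subst nn_integral_add, measurable, subst nn_integral_cmult, measurable)
       (simp only: Suc.IH[OF sym] gauss_linear_second_moment[OF assms(1)] nn_integral_const emeasure_space_1 mult_1_right)
  also have "\<dots> = ennreal ((?a + \<sigma>\<^sup>2 * mtrace n M)\<^sup>2 + 2 * \<sigma>^4 * frob2 n M +
    (4 * \<sigma>\<^sup>2 * (\<sigma>\<^sup>2 * (\<Sum>i<n. (M i n)\<^sup>2)) + 2 * (M n n)\<^sup>2 * \<sigma>^4))"
    by (simp add: sum_nonneg frob2_nonneg flip: ennreal_plus ennreal_mult)
  also have "(?a + \<sigma>\<^sup>2 * mtrace n M)\<^sup>2 + 2 * \<sigma>^4 * frob2 n M +
    (4 * \<sigma>\<^sup>2 * (\<sigma>\<^sup>2 * (\<Sum>i<n. (M i n)\<^sup>2)) + 2 * (M n n)\<^sup>2 * \<sigma>^4) = 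
    (c + \<sigma>\<^sup>2 * mtrace (Suc n) M)\<^sup>2 + 2 * \<sigma>^4 * frob2 (Suc n) M"
    unfolding frob2_Suc[OF Suc.prems] by (simp add: mtrace_def distrib_left power4_eq_xxxx power2_eq_square[of \<sigma>] mult_ac add_ac)
  finally show ?case .
qed

lemma gauss_norm_second_moment:
  assumes "0 < \<sigma>"
  shows "(\<integral>\<^sup>+x. ennreal (\<Sum>i<n. (x i)\<^sup>2) \<partial>gauss_d \<sigma> n) = ennreal (real n * \<sigma>\<^sup>2)"
proof -
  have "(\<integral>\<^sup>+x. ennreal ((x i)\<^sup>2) \<partial>gauss_d \<sigma> n) = ennreal (\<sigma>\<^sup>2)" if "i < n" for i
  proof -
    have "(\<Sum>j<n. (if j = i then 1 else 0) * x j) = x i" for x :: "nat \<Rightarrow> real"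
      using that by (simp add: if_distrib[of "\<lambda>z. z * _"] cong: if_cong)
    moreover have "(\<Sum>j<n. (if j = i then 1 else 0 :: real)\<^sup>2) = 1"
      using that by (simp add: if_distrib[of "\<lambda>z. z ^ _"] cong: if_cong)
    ultimately show ?thesis
      using gauss_linear_second_moment[OF assms, where c = 0 and n = n and v = "\<lambda>j. if j = i then 1 else 0"]
      by simp
  qed
  moreover have [measurable]: "(\<lambda>x. x i) \<in> borel_measurable (gauss_d \<sigma> n)" if "i < n" for i
    using that by (simp add: gauss_d_def)
  moreover have "(\<integral>\<^sup>+x. ennreal (\<Sum>i<n. (x i)\<^sup>2) \<partial>gauss_d \<sigma> n) = (\<Sum>i<n. \<integral>\<^sup>+x. ennreal ((x i)\<^sup>2) \<partial>gauss_d \<sigma> n)"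
    by (subst nn_integral_sum[symmetric]) auto
  ultimately show ?thesis by (simp add: ennreal_mult' ennreal_of_nat_eq_real_of_nat)
qed

section \<open>Exponential moment and mean of the absolute quadratic form\<close>

lemma qform_scale: "qform d (\<lambda>i j. c * M i j) x = c * qform d M x"
  by (simp add: qform_def sum_distrib_left mult_ac)

lemma frob2_scale: "frob2 d (\<lambda>i j. c * M i j) = c\<^sup>2 * frob2 d M"
  by (simp add: frob2_def sum_distrib_left power_mult_distrib)

lemma mtrace_scale: "mtrace d (\<lambda>i j. c * M i j) = c * mtrace d M"
  by (simp add: mtrace_def sum_distrib_left)

lemma prob_space_gauss_d: "0 < \<sigma> \<Longrightarrow> prob_space (gauss_d \<sigma> d)"
  unfolding gauss_d_def by (intro prob_space_PiM prob_space_normal_density)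

text \<open>The number 5/64 = 1/16 + 4/256 bounds the exponent that arises when
  \<open>gauss_mgf\<close> is applied in \<open>gauss_exp_abs_qform\<close>.\<close>

lemma exp_five_64ths_le_2: "exp (5/64 :: real) \<le> 2"
proof -
  have "exp (5/64 :: real) \<le> 1 + 5/64 + (5/64)\<^sup>2"
    by (rule exp_bound) auto
  also have "\<dots> \<le> 2" by (simp add: power2_eq_square)
  finally show ?thesis .
qed

text \<open>Up to constants, \<tau> is the mean of the absolute value of the form. Dividing by 16
  \<tau> meets the condition of \<open>gauss_mgf\<close>, as 16^2 = 256, and exp |q| is at most exp
  q + exp (-q).\<close>

lemma gauss_exp_abs_qform:
  assumes "0 < \<sigma>" "symmetric n M"
  defines "\<tau> \<equiv> \<sigma>\<^sup>2 * (\<bar>mtrace n M\<bar> + sqrt (frob2 n M))"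
  assumes "0 < \<tau>"
  shows "(\<integral>\<^sup>+x. ennreal (exp (\<bar>qform n M x\<bar> / (16 * \<tau>))) \<partial>gauss_d \<sigma> n) \<le> 4"
proof -
  have half: "(\<integral>\<^sup>+x. ennreal (exp (s * qform n M x / (16 * \<tau>))) \<partial>gauss_d \<sigma> n) \<le> 2"
    if s: "\<bar>s\<bar> = 1" for s
  proof -
    define c where "c = s / (16 * \<tau>)"
    have s2: "s\<^sup>2 = 1" using s by (metis power2_abs one_power2)
    have "\<sigma>\<^sup>2 * sqrt (frob2 n M) \<le> \<tau>" "\<sigma>\<^sup>2 * \<bar>mtrace n M\<bar> \<le> \<tau>"
      unfolding \<tau>_def distrib_left using frob2_nonneg[of n M]
      by (auto intro: add_increasing add_increasing2)
    then have b: "(\<sigma>\<^sup>2 * sqrt (frob2 n M))\<^sup>2 \<le> \<tau>\<^sup>2" "\<sigma>\<^sup>2 * \<bar>mtrace n M\<bar> \<le> \<tau>"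
      by (auto simp: frob2_nonneg intro: power_mono)
    have "(\<sigma>\<^sup>2 * sqrt (frob2 n M))\<^sup>2 = \<sigma>^4 * frob2 n M"
      by (simp add: power_mult_distrib frob2_nonneg flip: power_mult)
    then have F: "\<sigma>^4 * frob2 n (\<lambda>i j. c * M i j) \<le> 1/256"
    proof -
      have "\<sigma>^4 * frob2 n (\<lambda>i j. c * M i j) = c\<^sup>2 * (\<sigma>\<^sup>2 * sqrt (frob2 n M))\<^sup>2"
        unfolding frob2_scale \<open>(\<sigma>\<^sup>2 * sqrt (frob2 n M))\<^sup>2 = _\<close> by simp
      also have "\<dots> \<le> c\<^sup>2 * \<tau>\<^sup>2" using b(1) by (rule mult_left_mono) simp
      also have "\<dots> = 1/256" using assms(4) s2 by (simp add: c_def power_divide power_mult_distrib)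
      finally show ?thesis .
    qed
    have "\<bar>c\<bar> * (\<sigma>\<^sup>2 * \<bar>mtrace n M\<bar>) \<le> \<bar>c\<bar> * \<tau>"
      using b(2) by (intro mult_left_mono) auto
    also have "\<bar>c\<bar> * \<tau> = 1/16"
      using assms(4) s by (simp add: c_def abs_mult)
    finally have "\<bar>c * (\<sigma>\<^sup>2 * mtrace n M)\<bar> \<le> 1/16"
      by (simp add: abs_mult)
    then have T: "\<sigma>\<^sup>2 * mtrace n (\<lambda>i j. c * M i j) \<le> 1/16"
      by (simp add: mtrace_scale mult_ac abs_le_iff)
    have "symmetric n (\<lambda>i j. c * M i j)" using assms(2) by (simp add: symmetric_def)
    then have "(\<integral>\<^sup>+x. ennreal (exp (qform n (\<lambda>i j. c * M i j) x)) \<partial>gauss_d \<sigma> n) \<le>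
      ennreal (exp (\<sigma>\<^sup>2 * mtrace n (\<lambda>i j. c * M i j) + 4 * \<sigma>^4 * frob2 n (\<lambda>i j. c * M i j)))"
      using F by (rule gauss_mgf[OF assms(1)])
    also have "\<dots> \<le> ennreal (exp (5/64))"
      using F T by (intro ennreal_leI) simp
    also have "\<dots> \<le> 2" using ennreal_leI[OF exp_five_64ths_le_2] by simp
    finally show ?thesis unfolding qform_scale c_def by simp
  qed
  have "(\<integral>\<^sup>+x. ennreal (exp (\<bar>qform n M x\<bar> / (16 * \<tau>))) \<partial>gauss_d \<sigma> n) \<le>
    (\<integral>\<^sup>+x. ennreal (exp (1 * qform n M x / (16 * \<tau>))) + ennreal (exp (-1 * qform n M x / (16 * \<tau>))) \<partial>gauss_d \<sigma> n)"
    by (intro nn_integral_mono) (auto simp: abs_if simp flip: ennreal_plus)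
  also have "\<dots> \<le> 2 + 2"
    using half[of 1] half[of "-1"] by (subst nn_integral_add) (auto intro!: add_mono[of _ 2 _ 2, simplified])
  finally show ?thesis by simp
qed

text \<open>Interpolation between moments: t^2 <= t + t^4 bounds the second moment by the first and
  the fourth. The second is at least \<tau>^2 / 2 by the exact formula, and the fourth is at most a
  constant times \<tau>^4 by the exponential moment.\<close>

lemma gauss_abs_qform_lower:
  assumes "0 < \<sigma>" "symmetric n M"
  defines "\<tau> \<equiv> \<sigma>\<^sup>2 * (\<bar>mtrace n M\<bar> + sqrt (frob2 n M))"
  assumes "0 < \<tau>"
  shows "ennreal (\<tau> / 2^15) \<le> (\<integral>\<^sup>+x. ennreal \<bar>qform n M x\<bar> \<partial>gauss_d \<sigma> n)"
proof -
  let ?q = "qform n M" and ?G = "gauss_d \<sigma> n"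
  \<comment> \<open>At this scale the second moment contributes \<tau> / 2^14 and the fourth takes
    back half of it, \<tau> / 2^15.\<close>
  define u where "u = 2^13 * \<tau>"
  have u: "u > 0" using assms(4) by (simp add: u_def)
  have sec: "ennreal (\<tau>\<^sup>2 / 2) \<le> (\<integral>\<^sup>+x. ennreal ((?q x)\<^sup>2) \<partial>?G)"
  proof -
    have "(\<bar>mtrace n M\<bar> + sqrt (frob2 n M))\<^sup>2 \<le> 2 * ((mtrace n M)\<^sup>2 + frob2 n M)"
      using zero_le_power2[of "\<bar>mtrace n M\<bar> - sqrt (frob2 n M)"] frob2_nonneg[of n M]
      by (simp add: power2_sum power2_diff)
    then have "\<sigma>^4 * (\<bar>mtrace n M\<bar> + sqrt (frob2 n M))\<^sup>2 \<le> \<sigma>^4 * (2 * ((mtrace n M)\<^sup>2 + frob2 n M))"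
      by (rule mult_left_mono) simp
    then have "\<tau>\<^sup>2 / 2 \<le> \<sigma>^4 * ((mtrace n M)\<^sup>2 + frob2 n M)"
    proof -
      have "\<tau>\<^sup>2 = \<sigma>^4 * (\<bar>mtrace n M\<bar> + sqrt (frob2 n M))\<^sup>2"
        by (simp add: \<tau>_def power_mult_distrib flip: power_mult)
      then show ?thesis using \<open>\<sigma>^4 * _ \<le> _\<close> by linarith
    qed
    also have "\<dots> \<le> (0 + \<sigma>\<^sup>2 * mtrace n M)\<^sup>2 + 2 * \<sigma>^4 * frob2 n M"
      using frob2_nonneg[of n M] by (simp add: power_mult_distrib distrib_left flip: power_mult)
    finally show ?thesis
      using gauss_second_moment[OF assms(1,2), of 0] by (simp add: ennreal_leI)
  qed
  have fourth: "(\<integral>\<^sup>+x. ennreal ((?q x)^4) \<partial>?G) \<le> ennreal (2^24 * \<tau>^4)"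
  proof -
    \<comment> \<open>The constant is 16^4 * 64: with z = |q| / (16 \<tau>), the Taylor bound z^2 /
      8 <= exp (z / 2) is squared.\<close>
    have "(?q x)^4 \<le> 2^22 * \<tau>^4 * exp (\<bar>?q x\<bar> / (16 * \<tau>))" for x
    proof -
      define z where "z = \<bar>?q x\<bar> / (16 * \<tau>)"
      have z: "0 \<le> z" using assms(4) by (simp add: z_def)
      have "(z/2)\<^sup>2 / 2 \<le> exp (z / 2)"
        using exp_lower_Taylor_quadratic[of "z/2"] z by simp
      then have "((z/2)\<^sup>2 / 2)\<^sup>2 \<le> (exp (z / 2))\<^sup>2" by (intro power_mono) auto
      then have "z^4 \<le> 64 * exp z"
        by (simp add: power_divide exp_double[symmetric] flip: power_mult)
      moreover have "(?q x)^4 = 2^16 * \<tau>^4 * z^4"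
        using assms(4) by (simp add: z_def power_divide power_mult_distrib)
      moreover have "2^16 * \<tau>^4 * z^4 \<le> 2^16 * \<tau>^4 * (64 * exp z)"
        using \<open>z^4 \<le> 64 * exp z\<close> by (intro mult_left_mono) auto
      ultimately show ?thesis by (simp add: z_def)
    qed
    then have "(\<integral>\<^sup>+x. ennreal ((?q x)^4) \<partial>?G) \<le>
      (\<integral>\<^sup>+x. ennreal (2^22 * \<tau>^4) * ennreal (exp (\<bar>?q x\<bar> / (16 * \<tau>))) \<partial>?G)"
      by (intro nn_integral_mono) (simp add: ennreal_leI flip: ennreal_mult)
    also have "\<dots> \<le> ennreal (2^22 * \<tau>^4) * 4"
      using gauss_exp_abs_qform[OF assms(1,2)] assms(4)
      by (subst nn_integral_cmult) (auto simp: \<tau>_def intro!: mult_left_mono)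
    also have "\<dots> = ennreal (2^24 * \<tau>^4)"
      using ennreal_mult'[of 4 "2^22 * \<tau>^4"] by (simp add: mult.commute)
    finally show ?thesis .
  qed
  have "ennreal (\<tau> / 2^14) = ennreal (1 / u) * ennreal (\<tau>\<^sup>2 / 2)"
    using assms(4) by (simp add: u_def power2_eq_square flip: ennreal_mult)
  also have "\<dots> \<le> (\<integral>\<^sup>+x. ennreal (1 / u) * ennreal ((?q x)\<^sup>2) \<partial>?G)"
    using sec by (subst nn_integral_cmult) (auto intro: mult_left_mono)
  also have "\<dots> \<le> (\<integral>\<^sup>+x. ennreal \<bar>?q x\<bar> + ennreal (1 / u^3) * ennreal ((?q x)^4) \<partial>?G)"
  proof (intro nn_integral_mono)
    fix x
    define t where "t = \<bar>?q x\<bar> / u"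
    have t: "0 \<le> t" using u by (simp add: t_def)
    have "t\<^sup>2 \<le> t + t^4"
    proof (cases "t \<le> 1")
      case True
      then have "t\<^sup>2 \<le> t" using t by (simp add: power2_eq_square mult_left_le)
      then show ?thesis using t by (simp add: add_increasing2)
    next
      case False
      then have "t\<^sup>2 \<le> t^4" by (intro power_increasing) auto
      then show ?thesis using t by simp
    qed
    then have "u * t\<^sup>2 \<le> u * (t + t^4)" using u by (intro mult_left_mono) auto
    moreover have "u * t\<^sup>2 = 1 / u * (?q x)\<^sup>2" "u * (t + t^4) = \<bar>?q x\<bar> + 1 / u^3 * (?q x)^4"
      using u by (simp_all add: t_def power_divide field_simps power2_eq_square power3_eq_cube power4_eq_xxxx)
    ultimately show "ennreal (1 / u) * ennreal ((?q x)\<^sup>2) \<le> ennreal \<bar>?q x\<bar> + ennreal (1 / u^3) * ennreal ((?q x)^4)"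
      using u by (simp add: ennreal_leI flip: ennreal_mult ennreal_plus)
  qed
  also have "\<dots> \<le> (\<integral>\<^sup>+x. ennreal \<bar>?q x\<bar> \<partial>?G) + ennreal (1 / u^3) * ennreal (2^24 * \<tau>^4)"
    using fourth by (subst nn_integral_add) (auto simp: nn_integral_cmult intro!: add_left_mono mult_left_mono)
  also have "ennreal (1 / u^3) * ennreal (2^24 * \<tau>^4) = ennreal (\<tau> / 2^15)"
    using assms(4) by (simp add: u_def power_mult_distrib power4_eq_xxxx power3_eq_cube flip: ennreal_mult)
  finally have "ennreal (\<tau> / 2^15) + ennreal (\<tau> / 2^15) \<le> (\<integral>\<^sup>+x. ennreal \<bar>?q x\<bar> \<partial>?G) + ennreal (\<tau> / 2^15)"
    using assms(4) by (simp flip: ennreal_plus)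
  then show ?thesis by simp
qed

lemma gauss_abs_qform_finite:
  assumes "0 < \<sigma>" "symmetric n M"
  shows "(\<integral>\<^sup>+x. ennreal \<bar>qform n M x\<bar> \<partial>gauss_d \<sigma> n) < \<infinity>"
proof -
  interpret prob_space "gauss_d \<sigma> n" by (rule prob_space_gauss_d[OF assms(1)])
  have "\<bar>qform n M x\<bar> \<le> 1 + (0 + qform n M x)\<^sup>2" for x
    using zero_le_power2[of "\<bar>qform n M x\<bar> - 1"] by (simp add: power2_diff)
  then have "(\<integral>\<^sup>+x. ennreal \<bar>qform n M x\<bar> \<partial>gauss_d \<sigma> n) \<le>
     (\<integral>\<^sup>+x. 1 + ennreal ((0 + qform n M x)\<^sup>2) \<partial>gauss_d \<sigma> n)"
    by (intro nn_integral_mono) (simp add: ennreal_leI flip: ennreal_plus ennreal_1)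
  also have "\<dots> = 1 + ennreal ((0 + \<sigma>\<^sup>2 * mtrace n M)\<^sup>2 + 2 * \<sigma>^4 * frob2 n M)"
    unfolding gauss_second_moment[OF assms, symmetric]
    by (subst nn_integral_add) (auto simp: emeasure_space_1)
  also have "\<dots> < \<infinity>" by (simp add: less_top[symmetric])
  finally show ?thesis .
qed

section \<open>Polar decomposition and the uniform distribution on the sphere\<close>

text \<open>The map in the definition of \<open>Lambda_U\<close>. Division by zero sends the origin
  to the zero vector, so \<open>qform_dir\<close> holds everywhere and no null set has to be
  excluded; in exchange the norm of a direction is only bounded by 1.\<close>

definition dir :: "nat \<Rightarrow> (nat \<Rightarrow> real) \<Rightarrow> (nat \<Rightarrow> real)" where
  "dir d x = restrict (\<lambda>i. x i / vnorm d x) {..<d}"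

definition dilate :: "nat \<Rightarrow> real \<Rightarrow> (nat \<Rightarrow> real) \<Rightarrow> (nat \<Rightarrow> real)" where
  "dilate d s x = restrict (\<lambda>i. s * x i) {..<d}"

lemma vnorm_nonneg: "0 \<le> vnorm d x"
  by (simp add: vnorm_def sum_nonneg)

lemma vnorm_square: "(vnorm d x)\<^sup>2 = (\<Sum>i<d. (x i)\<^sup>2)"
  by (simp add: vnorm_def sum_nonneg)

lemma abs_le_vnorm: "i < d \<Longrightarrow> \<bar>x i\<bar> \<le> vnorm d x"
proof -
  assume "i < d"
  then have "(x i)\<^sup>2 \<le> (vnorm d x)\<^sup>2"
    unfolding vnorm_square by (intro member_le_sum) auto
  then show ?thesis using vnorm_nonneg by (metis abs_le_square_iff abs_of_nonneg)
qed

lemma vnorm_dilate: "0 \<le> s \<Longrightarrow> vnorm d (dilate d s x) = s * vnorm d x"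
  by (simp add: vnorm_def dilate_def power_mult_distrib real_sqrt_mult flip: sum_distrib_left)

lemma dir_dilate: "0 < s \<Longrightarrow> dir d (dilate d s x) = dir d x"
  unfolding dir_def by (rule restrict_ext) (simp add: vnorm_dilate, simp add: dilate_def)

lemma qform_dir: "qform d M x = (vnorm d x)\<^sup>2 * qform d M (dir d x)"
proof (cases "vnorm d x = 0")
  case True
  then have "x i = 0" if "i < d" for i using abs_le_vnorm[OF that, of x] by simp
  then show ?thesis using True by (simp add: qform_def)
next
  case False
  then show ?thesis
    by (simp add: qform_def dir_def sum_distrib_left power2_eq_square)
qed

lemma abs_dir_le_1: "i < d \<Longrightarrow> \<bar>dir d x i\<bar> \<le> 1"
  using abs_le_vnorm[of i d x] vnorm_nonneg[of d x]
  by (cases "vnorm d x = 0") (auto simp: dir_def abs_divide)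

lemma vnorm_dir_le_1: "(\<Sum>i<d. (dir d x i)\<^sup>2) \<le> 1"
proof -
  have "(\<Sum>i<d. (dir d x i)\<^sup>2) = (\<Sum>i<d. (x i)\<^sup>2) / (vnorm d x)\<^sup>2"
    by (simp add: dir_def power_divide sum_divide_distrib)
  then show ?thesis by (cases "vnorm d x = 0") (auto simp: vnorm_square[symmetric])
qed

lemma sets_lebesgue_d [measurable_cong]: "sets (lebesgue_d d) = sets (borel_d d)"
  unfolding lebesgue_d_def borel_d_def by (intro sets_PiM_cong) auto

lemma space_lebesgue_d: "space (lebesgue_d d) = space (borel_d d)"
  by (rule sets_eq_imp_space_eq[OF sets_lebesgue_d])

lemma measurable_component_borel_d [measurable]: "i < d \<Longrightarrow> (\<lambda>x. x i) \<in> borel_measurable (borel_d d)"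
  unfolding borel_d_def by (rule measurable_component_singleton) auto

lemma vnorm_measurable [measurable]: "vnorm d \<in> borel_measurable (borel_d d)"
  unfolding vnorm_def[abs_def] by measurable

lemma dir_measurable [measurable]: "dir d \<in> measurable (borel_d d) (borel_d d)"
  unfolding dir_def[abs_def] 
  by (subst (2) borel_d_def, rule measurable_restrict) measurable

lemma dilate_measurable [measurable]: "dilate d s \<in> measurable (borel_d d) (borel_d d)"
  unfolding dilate_def[abs_def]
  by (subst (2) borel_d_def, rule measurable_restrict) measurable

lemma qform_measurable_borel_d [measurable]: "qform d M \<in> borel_measurable (borel_d d)"
  unfolding borel_d_def by (rule qform_measurable_PiM) simp

section \<open>Dilations of Lebesgue measure and integration in polar coordinates\<close>

lemma emeasure_lborel_scale:
  assumes "0 < s" "A \<in> sets borel"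
  shows "emeasure lborel A = ennreal s * emeasure lborel ((\<lambda>x. s * x) -` A :: real set)"
proof -
  have "emeasure lborel A = emeasure (density (distr lborel borel (\<lambda>x. 0 + s * x)) (\<lambda>_. ennreal \<bar>s\<bar>)) A"
    using lborel_real_affine[of s 0] assms by simp
  also have "\<dots> = ennreal s * emeasure lborel ((\<lambda>x. s * x) -` A)"
    using assms by (subst emeasure_density_const) (auto simp: emeasure_distr)
  finally show ?thesis .
qed

lemma lebesgue_d_dilate:
  assumes "0 < s"
  shows "lebesgue_d d = density (distr (lebesgue_d d) (borel_d d) (dilate d s)) (\<lambda>_. ennreal (s ^ d))"
proof -
  interpret product_sigma_finite "\<lambda>_::nat. lborel :: real measure"
    by standard
  have "density (distr (lebesgue_d d) (borel_d d) (dilate d s)) (\<lambda>_. ennreal (s ^ d)) =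
    PiM {..<d} (\<lambda>_. lborel)"
  proof (rule PiM_eqI)
    show "sets (density (distr (lebesgue_d d) (borel_d d) (dilate d s)) (\<lambda>_. ennreal (s ^ d))) = PiM {..<d} (\<lambda>_. lborel)"
      using sets_lebesgue_d by (simp add: lebesgue_d_def)
  next
    fix A assume A: "\<And>i. i \<in> {..<d} \<Longrightarrow> A i \<in> sets (lborel :: real measure)"
    have PA: "PiE {..<d} A \<in> sets (borel_d d)"
      unfolding borel_d_def using A by (intro sets_PiM_I_finite) auto
    have "dilate d s -` PiE {..<d} A \<inter> space (lebesgue_d d) = PiE {..<d} (\<lambda>i. (\<lambda>x. s * x) -` A i)"
      by (auto simp: space_lebesgue_d borel_d_def space_PiM dilate_def PiE_def Pi_def extensional_def)
    moreover have "emeasure (lebesgue_d d) (PiE {..<d} (\<lambda>i. (\<lambda>x. s * x) -` A i)) =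
       (\<Prod>i<d. emeasure lborel ((\<lambda>x. s * x) -` A i))"
      unfolding lebesgue_d_def using A
    proof (intro emeasure_PiM)
      have "(\<lambda>x. s * x) \<in> borel_measurable borel" by measurable
      then show "(\<lambda>x. s * x) -` A i \<in> sets lborel" if "i \<in> {..<d}" for i
        using A[OF that] measurable_sets_borel[of "\<lambda>x. s * x" borel "A i"] by simp
    qed simp
    ultimately have "emeasure (density (distr (lebesgue_d d) (borel_d d) (dilate d s)) (\<lambda>_. ennreal (s ^ d))) (PiE {..<d} A) =
      ennreal (s ^ d) * (\<Prod>i<d. emeasure lborel ((\<lambda>x. s * x) -` A i))"
      using PA by (subst emeasure_density_const) (auto simp: emeasure_distr)
    also have "\<dots> = (\<Prod>i<d. ennreal s * emeasure lborel ((\<lambda>x. s * x) -` A i))"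
      using assms by (simp add: prod.distrib ennreal_power)
    also have "\<dots> = (\<Prod>i<d. emeasure lborel (A i))"
      using emeasure_lborel_scale[OF assms] A by (intro prod.cong) auto
    finally show "emeasure (density (distr (lebesgue_d d) (borel_d d) (dilate d s)) (\<lambda>_. ennreal (s ^ d))) (PiE {..<d} A) =
       (\<Prod>i\<in>{..<d}. emeasure lborel (A i))" .
  qed auto
  then show ?thesis by (simp add: lebesgue_d_def)
qed

lemma nn_integral_lebesgue_d_dilate:
  assumes "0 < s" and [measurable]: "f \<in> borel_measurable (borel_d d)"
  shows "(\<integral>\<^sup>+x. f x \<partial>lebesgue_d d) = ennreal (s ^ d) * (\<integral>\<^sup>+x. f (dilate d s x) \<partial>lebesgue_d d)"
  by (subst lebesgue_d_dilate[OF assms(1)])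
    (simp add: nn_integral_density nn_integral_distr nn_integral_cmult)

text \<open>For \<open>f\<close> depending on the direction only, this is the volume of the ball
  times the spherical mean of \<open>f\<close>, so it takes the place of a surface integral.\<close>

definition ball_integral :: "nat \<Rightarrow> ((nat \<Rightarrow> real) \<Rightarrow> ennreal) \<Rightarrow> ennreal" where
  "ball_integral d f = (\<integral>\<^sup>+x. f x * indicator {..1} (vnorm d x) \<partial>lebesgue_d d)"

lemma ball_integral_one_pos: "0 < ball_integral d (\<lambda>_. 1)"
proof -
  interpret product_sigma_finite "\<lambda>_::nat. lborel :: real measure" by standard
  \<comment> \<open>A cube of half-width 1 / (d + 1) fits into the ball, because d r <= 1 and r <= 1
    give d r^2 <= 1.\<close>
  obtain r :: real where r: "0 < r" "r \<le> 1" "real d * r \<le> 1"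
    by (rule that[of "1 / (real d + 1)"]) (simp_all add: divide_le_eq)
  let ?A = "PiE {..<d} (\<lambda>_. {- r .. r})"
  have 1: "indicator ?A x \<le> (1 * indicator {..1} (vnorm d x) :: ennreal)" for x
  proof (cases "x \<in> ?A")
    case True
    then have b: "\<bar>x i\<bar> \<le> r" if "i < d" for i using that by (auto simp: PiE_def Pi_def abs_le_iff)
    have "(x i)\<^sup>2 \<le> r\<^sup>2" if "i < d" for i
      using b[OF that] by (metis abs_ge_zero power2_abs power_mono)
    then have "(\<Sum>i<d. (x i)\<^sup>2) \<le> (\<Sum>i<d. r\<^sup>2)" by (intro sum_mono) auto
    also have "\<dots> \<le> 1"
      using mult_mono[OF r(3) r(2)] r(1) by (simp add: power2_eq_square mult_ac)
    finally have "vnorm d x \<le> 1" by (simp add: vnorm_def)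
    then show ?thesis by (auto split: split_indicator)
  qed simp
  have A: "?A \<in> sets (lebesgue_d d)"
    unfolding lebesgue_d_def by (intro sets_PiM_I_finite) auto
  have "0 < (\<Prod>i<d. emeasure lborel {- r .. r})"
    using r(1) by (simp add: ennreal_power)
  also have "\<dots> = emeasure (lebesgue_d d) ?A"
    unfolding lebesgue_d_def by (intro emeasure_PiM[symmetric]) auto
  also have "\<dots> = (\<integral>\<^sup>+x. indicator ?A x \<partial>lebesgue_d d)"
    using A by simp
  also have "\<dots> \<le> ball_integral d (\<lambda>_. 1)"
    unfolding ball_integral_def using 1 by (intro nn_integral_mono)
  finally show ?thesis .
qed

lemma ball_integral_one_finite: "ball_integral d (\<lambda>_. 1) < \<infinity>"
proof -
  interpret product_sigma_finite "\<lambda>_::nat. lborel :: real measure" by standard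
  let ?A = "PiE {..<d} (\<lambda>_. {-1 .. 1 :: real})"
  have A: "?A \<in> sets (lebesgue_d d)"
    unfolding lebesgue_d_def by (intro sets_PiM_I_finite) auto
  have "ball_integral d (\<lambda>_. 1) \<le> (\<integral>\<^sup>+x. indicator ?A x \<partial>lebesgue_d d)"
    unfolding ball_integral_def
  proof (intro nn_integral_mono)
    fix x assume x: "x \<in> space (lebesgue_d d)"
    show "(1 * indicator {..1} (vnorm d x) :: ennreal) \<le> indicator ?A x"
    proof (cases "vnorm d x \<le> 1")
      case True
      then have "\<bar>x i\<bar> \<le> 1" if "i < d" for i using abs_le_vnorm[OF that, of x] by simp
      then have "x \<in> ?A" using x by (auto simp: space_lebesgue_d borel_d_def space_PiM PiE_def Pi_def abs_le_iff)
      then show ?thesis by (auto split: split_indicator)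
    qed simp
  qed
  also have "\<dots> = (\<Prod>i<d. emeasure lborel {-1 .. 1 :: real})"
    using A unfolding lebesgue_d_def by (subst nn_integral_indicator, simp, intro emeasure_PiM) auto
  also have "\<dots> < \<infinity>" by (simp add: less_top[symmetric] power_eq_top_ennreal)
  finally show ?thesis .
qed

lemma nn_integral_ball_scaled:
  assumes [measurable]: "f \<in> borel_measurable (borel_d d)"
    and hom: "\<And>s x. 0 < s \<Longrightarrow> f (dilate d s x) = f x" and "0 < s"
  shows "(\<integral>\<^sup>+x. f x * indicator {..s} (vnorm d x) \<partial>lebesgue_d d) = ennreal (s ^ d) * ball_integral d f"
proof -
  have "indicator {..s} (s * vnorm d x) = (indicator {..1} (vnorm d x) :: ennreal)" for x
    using assms(3) by (simp add: indicator_def)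
  then show ?thesis
    using assms(3) unfolding ball_integral_def
    by (subst nn_integral_lebesgue_d_dilate[of s]) (auto simp: vnorm_dilate hom)
qed

text \<open>By homogeneity the image of \<open>f dx\<close> under the norm gives \<open>{..s}\<close> the mass \<open>s ^ d\<close> times that
  of \<open>{..1}\<close>, which determines it up to a factor.\<close>

lemma polar_decomposition:
  assumes "0 < d" and f[measurable]: "f \<in> borel_measurable (borel_d d)"
    and hom: "\<And>s x. 0 < s \<Longrightarrow> f (dilate d s x) = f x"
    and fin: "ball_integral d f < \<infinity>"
    and [measurable]: "h \<in> borel_measurable borel"
  shows "ball_integral d (\<lambda>_. 1) * (\<integral>\<^sup>+x. f x * h (vnorm d x) \<partial>lebesgue_d d) =
    ball_integral d f * (\<integral>\<^sup>+x. h (vnorm d x) \<partial>lebesgue_d d)"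
proof -
  let ?\<nu> = "\<lambda>f. distr (density (lebesgue_d d) f) borel (vnorm d)"
  have em: "emeasure (?\<nu> g) {..s} = (\<integral>\<^sup>+x. g x * indicator {..s} (vnorm d x) \<partial>lebesgue_d d)"
    if [measurable]: "g \<in> borel_measurable (borel_d d)" for g s
    by (subst emeasure_distr, measurable, subst emeasure_density)
       (auto intro!: nn_integral_cong measurable_sets simp: indicator_def cong: measurable_cong_sets)
  \<comment> \<open>The origin carries no mass: for t <= 1 the interval {..t} has mass t^d times a
    finite constant, at most t times that constant since d > 0, and t is arbitrarily small.\<close>
  have em0: "emeasure (?\<nu> g) {..s} = 0"
    if [measurable]: "g \<in> borel_measurable (borel_d d)"
      and hg: "\<And>s x. 0 < s \<Longrightarrow> g (dilate d s x) = g x" and fg: "ball_integral d g < \<infinity>" and "s \<le> 0" for g s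
  proof -
    have "emeasure (?\<nu> g) {..s} \<le> ennreal e" if "0 < e" for e
    proof -
      obtain c where c: "ball_integral d g = ennreal c" "0 \<le> c"
        using fg by (cases "ball_integral d g") auto
      define t where "t = min 1 (e / (c + 1))"
      have t: "0 < t" "t \<le> 1" using that c by (auto simp: t_def)
      have "emeasure (?\<nu> g) {..s} \<le> emeasure (?\<nu> g) {..t}"
        using t \<open>s \<le> 0\<close> by (intro emeasure_mono) auto
      also have "\<dots> = ennreal (t ^ d) * ennreal c"
        using t by (subst em) (auto simp: nn_integral_ball_scaled hg c)
      also have "\<dots> \<le> ennreal (t * c)"
      proof -
        have "t ^ d \<le> t ^ 1" using t assms(1) by (intro power_decreasing) auto
        then show ?thesis using t c by (simp flip: ennreal_mult) (intro ennreal_leI mult_right_mono, auto)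
      qed
      also have "\<dots> \<le> ennreal e"
      proof (rule ennreal_leI)
        have "t * c \<le> e / (c + 1) * (c + 1)"
          using t c that by (intro mult_mono) (auto simp: t_def)
        then show "t * c \<le> e" using c by simp
      qed
      finally show ?thesis .
    qed
    then show ?thesis by (metis ennreal_0 ennreal_le_epsilon le_zero_eq add_0 ennreal_zero_less_top top.not_eq_extremum zero_le)
  qed
  let ?E = "range atMost :: real set set"
  \<comment> \<open>Each measure is scaled by the constant of the other, which avoids a quotient of
    extended reals; the intervals {..s} generate the Borel sets and are closed under
    intersection.\<close>
  have "scale_measure (ball_integral d (\<lambda>_. 1)) (?\<nu> f) = scale_measure (ball_integral d f) (?\<nu> (\<lambda>_. 1))"
  proof (rule measure_eqI_generator_eq[where E = ?E and \<Omega> = UNIV and A = "\<lambda>n. {..real n}"])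
    show "Int_stable ?E"
      by (auto simp: Int_stable_def)
    show "emeasure (scale_measure (ball_integral d (\<lambda>_. 1)) (?\<nu> f)) X = emeasure (scale_measure (ball_integral d f) (?\<nu> (\<lambda>_. 1))) X"
      if XE: "X \<in> ?E" for X
    proof -
      obtain s where X: "X = {..s}" using XE by auto
      show ?thesis
      proof (cases "0 < s")
        case True
        then show ?thesis
          by (simp add: X em nn_integral_ball_scaled hom del: mult_1_left) (simp add: mult_ac)
      next
        case False
        then show ?thesis using em0[OF f hom fin, of s] em0[of "\<lambda>_. 1" s] ball_integral_one_finite[of d]
          by (simp add: X)
      qed
    qed
    show "range (\<lambda>n. {..real n}) \<subseteq> ?E" by auto
    show "(\<Union>n. {..real n}) = UNIV" by (auto intro: real_arch_simple)
    show "emeasure (scale_measure (ball_integral d (\<lambda>_. 1)) (?\<nu> f)) {..real n} \<noteq> \<infinity>" for n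
    proof (cases "0 < real n")
      case True
      then show ?thesis using fin ball_integral_one_finite[of d]
        by (auto simp: em nn_integral_ball_scaled hom ennreal_mult_eq_top_iff)
    next
      case False
      then show ?thesis using em0[OF f hom fin, of "real n"] by simp
    qed
  qed (auto simp: borel_eq_atMost)
  then have "(\<integral>\<^sup>+r. h r \<partial>scale_measure (ball_integral d (\<lambda>_. 1)) (?\<nu> f)) =
     (\<integral>\<^sup>+r. h r \<partial>scale_measure (ball_integral d f) (?\<nu> (\<lambda>_. 1)))" by simp
  then show ?thesis
    by (simp add: nn_integral_scale_measure nn_integral_distr nn_integral_density)
qed

section \<open>Independence of norm and direction of a Gaussian vector\<close>

lemma Lambda_G_eq: "Lambda_G d = gauss_d (1 / sqrt (real d)) d"
  by (simp add: Lambda_G_def gauss_d_def)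

lemma sets_gauss_d [measurable_cong]: "sets (gauss_d \<sigma> d) = sets (borel_d d)"
  unfolding gauss_d_def borel_d_def by (intro sets_PiM_cong) auto

definition gauss_profile :: "real \<Rightarrow> nat \<Rightarrow> real \<Rightarrow> real" where
  "gauss_profile \<sigma> d r = (1 / sqrt (2 * pi * \<sigma>\<^sup>2)) ^ d * exp (- r\<^sup>2 / (2 * \<sigma>\<^sup>2))"

lemma gauss_profile_measurable [measurable]: "gauss_profile \<sigma> d \<in> borel_measurable borel"
  unfolding gauss_profile_def[abs_def] by measurable

text \<open>The Gaussian density depends on the norm alone. As a density over
  \<open>lebesgue_d\<close> it can be absorbed into the radial factor of
  \<open>polar_decomposition\<close>.\<close>

lemma gauss_d_eq_density:
  assumes "0 < \<sigma>"
  shows "gauss_d \<sigma> d = density (lebesgue_d d) (\<lambda>x. ennreal (gauss_profile \<sigma> d (vnorm d x)))"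
proof -
  interpret L: product_sigma_finite "\<lambda>_::nat. lborel :: real measure" by standard
  interpret prob_space "density lborel (normal_density 0 \<sigma>)"
    by (rule prob_space_normal_density) (rule assms)
  interpret product_sigma_finite "\<lambda>_::nat. density lborel (normal_density 0 \<sigma>)" by standard
  have prof: "gauss_profile \<sigma> d (vnorm d x) = (\<Prod>i<d. normal_density 0 \<sigma> (x i))" for x
  proof -
    have "(\<Prod>i<d. normal_density 0 \<sigma> (x i)) = (1 / sqrt (2 * pi * \<sigma>\<^sup>2)) ^ d * exp (\<Sum>i<d. - (x i)\<^sup>2 / (2 * \<sigma>\<^sup>2))"
      unfolding normal_density_def by (simp only: prod.distrib exp_sum[OF finite_lessThan]) simp
    also have "(\<Sum>i<d. - (x i)\<^sup>2 / (2 * \<sigma>\<^sup>2)) = - (vnorm d x)\<^sup>2 / (2 * \<sigma>\<^sup>2)"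
      unfolding vnorm_square by (simp add: sum_negf flip: sum_divide_distrib)
    finally show ?thesis by (simp add: gauss_profile_def)
  qed
  have "density (lebesgue_d d) (\<lambda>x. ennreal (gauss_profile \<sigma> d (vnorm d x))) =
    PiM {..<d} (\<lambda>_. density lborel (normal_density 0 \<sigma>))"
  proof (rule PiM_eqI)
    show "sets (density (lebesgue_d d) (\<lambda>x. ennreal (gauss_profile \<sigma> d (vnorm d x)))) =
      PiM {..<d} (\<lambda>_. density lborel (normal_density 0 \<sigma>))"
      using sets_gauss_d[of \<sigma> d] by (simp add: sets_lebesgue_d gauss_d_def)
  next
    fix A assume A: "\<And>i. i \<in> {..<d} \<Longrightarrow> A i \<in> sets (density lborel (normal_density 0 \<sigma>))"
    have PA: "PiE {..<d} A \<in> sets (borel_d d)"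
      unfolding borel_d_def using A by (intro sets_PiM_I_finite) auto
    have "emeasure (density (lebesgue_d d) (\<lambda>x. ennreal (gauss_profile \<sigma> d (vnorm d x)))) (PiE {..<d} A) =
      (\<integral>\<^sup>+x. ennreal (gauss_profile \<sigma> d (vnorm d x)) * indicator (PiE {..<d} A) x \<partial>lebesgue_d d)"
      using PA by (subst emeasure_density) (auto simp: sets_lebesgue_d)
    also have "\<dots> = (\<integral>\<^sup>+x. (\<Prod>i<d. ennreal (normal_density 0 \<sigma> (x i)) * indicator (A i) (x i)) \<partial>lebesgue_d d)"
    proof (intro nn_integral_cong)
      fix x assume "x \<in> space (lebesgue_d d)"
      then have "indicator (PiE {..<d} A) x = (\<Prod>i<d. indicator (A i) (x i) :: ennreal)"
        by (auto simp: lebesgue_d_def space_PiM PiE_def Pi_def split: split_indicator)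
      then show "ennreal (gauss_profile \<sigma> d (vnorm d x)) * indicator (PiE {..<d} A) x =
        (\<Prod>i<d. ennreal (normal_density 0 \<sigma> (x i)) * indicator (A i) (x i))"
        by (simp add: prof prod.distrib prod_ennreal)
    qed
    also have "\<dots> = (\<Prod>i<d. \<integral>\<^sup>+y. ennreal (normal_density 0 \<sigma> y) * indicator (A i) y \<partial>lborel)"
      unfolding lebesgue_d_def using A by (intro L.product_nn_integral_prod) auto
    also have "\<dots> = (\<Prod>i\<in>{..<d}. emeasure (density lborel (normal_density 0 \<sigma>)) (A i))"
      using A by (intro prod.cong) (auto simp: emeasure_density)
    finally show "emeasure (density (lebesgue_d d) (\<lambda>x. ennreal (gauss_profile \<sigma> d (vnorm d x)))) (PiE {..<d} A) =
      (\<Prod>i\<in>{..<d}. emeasure (density lborel (normal_density 0 \<sigma>)) (A i))" .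
  qed simp
  then show ?thesis by (simp add: gauss_d_def)
qed

lemma unit_ball_measurable: "{x \<in> space (lebesgue_d d). vnorm d x \<le> 1} \<in> sets (lebesgue_d d)"
  by measurable

lemma emeasure_unit_ball:
  "emeasure (lebesgue_d d) {x \<in> space (lebesgue_d d). vnorm d x \<le> 1} = ball_integral d (\<lambda>_. 1)"
proof -
  let ?B = "{x \<in> space (lebesgue_d d). vnorm d x \<le> 1}"
  have "emeasure (lebesgue_d d) ?B = (\<integral>\<^sup>+x. indicator ?B x \<partial>lebesgue_d d)"
    using unit_ball_measurable by simp
  also have "\<dots> = ball_integral d (\<lambda>_. 1)"
    unfolding ball_integral_def by (intro nn_integral_cong) (auto split: split_indicator)
  finally show ?thesis .
qed

lemma Lambda_U_dir: "Lambda_U d = distr (uniform_measure (lebesgue_d d) {x \<in> space (lebesgue_d d). vnorm d x \<le> 1})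
      (borel_d d) (dir d)"
  by (simp add: Lambda_U_def dir_def[abs_def])

lemma sets_Lambda_U [measurable_cong]: "sets (Lambda_U d) = sets (borel_d d)"
  by (simp add: Lambda_U_def)

lemma prob_space_Lambda_U: "prob_space (Lambda_U d)"
proof -
  interpret prob_space "uniform_measure (lebesgue_d d) {x \<in> space (lebesgue_d d). vnorm d x \<le> 1}"
    using ball_integral_one_finite[of d] ball_integral_one_pos[of d]
    by (intro prob_space_uniform_measure) (auto simp: emeasure_unit_ball)
  show ?thesis unfolding Lambda_U_dir by (intro prob_space_distr) measurable
qed

lemma nn_integral_Lambda_U:
  assumes [measurable]: "g \<in> borel_measurable (borel_d d)"
  shows "ball_integral d (\<lambda>_. 1) * (\<integral>\<^sup>+x. g x \<partial>Lambda_U d) = ball_integral d (\<lambda>x. g (dir d x))"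
proof -
  let ?B = "{x \<in> space (lebesgue_d d). vnorm d x \<le> 1}"
  let ?I = "ball_integral d (\<lambda>_. 1)"
  have "(\<integral>\<^sup>+x. g x \<partial>Lambda_U d) = (\<integral>\<^sup>+x. g (dir d x) \<partial>uniform_measure (lebesgue_d d) ?B)"
    unfolding Lambda_U_dir by (rule nn_integral_distr) measurable
  also have "\<dots> = (\<integral>\<^sup>+x. g (dir d x) * indicator ?B x \<partial>lebesgue_d d) / ?I"
    using unit_ball_measurable by (subst nn_integral_uniform_measure) (auto simp: emeasure_unit_ball)
  also have "(\<integral>\<^sup>+x. g (dir d x) * indicator ?B x \<partial>lebesgue_d d) = ball_integral d (\<lambda>x. g (dir d x))"
    unfolding ball_integral_def by (intro nn_integral_cong) (auto split: split_indicator)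
  finally have "(\<integral>\<^sup>+x. g x \<partial>Lambda_U d) = ball_integral d (\<lambda>x. g (dir d x)) / ?I" .
  then show ?thesis
    using ball_integral_one_finite[of d] ball_integral_one_pos[of d]
    by (simp add: ennreal_times_divide mult.commute[of ?I] ennreal_mult_divide_eq)
qed

text \<open>Independence of norm and direction, the direction having law \<open>Lambda_U\<close>.
  Both sides are multiplied by the volume of the ball, which is positive and finite and cancels
  after \<open>polar_decomposition\<close>. Boundedness of \<open>g\<close> on directions provides
  the finite ball integral.\<close>

lemma nn_integral_gauss_polar:
  assumes "0 < d" "0 < \<sigma>" and [measurable]: "g \<in> borel_measurable (borel_d d)" "h \<in> borel_measurable borel"
    and bdd: "\<And>x. g (dir d x) \<le> ennreal c"
  shows "(\<integral>\<^sup>+x. g (dir d x) * h (vnorm d x) \<partial>gauss_d \<sigma> d) =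
    (\<integral>\<^sup>+x. g x \<partial>Lambda_U d) * (\<integral>\<^sup>+x. h (vnorm d x) \<partial>gauss_d \<sigma> d)"
proof -
  let ?I = "ball_integral d (\<lambda>_. 1)" and ?p = "\<lambda>r. ennreal (gauss_profile \<sigma> d r)"
  have fin: "ball_integral d (\<lambda>x. g (dir d x)) < \<infinity>"
  proof -
    have "ball_integral d (\<lambda>x. g (dir d x)) \<le> (\<integral>\<^sup>+x. ennreal c * (1 * indicator {..1} (vnorm d x)) \<partial>lebesgue_d d)"
      unfolding ball_integral_def using bdd by (intro nn_integral_mono) (auto split: split_indicator)
    also have "\<dots> = ennreal c * ?I"
      unfolding ball_integral_def by (rule nn_integral_cmult) measurable
    also have "\<dots> < \<infinity>" using ball_integral_one_finite[of d] by (simp add: ennreal_mult_less_top)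
    finally show ?thesis .
  qed
  have "?I * (\<integral>\<^sup>+x. g (dir d x) * h (vnorm d x) \<partial>gauss_d \<sigma> d) =
    ?I * (\<integral>\<^sup>+x. g (dir d x) * (?p (vnorm d x) * h (vnorm d x)) \<partial>lebesgue_d d)"
    unfolding gauss_d_eq_density[OF assms(2)] by (subst nn_integral_density) (auto simp: mult_ac)
  also have "\<dots> = ball_integral d (\<lambda>x. g (dir d x)) * (\<integral>\<^sup>+x. ?p (vnorm d x) * h (vnorm d x) \<partial>lebesgue_d d)"
    using polar_decomposition[where f = "\<lambda>x. g (dir d x)" and h = "\<lambda>r. ?p r * h r" and d = d] assms(1) fin
    by (simp add: dir_dilate)
  also have "\<dots> = ?I * ((\<integral>\<^sup>+x. g x \<partial>Lambda_U d) * (\<integral>\<^sup>+x. h (vnorm d x) \<partial>gauss_d \<sigma> d))"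
    unfolding nn_integral_Lambda_U[OF assms(3), symmetric] gauss_d_eq_density[OF assms(2)]
    by (subst nn_integral_density) (auto simp: mult_ac)
  finally show ?thesis
    using ball_integral_one_finite[of d] ball_integral_one_pos[of d]
    by (subst (asm) ennreal_mult_cancel_left) auto
qed

lemma nn_integral_gauss_dir:
  assumes "0 < d" "0 < \<sigma>" "g \<in> borel_measurable (borel_d d)" "\<And>x. g (dir d x) \<le> ennreal c"
  shows "(\<integral>\<^sup>+x. g (dir d x) \<partial>gauss_d \<sigma> d) = (\<integral>\<^sup>+x. g x \<partial>Lambda_U d)"
  using nn_integral_gauss_polar[OF assms(1-3), of "\<lambda>_. 1" c] assms(4)
    prob_space.emeasure_space_1[OF prob_space_gauss_d[OF assms(2)], of d] by simp

text \<open>At variance 1 / d the squared norm has mean 1 and is independent of the direction, so it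
  may be inserted as a weight.\<close>

lemma nn_integral_gauss_dir_square:
  assumes "0 < d" "g \<in> borel_measurable (borel_d d)" "\<And>x. g (dir d x) \<le> ennreal c"
  shows "(\<integral>\<^sup>+x. g (dir d x) * ennreal ((vnorm d x)\<^sup>2) \<partial>gauss_d (1 / sqrt (real d)) d) = (\<integral>\<^sup>+x. g x \<partial>Lambda_U d)"
proof -
  have s: "0 < 1 / sqrt (real d)" using assms by simp
  show ?thesis
    using nn_integral_gauss_polar[OF assms(1) s assms(2), of "\<lambda>r. ennreal (r\<^sup>2)" c] assms(1,3)
      gauss_norm_second_moment[OF s, of d]
    by (simp add: vnorm_square power_divide)
qed

text \<open>A crude bound for the form on directions. Only its finiteness matters: it yields the
  constant \<open>c\<close> required by the polar formulas.\<close>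

definition abs_entries :: "nat \<Rightarrow> (nat \<Rightarrow> nat \<Rightarrow> real) \<Rightarrow> real" where
  "abs_entries d M = (\<Sum>i<d. \<Sum>j<d. \<bar>M i j\<bar>)"

lemma abs_qform_dir_le: "\<bar>qform d M (dir d x)\<bar> \<le> abs_entries d M"
  unfolding qform_def abs_entries_def
proof (intro order.trans[OF sum_abs] sum_mono)
  fix i j assume ij: "i \<in> {..<d}" "j \<in> {..<d}"
  have "\<bar>dir d x i\<bar> * \<bar>M i j\<bar> * \<bar>dir d x j\<bar> \<le> 1 * \<bar>M i j\<bar> * 1"
    using ij abs_dir_le_1[of i d x] abs_dir_le_1[of j d x] by (intro mult_mono) auto
  then show "\<bar>dir d x i * M i j * dir d x j\<bar> \<le> \<bar>M i j\<bar>" by (simp add: abs_mult)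
qed

text \<open>The form is homogeneous of degree two and the squared norm has mean 1, so normalizing
  the Gaussian vector does not change the mean.\<close>

lemma nn_integral_abs_qform_Unif:
  assumes "0 < d"
  shows "(\<integral>\<^sup>+x. ennreal \<bar>qform d M x\<bar> \<partial>Lambda_U d) = (\<integral>\<^sup>+x. ennreal \<bar>qform d M x\<bar> \<partial>Lambda_G d)"
proof -
  have "(\<integral>\<^sup>+x. ennreal \<bar>qform d M x\<bar> \<partial>Lambda_G d) =
    (\<integral>\<^sup>+x. ennreal \<bar>qform d M (dir d x)\<bar> * ennreal ((vnorm d x)\<^sup>2) \<partial>gauss_d (1 / sqrt (real d)) d)"
    unfolding Lambda_G_eq
    by (intro nn_integral_cong) (subst qform_dir, simp add: abs_mult mult.commute flip: ennreal_mult)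
  also have "\<dots> = (\<integral>\<^sup>+x. ennreal \<bar>qform d M x\<bar> \<partial>Lambda_U d)"
    by (rule nn_integral_gauss_dir_square[where c = "abs_entries d M"]) (auto simp: assms intro!: ennreal_leI abs_qform_dir_le)
  finally show ?thesis by simp
qed

text \<open>Jensen's inequality in the radial variable, in the tangent-line form
  \<open>exp (r\<^sup>2 y) \<ge> exp y * (1 + (r\<^sup>2 - 1) y)\<close> with \<open>E r\<^sup>2 = 1\<close>.\<close>

lemma nn_integral_exp_qform_Unif:
  assumes "0 < d" "0 \<le> l"
  shows "(\<integral>\<^sup>+x. ennreal (exp (l * \<bar>qform d M x\<bar>)) \<partial>Lambda_U d) \<le> (\<integral>\<^sup>+x. ennreal (exp (l * \<bar>qform d M x\<bar>)) \<partial>Lambda_G d)"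
proof -
  let ?G = "gauss_d (1 / sqrt (real d)) d"
  have s: "0 < 1 / sqrt (real d)" using assms by simp
  define y where "y x = l * \<bar>qform d M x\<bar>" for x
  have y0: "0 \<le> y x" for x using assms by (simp add: y_def)
  define c where "c = l * abs_entries d M"
  have yc: "y (dir d x) \<le> c" for x
    using assms abs_qform_dir_le[of d M x] by (simp add: y_def c_def mult_left_mono)
  have [measurable]: "y \<in> borel_measurable (borel_d d)" unfolding y_def[abs_def] by measurable
  let ?g = "\<lambda>x. ennreal (exp (y x))" and ?k = "\<lambda>x. ennreal (exp (y x) * y x)"
  have gb: "?g (dir d x) \<le> ennreal (exp c)" for x using yc by (intro ennreal_leI) simp
  have kb: "?k (dir d x) \<le> ennreal (exp c * c)" for x using yc y0 by (intro ennreal_leI mult_mono) auto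
  \<comment> \<open>The tangent-line inequality is integrated with its negative term moved to the
    other side, since extended nonnegative reals do not subtract well; finiteness allows the term to
    be cancelled at the end.\<close>
  have kfin: "(\<integral>\<^sup>+x. ?k x \<partial>Lambda_U d) < \<infinity>"
  proof -
    interpret prob_space ?G by (rule prob_space_gauss_d[OF s])
    have "(\<integral>\<^sup>+x. ?k x \<partial>Lambda_U d) = (\<integral>\<^sup>+x. ?k (dir d x) \<partial>?G)"
      by (rule nn_integral_gauss_dir[where g = "\<lambda>x. ?k x" and c = "exp c * c", OF assms(1) s _ kb, symmetric]) measurable
    also have "\<dots> \<le> (\<integral>\<^sup>+x. ennreal (exp c * c) \<partial>?G)" using kb by (intro nn_integral_mono)
    also have "\<dots> < \<infinity>" by (simp add: emeasure_space_1)
    finally show ?thesis .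
  qed
  have "(\<integral>\<^sup>+x. ?g x \<partial>Lambda_U d) + (\<integral>\<^sup>+x. ?k x \<partial>Lambda_U d) =
    (\<integral>\<^sup>+x. ?g (dir d x) \<partial>?G) + (\<integral>\<^sup>+x. ?k (dir d x) * ennreal ((vnorm d x)\<^sup>2) \<partial>?G)"
    by (subst nn_integral_gauss_dir[where g = "\<lambda>x. ?g x" and c = "exp c", OF assms(1) s _ gb], measurable,
        subst nn_integral_gauss_dir_square[where g = "\<lambda>x. ?k x" and c = "exp c * c", OF assms(1) _ kb], measurable)
  also have "\<dots> = (\<integral>\<^sup>+x. ?g (dir d x) + ?k (dir d x) * ennreal ((vnorm d x)\<^sup>2) \<partial>?G)"
    by (rule nn_integral_add[symmetric]) measurable
  also have "\<dots> \<le> (\<integral>\<^sup>+x. ?g x + ?k (dir d x) \<partial>?G)"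
  proof (intro nn_integral_mono)
    fix x
    define r2 z where "r2 = (vnorm d x)\<^sup>2" and "z = y (dir d x)"
    have yx: "y x = r2 * z" by (simp add: y_def r2_def z_def qform_dir[of d M x] abs_mult)
    have "exp z * (1 + (r2 * z - z)) \<le> exp z * exp (r2 * z - z)"
      by (intro mult_left_mono exp_ge_add_one_self) auto
    then have "exp z + exp z * z * r2 \<le> exp (y x) + exp z * z"
      by (simp add: yx mult_exp_exp algebra_simps)
    then show "?g (dir d x) + ?k (dir d x) * ennreal ((vnorm d x)\<^sup>2) \<le> ?g x + ?k (dir d x)"
      using y0[of "dir d x"] by (simp add: z_def r2_def ennreal_leI flip: ennreal_mult ennreal_plus)
  qed
  also have "\<dots> = (\<integral>\<^sup>+x. ?g x \<partial>?G) + (\<integral>\<^sup>+x. ?k x \<partial>Lambda_U d)"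
    by (subst nn_integral_add, measurable,
        subst nn_integral_gauss_dir[where g = "\<lambda>x. ?k x" and c = "exp c * c", OF assms(1) s _ kb]) measurable
  finally show ?thesis
    using kfin by (auto simp: Lambda_G_eq y_def[abs_def] ennreal_add_left_cancel_le add.commute)
qed

lemma norm_second_moment_Unif:
  assumes "0 < d"
  shows "(\<integral>\<^sup>+x. ennreal (\<Sum>i<d. (x i)\<^sup>2) \<partial>Lambda_U d) \<le> 1"
proof -
  let ?G = "gauss_d (1 / sqrt (real d)) d"
  have s: "0 < 1 / sqrt (real d)" using assms by simp
  interpret prob_space ?G by (rule prob_space_gauss_d[OF s])
  have "(\<integral>\<^sup>+x. ennreal (\<Sum>i<d. (x i)\<^sup>2) \<partial>Lambda_U d) = (\<integral>\<^sup>+x. ennreal (\<Sum>i<d. (dir d x i)\<^sup>2) \<partial>?G)"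
    using vnorm_dir_le_1 by (intro nn_integral_gauss_dir[OF assms s, symmetric, where c = 1] ennreal_leI) measurable
  also have "\<dots> \<le> (\<integral>\<^sup>+x. ennreal 1 \<partial>?G)"
    using vnorm_dir_le_1 by (intro nn_integral_mono ennreal_leI)
  finally show ?thesis by (simp add: emeasure_space_1)
qed

section \<open>Concentration of the measurements\<close>

lemma sets_Lambda [measurable_cong]: "sets (Lambda e d) = sets (borel_d d)"
  by (cases e) (simp_all add: Lambda_def sets_Lambda_U Lambda_G_eq sets_gauss_d)

lemma prob_space_Lambda: "0 < d \<Longrightarrow> prob_space (Lambda e d)"
  by (cases e) (simp_all add: Lambda_def prob_space_Lambda_U Lambda_G_eq prob_space_gauss_d)

lemma Lambda_norm_second_moment:
  "0 < d \<Longrightarrow> (\<integral>\<^sup>+x. ennreal (\<Sum>i<d. (x i)\<^sup>2) \<partial>Lambda e d) \<le> 1"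
  using norm_second_moment_Unif[of d] gauss_norm_second_moment[of "1 / sqrt (real d)" d]
  by (cases e) (simp_all add: Lambda_def Lambda_G_eq power_divide)

lemma nn_integral_abs_qform_Lambda:
  "0 < d \<Longrightarrow> (\<integral>\<^sup>+x. ennreal \<bar>qform d M x\<bar> \<partial>Lambda e d) = (\<integral>\<^sup>+x. ennreal \<bar>qform d M x\<bar> \<partial>Lambda_G d)"
  by (cases e) (simp_all add: Lambda_def nn_integral_abs_qform_Unif)

lemma integrable_qform:
  assumes "0 < d" "symmetric d M"
  shows "integrable (Lambda e d) (qform d M)"
  using gauss_abs_qform_finite[of "1 / sqrt (real d)" d M] assms
  by (intro integrableI_bounded) (simp_all add: nn_integral_abs_qform_Lambda Lambda_G_eq)

lemma nn_integral_Lnorm: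
  assumes "0 < d" "symmetric d M"
  shows "(\<integral>\<^sup>+x. ennreal \<bar>qform d M x\<bar> \<partial>Lambda e d) = ennreal (Lnorm e d M)"
  unfolding Lnorm_def using integrable_qform[OF assms]
  by (intro nn_integral_eq_integral integrable_abs) auto

lemma Lnorm_nonneg: "0 \<le> Lnorm e d M"
  by (simp add: Lnorm_def)

text \<open>The factor \<open>d\<close> is the inverse variance of a Gaussian coordinate. Through
  the Frobenius norm, \<open>Lnorm\<close> dominates every entry, which connects the entrywise net
  with this norm.\<close>

lemma Lnorm_lower:
  assumes "0 < d" "symmetric d M"
  shows "\<bar>mtrace d M\<bar> + sqrt (frob2 d M) \<le> 2^15 * real d * Lnorm e d M"
proof (cases "0 < \<bar>mtrace d M\<bar> + sqrt (frob2 d M)")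
  case True
  have "ennreal ((1 / sqrt (real d))\<^sup>2 * (\<bar>mtrace d M\<bar> + sqrt (frob2 d M)) / 2^15) \<le> ennreal (Lnorm e d M)"
    unfolding nn_integral_Lnorm[OF assms, symmetric] nn_integral_abs_qform_Lambda[OF assms(1)] Lambda_G_eq
    using True assms by (intro gauss_abs_qform_lower mult_pos_pos) auto
  then have "(\<bar>mtrace d M\<bar> + sqrt (frob2 d M)) / real d / 2^15 \<le> Lnorm e d M"
    using True by (subst (asm) ennreal_le_iff) (auto simp: Lnorm_nonneg power_divide)
  then show ?thesis using assms(1) by (simp add: field_simps)
next
  case False
  then show ?thesis using Lnorm_nonneg[of e d M] by (simp add: not_less mult_nonneg_nonneg order.trans)
qed

lemma abs_entry_le_frob: "i < d \<Longrightarrow> j < d \<Longrightarrow> \<bar>M i j\<bar> \<le> sqrt (frob2 d M)"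
proof -
  assume ij: "i < d" "j < d"
  have "(M i j)\<^sup>2 \<le> (\<Sum>j<d. (M i j)\<^sup>2)" using ij by (intro member_le_sum) auto
  also have "\<dots> \<le> frob2 d M"
    unfolding frob2_def using ij by (intro member_le_sum[where f = "\<lambda>i. \<Sum>j<d. (M i j)\<^sup>2"]) (auto simp: sum_nonneg)
  finally show ?thesis using real_sqrt_le_mono by fastforce
qed

lemma entry_le_Lnorm:
  assumes "0 < d" "symmetric d M" "i < d" "j < d"
  shows "\<bar>M i j\<bar> \<le> 2^15 * real d * Lnorm e d M"
  using Lnorm_lower[OF assms(1,2), of e] abs_entry_le_frob[OF assms(3,4), of M] by linarith

text \<open>Here 2^19 = 16 * 2^15: the first factor is that of \<open>gauss_exp_abs_qform\<close>,
  the second compares \<tau> with the mean. In units of its own mean the variable has an exponential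
  moment free of \<open>d\<close> and \<open>M\<close>, so the concentration rate is uniform over
  the net.\<close>

lemma Lambda_exp_abs_qform:
  assumes "0 < d" "symmetric d M" "0 < Lnorm e d M"
  shows "(\<integral>\<^sup>+x. ennreal (exp (1 / 2^19 * (\<bar>qform d M x\<bar> / Lnorm e d M))) \<partial>Lambda e d) \<le> 4"
proof -
  let ?L = "Lnorm e d M"
  define \<tau> where "\<tau> = (1 / sqrt (real d))\<^sup>2 * (\<bar>mtrace d M\<bar> + sqrt (frob2 d M))"
  have t: "\<tau> = (\<bar>mtrace d M\<bar> + sqrt (frob2 d M)) / real d" by (simp add: \<tau>_def power_divide)
  have tL: "\<tau> \<le> 2^15 * ?L"
    using Lnorm_lower[OF assms(1,2), of e] assms(1) by (simp add: t divide_le_eq mult_ac)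
  have "\<tau> > 0"
  proof (rule ccontr)
    assume "\<not> \<tau> > 0"
    then have "\<bar>mtrace d M\<bar> + sqrt (frob2 d M) \<le> 0"
      using assms(1) by (simp add: t divide_le_eq zero_less_divide_iff not_less)
    then have "\<bar>M i j\<bar> \<le> 0" if "i < d" "j < d" for i j
      using abs_entry_le_frob[OF that, of M] by linarith
    then have "qform d M x = 0" for x by (simp add: qform_def)
    then have "?L = 0" by (simp add: Lnorm_def)
    then show False using assms(3) by simp
  qed
  have G: "(\<integral>\<^sup>+x. ennreal (exp (1 / (16 * \<tau>) * \<bar>qform d M x\<bar>)) \<partial>Lambda_G d) \<le> 4"
    using gauss_exp_abs_qform[of "1 / sqrt (real d)" d M] assms(1,2) \<open>\<tau> > 0\<close>
    by (simp add: Lambda_G_eq \<tau>_def[symmetric])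
  have "(\<integral>\<^sup>+x. ennreal (exp (1 / 2^19 * (\<bar>qform d M x\<bar> / ?L))) \<partial>Lambda e d) \<le>
    (\<integral>\<^sup>+x. ennreal (exp (1 / (16 * \<tau>) * \<bar>qform d M x\<bar>)) \<partial>Lambda e d)"
  proof (intro nn_integral_mono ennreal_leI)
    fix x
    have "1 / (2^19 * ?L) \<le> 1 / (16 * \<tau>)"
      using tL \<open>\<tau> > 0\<close> assms(3) by (intro divide_left_mono) auto
    then have "1 / (2^19 * ?L) * \<bar>qform d M x\<bar> \<le> 1 / (16 * \<tau>) * \<bar>qform d M x\<bar>"
      by (rule mult_right_mono) simp
    then show "exp (1 / 2^19 * (\<bar>qform d M x\<bar> / ?L)) \<le> exp (1 / (16 * \<tau>) * \<bar>qform d M x\<bar>)"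
      by simp
  qed
  also have "\<dots> \<le> 4"
  proof (cases e)
    case Gauss
    then show ?thesis using G by (simp add: Lambda_def)
  next
    case Unif
    then show ?thesis
      using order.trans[OF nn_integral_exp_qform_Unif[OF assms(1), of "1 / (16 * \<tau>)" M] G] \<open>\<tau> > 0\<close>
      by (simp add: Lambda_def)
  qed
  finally show ?thesis .
qed

lemma abs_qform_le:
  assumes "\<And>i j. i < d \<Longrightarrow> j < d \<Longrightarrow> \<bar>M i j\<bar> \<le> c"
  shows "\<bar>qform d M x\<bar> \<le> c * real d * (\<Sum>i<d. (x i)\<^sup>2)"
proof (cases "d = 0")
  case False
  then have c: "0 \<le> c" using assms[of 0 0] by simp
  have "\<bar>qform d M x\<bar> \<le> (\<Sum>i<d. \<Sum>j<d. \<bar>x i * M i j * x j\<bar>)"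
    unfolding qform_def by (intro order.trans[OF sum_abs] sum_mono order.refl)
  also have "\<dots> \<le> (\<Sum>i<d. \<Sum>j<d. c * (\<bar>x i\<bar> * \<bar>x j\<bar>))"
  proof (intro sum_mono)
    fix i j assume "i \<in> {..<d}" "j \<in> {..<d}"
    then show "\<bar>x i * M i j * x j\<bar> \<le> c * (\<bar>x i\<bar> * \<bar>x j\<bar>)"
      using mult_right_mono[OF assms[of i j], of "\<bar>x i\<bar> * \<bar>x j\<bar>"] by (simp add: abs_mult mult_ac)
  qed
  also have "\<dots> = c * (\<Sum>i<d. \<bar>x i\<bar>)\<^sup>2"
    by (simp only: power2_eq_square sum_product) (simp only: sum_distrib_left)
  also have "\<dots> \<le> c * (real d * (\<Sum>i<d. (x i)\<^sup>2))"
    using Cauchy_Schwarz_ineq_sum[of "\<lambda>_. 1" "\<lambda>i. \<bar>x i\<bar>" "{..<d}"] c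
    by (intro mult_left_mono) auto
  finally show ?thesis by (simp add: mult_ac)
qed (simp add: qform_def)

lemma Lnorm_le:
  assumes "0 < d" "symmetric d M" "\<And>i j. i < d \<Longrightarrow> j < d \<Longrightarrow> \<bar>M i j\<bar> \<le> c"
  shows "Lnorm e d M \<le> c * real d"
proof -
  have c: "0 \<le> c" using assms(3)[of 0 0] assms(1) by simp
  have "ennreal (Lnorm e d M) \<le> (\<integral>\<^sup>+x. ennreal (c * real d) * ennreal (\<Sum>i<d. (x i)\<^sup>2) \<partial>Lambda e d)"
    unfolding nn_integral_Lnorm[OF assms(1,2), symmetric] using abs_qform_le[OF assms(3)] c
    by (intro nn_integral_mono) (simp add: ennreal_leI sum_nonneg flip: ennreal_mult)
  also have "\<dots> = ennreal (c * real d) * (\<integral>\<^sup>+x. ennreal (\<Sum>i<d. (x i)\<^sup>2) \<partial>Lambda e d)"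
    by (rule nn_integral_cmult) measurable
  also have "\<dots> \<le> ennreal (c * real d) * 1"
    by (intro mult_left_mono Lambda_norm_second_moment assms) simp
  finally show ?thesis using c by (simp add: ennreal_le_iff)
qed

lemma qform_msub: "qform d (msub A B) x = qform d A x - qform d B x"
  by (simp add: qform_def msub_def sum_subtractf algebra_simps)

lemma Lnorm_diff:
  assumes "0 < d" "symmetric d A" "symmetric d B"
  shows "\<bar>Lnorm e d A - Lnorm e d B\<bar> \<le> Lnorm e d (msub A B)"
proof -
  note [simp] = integrable_qform[OF assms(1,2)] integrable_qform[OF assms(1,3)]
  have "Lnorm e d A - Lnorm e d B = (\<integral>x. \<bar>qform d A x\<bar> - \<bar>qform d B x\<bar> \<partial>Lambda e d)"
    unfolding Lnorm_def by (subst Bochner_Integration.integral_diff) auto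
  also have "\<bar>\<dots>\<bar> \<le> (\<integral>x. \<bar>\<bar>qform d A x\<bar> - \<bar>qform d B x\<bar>\<bar> \<partial>Lambda e d)"
    by (rule integral_abs_bound)
  also have "\<dots> \<le> Lnorm e d (msub A B)"
    unfolding Lnorm_def qform_msub by (intro integral_mono integrable_abs Bochner_Integration.integrable_diff) auto
  finally show ?thesis .
qed

lemma Lnorm_scale: "Lnorm e d (\<lambda>i j. c * M i j) = \<bar>c\<bar> * Lnorm e d M"
  by (simp add: Lnorm_def qform_scale abs_mult)

section \<open>A Bernstein inequality for nonnegative variables of mean one\<close>

lemma exp_le_quadratic: "exp z \<le> 1 + z + z\<^sup>2 * exp \<bar>z\<bar>" for z :: real
proof -
  have "(1 + - z) * exp z \<le> exp (- z) * exp z"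
    by (intro mult_right_mono exp_ge_add_one_self) simp
  then have 1: "exp z - 1 \<le> z * exp z" by (simp add: mult_exp_exp algebra_simps)
  have 2: "z \<le> exp z - 1" using exp_ge_add_one_self[of z] by linarith
  have "exp z - 1 - z \<le> z * (exp z - 1)" using 1 by (simp add: algebra_simps)
  also have "\<dots> \<le> z * (z * exp \<bar>z\<bar>)"
  proof (cases "0 \<le> z")
    case True
    then show ?thesis using 1 by (intro mult_left_mono) auto
  next
    case False
    then have "z * exp \<bar>z\<bar> \<le> z * 1" by (intro mult_left_mono_neg) auto
    then have "z * exp \<bar>z\<bar> \<le> exp z - 1" using 2 by linarith
    then show ?thesis using False by (intro mult_left_mono_neg) auto
  qed
  finally show ?thesis by (simp add: power2_eq_square mult_ac)
qed

text \<open>The factor 4 is the assumed bound on the exponential moment, exp (l / 2) comes from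
  centering at the mean 1, and 1 + 8 / l^2 from dominating (w - 1)^2 by an exponential.\<close>

definition bern_const :: "real \<Rightarrow> real" where
  "bern_const l = 4 * (exp (l / 2) * (1 + 8 / l\<^sup>2))"

text \<open>The linear Taylor term has mean zero. In the remainder, half of the available exponent
  dominates (W - 1)^2 and the other half dominates exp |\<theta> (W - 1)|; this split is the origin
  of |\<theta>| <= l / 2.\<close>

lemma centered_mgf_bound:
  fixes W :: "'a \<Rightarrow> real"
  assumes "prob_space P" and [measurable]: "W \<in> borel_measurable P"
    and W0: "\<And>x. 0 \<le> W x" and W1: "(\<integral>\<^sup>+x. ennreal (W x) \<partial>P) = 1"
    and l: "0 < l" and We: "(\<integral>\<^sup>+x. ennreal (exp (l * W x)) \<partial>P) \<le> 4"
    and th: "\<bar>\<theta>\<bar> \<le> l / 2"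
  shows "(\<integral>\<^sup>+x. ennreal (exp (\<theta> * (W x - 1))) \<partial>P) \<le> ennreal (exp (bern_const l * \<theta>\<^sup>2))"
proof -
  interpret prob_space P by fact
  define B where "B = exp (l / 2) * (1 + 8 / l\<^sup>2)"
  have B0: "0 \<le> B" using l by (simp add: B_def)
  have iW: "integrable P W" using W0 W1 by (intro integrableI_nonneg) auto
  have eW: "(\<integral>x. W x \<partial>P) = 1" using W0 W1 by (simp add: integral_eq_nn_integral)
  have iE: "integrable P (\<lambda>x. exp (l * W x))"
    using We by (intro integrableI_nonneg) (auto simp: le_less_trans)
  have eE: "(\<integral>x. exp (l * W x) \<partial>P) \<le> 4"
    using We enn2real_mono[OF We] by (subst integral_eq_nn_integral) auto
  have pt: "exp (\<theta> * (W x - 1)) \<le> 1 + \<theta> * (W x - 1) + \<theta>\<^sup>2 * B * exp (l * W x)" for x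
  proof -
    let ?w = "W x" and ?z = "\<theta> * (W x - 1)"
    have z: "\<bar>?z\<bar> \<le> l / 2 + l * ?w / 2"
    proof -
      have "\<bar>?z\<bar> \<le> l / 2 * (?w + 1)"
        unfolding abs_mult using th W0[of x] l by (intro mult_mono) auto
      then show ?thesis by (simp add: algebra_simps)
    qed
    have "(l * ?w / 2)\<^sup>2 / 2 \<le> exp (l * ?w / 2)"
    proof -
      have "0 \<le> l * ?w / 2" using l W0[of x] by simp
      then show ?thesis using exp_lower_Taylor_quadratic[of "l * ?w / 2"] by linarith
    qed
    then have w2: "?w\<^sup>2 \<le> 8 / l\<^sup>2 * exp (l * ?w / 2)"
      using l by (simp add: field_simps power_mult_distrib)
    have "(?w - 1)\<^sup>2 \<le> 1 + ?w\<^sup>2" using W0[of x] by (simp add: power2_diff)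
    also have "\<dots> \<le> exp (l * ?w / 2) + 8 / l\<^sup>2 * exp (l * ?w / 2)"
      using w2 l W0[of x] by (intro add_mono) auto
    also have "\<dots> = (1 + 8 / l\<^sup>2) * exp (l * ?w / 2)" by (simp add: algebra_simps)
    finally have sq: "(?w - 1)\<^sup>2 \<le> (1 + 8 / l\<^sup>2) * exp (l * ?w / 2)" .
    have "?z\<^sup>2 * exp \<bar>?z\<bar> \<le> \<theta>\<^sup>2 * ((1 + 8 / l\<^sup>2) * exp (l * ?w / 2)) * exp (l / 2 + l * ?w / 2)"
      unfolding power_mult_distrib using sq z l by (intro mult_mono) auto
    also have "\<dots> = \<theta>\<^sup>2 * B * exp (l * ?w)"
    proof -
      have "exp (l * ?w) = exp (l * ?w / 2) * exp (l * ?w / 2)" by (simp add: mult_exp_exp)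
      then show ?thesis by (simp add: B_def exp_add mult_ac)
    qed
    finally show ?thesis using exp_le_quadratic[of ?z] by linarith
  qed
  have int: "integrable P (\<lambda>x. 1 + \<theta> * (W x - 1) + \<theta>\<^sup>2 * B * exp (l * W x))"
    using iW iE by auto
  have "(\<integral>\<^sup>+x. ennreal (exp (\<theta> * (W x - 1))) \<partial>P) \<le> (\<integral>\<^sup>+x. ennreal (1 + \<theta> * (W x - 1) + \<theta>\<^sup>2 * B * exp (l * W x)) \<partial>P)"
    using pt by (intro nn_integral_mono ennreal_leI)
  also have "\<dots> = ennreal (\<integral>x. 1 + \<theta> * (W x - 1) + \<theta>\<^sup>2 * B * exp (l * W x) \<partial>P)"
    by (rule nn_integral_eq_integral[OF int]) (use pt in \<open>auto intro!: AE_I2 order.trans[OF exp_ge_zero]\<close>)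
  also have "(\<integral>x. 1 + \<theta> * (W x - 1) + \<theta>\<^sup>2 * B * exp (l * W x) \<partial>P) = 1 + \<theta>\<^sup>2 * B * (\<integral>x. exp (l * W x) \<partial>P)"
    using iW iE by (simp add: eW prob_space)
  also have "\<dots> \<le> 1 + \<theta>\<^sup>2 * B * 4"
    using eE B0 by (intro add_left_mono mult_left_mono) auto
  also have "\<dots> \<le> exp (bern_const l * \<theta>\<^sup>2)"
    using exp_ge_add_one_self[of "bern_const l * \<theta>\<^sup>2"] by (simp add: bern_const_def B_def mult_ac)
  finally show ?thesis by (simp add: ennreal_leI)
qed

text \<open>Half of \<theta> t, where \<theta> minimizes the Chernoff exponent
  \<open>bern_const l * \<theta>^2 - \<theta> * t\<close>, capped at the largest admissible value l
  / 2.\<close>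

definition bern_rate :: "real \<Rightarrow> real \<Rightarrow> real" where
  "bern_rate l t = min (l / 2) (t / (2 * bern_const l)) * t / 2"

lemma bern_const_pos: "0 < l \<Longrightarrow> 0 < bern_const l"
  by (simp add: bern_const_def add_pos_nonneg)

lemma bern_rate_pos: "0 < l \<Longrightarrow> 0 < t \<Longrightarrow> 0 < bern_rate l t"
  using bern_const_pos[of l] by (simp add: bern_rate_def)

text \<open>Markov's inequality for the exponential of the sum, whose mean factors over the
  coordinates of the product measure. The sign \<open>s\<close> covers both tails.\<close>

lemma chernoff_one_sided:
  fixes W :: "'a \<Rightarrow> real" and m :: nat
  assumes P: "prob_space P" and W[measurable]: "W \<in> borel_measurable P"
    and W0: "\<And>x. 0 \<le> W x" and W1: "(\<integral>\<^sup>+x. ennreal (W x) \<partial>P) = 1"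
    and l: "0 < l" and We: "(\<integral>\<^sup>+x. ennreal (exp (l * W x)) \<partial>P) \<le> 4"
    and t: "0 < t" and s: "\<bar>s\<bar> = 1"
  defines "Q \<equiv> PiM {..<m} (\<lambda>_. P)"
  shows "emeasure Q {x \<in> space Q. real m * t \<le> s * (\<Sum>j<m. W (x j) - 1)} \<le> ennreal (exp (- bern_rate l t * real m))"
proof -
  interpret prob_space P by fact
  interpret product_sigma_finite "\<lambda>_::nat. P" by standard
  let ?B = "bern_const l"
  define \<theta> where "\<theta> = min (l / 2) (t / (2 * ?B))"
  have B: "0 < ?B" using l by (rule bern_const_pos)
  have th: "0 < \<theta>" "\<theta> \<le> l / 2" using l t B by (auto simp: \<theta>_def)
  have "\<theta> * (2 * ?B) \<le> t" using B by (simp add: \<theta>_def pos_le_divide_eq[symmetric])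
  then have "\<theta> * (\<theta> * (2 * ?B)) \<le> \<theta> * t" using th by (intro mult_left_mono) auto
  \<comment> \<open>At the chosen \<theta> the quadratic term uses up at most half of the linear
    gain; the other half is \<open>bern_rate\<close>.\<close>
  then have Bth: "?B * \<theta>\<^sup>2 \<le> \<theta> * t / 2" by (simp add: power2_eq_square mult_ac)
  have s2: "(s * \<theta>)\<^sup>2 = \<theta>\<^sup>2" using s by (metis abs_mult mult_1 power2_abs)
  have [measurable]: "(\<lambda>x. x j) \<in> measurable Q P" if "j < m" for j
    unfolding Q_def using that by (intro measurable_component_singleton) auto
  let ?S = "\<lambda>x. s * (\<Sum>j<m. W (x j) - 1)"
  have "(\<integral>\<^sup>+x. ennreal (exp (\<theta> * ?S x)) \<partial>Q) = (\<integral>\<^sup>+x. (\<Prod>j<m. ennreal (exp (s * \<theta> * (W (x j) - 1)))) \<partial>Q)"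
    by (intro nn_integral_cong)
      (simp only: prod_ennreal[OF exp_ge_zero] exp_sum[OF finite_lessThan, symmetric] sum_distrib_left mult_ac)
  also have "\<dots> = (\<Prod>j<m. \<integral>\<^sup>+x. ennreal (exp (s * \<theta> * (W x - 1))) \<partial>P)"
    unfolding Q_def by (rule product_nn_integral_prod) auto
  also have "\<dots> \<le> (\<Prod>j<m. ennreal (exp (?B * \<theta>\<^sup>2)))"
  proof -
    have "\<bar>s * \<theta>\<bar> \<le> l / 2" using th s by (simp add: abs_mult)
    from centered_mgf_bound[OF P W W0 W1 l We this]
    show ?thesis unfolding s2 by (induction m) (auto intro: mult_mono)
  qed
  also have "\<dots> = ennreal (exp (real m * (?B * \<theta>\<^sup>2)))"
    by (simp add: ennreal_power exp_of_nat_mult)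
  finally have mgf: "(\<integral>\<^sup>+x. ennreal (exp (\<theta> * ?S x)) \<partial>Q) \<le> ennreal (exp (real m * (?B * \<theta>\<^sup>2)))" .
  have "emeasure Q {x \<in> space Q. real m * t \<le> ?S x} \<le>
    emeasure Q ({x \<in> space Q. 1 \<le> ennreal (exp (- (\<theta> * (real m * t)))) * ennreal (exp (\<theta> * ?S x))})"
  proof (rule emeasure_mono)
    have "1 \<le> exp (- (\<theta> * (real m * t))) * exp (\<theta> * ?S x)" if "real m * t \<le> ?S x" for x
      using mult_left_mono[OF that, of \<theta>] th by (simp add: mult_exp_exp)
    then show "{x \<in> space Q. real m * t \<le> ?S x} \<subseteq>
      {x \<in> space Q. 1 \<le> ennreal (exp (- (\<theta> * (real m * t)))) * ennreal (exp (\<theta> * ?S x))}"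
      by (auto simp flip: ennreal_mult ennreal_1 intro!: ennreal_leI)
  qed measurable
  also have "\<dots> \<le> ennreal (exp (- (\<theta> * (real m * t)))) * (\<integral>\<^sup>+x. ennreal (exp (\<theta> * ?S x)) * indicator (space Q) x \<partial>Q)"
    by (rule nn_integral_Markov_inequality) measurable
  also have "(\<integral>\<^sup>+x. ennreal (exp (\<theta> * ?S x)) * indicator (space Q) x \<partial>Q) = (\<integral>\<^sup>+x. ennreal (exp (\<theta> * ?S x)) \<partial>Q)"
    by (intro nn_integral_cong) auto
  also have "ennreal (exp (- (\<theta> * (real m * t)))) * (\<integral>\<^sup>+x. ennreal (exp (\<theta> * ?S x)) \<partial>Q) \<le>
     ennreal (exp (- (\<theta> * (real m * t)))) * ennreal (exp (real m * (?B * \<theta>\<^sup>2)))"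
    by (intro mult_left_mono mgf) simp
  also have "\<dots> = ennreal (exp (- (\<theta> * (real m * t)) + real m * (?B * \<theta>\<^sup>2)))"
    unfolding exp_add by (rule ennreal_mult[symmetric]) auto
  also have "\<dots> \<le> ennreal (exp (- bern_rate l t * real m))"
  proof -
    have "real m * (?B * \<theta>\<^sup>2) \<le> real m * (\<theta> * t / 2)" using Bth by (rule mult_left_mono) simp
    moreover have "- bern_rate l t * real m = - (real m * (\<theta> * t / 2))"
      by (simp add: bern_rate_def \<theta>_def)
    moreover have "\<theta> * (real m * t) = 2 * (real m * (\<theta> * t / 2))" by simp
    ultimately have "- (\<theta> * (real m * t)) + real m * (?B * \<theta>\<^sup>2) \<le> - bern_rate l t * real m"
      by linarith
    then show ?thesis by (intro ennreal_leI) (simp only: exp_le_cancel_iff)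
  qed
  finally show ?thesis .
qed

lemma l1norm_Aop: "l1norm m (Aop d m as M) = (\<Sum>j<m. \<bar>qform d M (as j)\<bar>) / real m"
  by (simp add: l1norm_def Aop_def abs_divide flip: sum_divide_distrib)

lemma component_measurable_sample [measurable]:
  "j < m \<Longrightarrow> (\<lambda>as. as j) \<in> measurable (sample_measure e d m) (Lambda e d)"
  unfolding sample_measure_def by (rule measurable_component_singleton) simp

lemma qform_sample_measurable [measurable]:
  "j < m \<Longrightarrow> (\<lambda>as. qform d M (as j)) \<in> borel_measurable (sample_measure e d m)"
proof -
  have [measurable]: "qform d M \<in> borel_measurable (Lambda e d)" by measurable
  show "j < m \<Longrightarrow> ?thesis" by (rule measurable_compose[OF component_measurable_sample]) auto
qed

lemma l1norm_Aop_measurable [measurable]: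
  "(\<lambda>as. l1norm m (Aop d m as M)) \<in> borel_measurable (sample_measure e d m)"
  unfolding l1norm_Aop by (intro borel_measurable_divide borel_measurable_sum borel_measurable_abs) auto

text \<open>Divided by \<open>Lnorm\<close>, the absolute measurements are independent with mean 1;
  the two tails give the factor 2.\<close>

lemma Aop_concentration:
  fixes e :: ensemble
  assumes "0 < d" "0 < m" "symmetric d M" "0 < t"
  defines "Q \<equiv> sample_measure e d m"
  shows "emeasure Q {as \<in> space Q. \<not> \<bar>l1norm m (Aop d m as M) - Lnorm e d M\<bar> \<le> t * Lnorm e d M}
    \<le> ennreal (2 * exp (- bern_rate (1 / 2^19) t * real m))"
proof (cases "0 < Lnorm e d M")
  case True
  let ?L = "Lnorm e d M"
  let ?W = "\<lambda>x. \<bar>qform d M x\<bar> / ?L"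
  have W1: "(\<integral>\<^sup>+x. ennreal (?W x) \<partial>Lambda e d) = 1"
  proof -
    have "(\<integral>\<^sup>+x. ennreal (?W x) \<partial>Lambda e d) = (\<integral>\<^sup>+x. ennreal (1 / ?L) * ennreal \<bar>qform d M x\<bar> \<partial>Lambda e d)"
      using True by (simp flip: ennreal_mult)
    also have "\<dots> = ennreal (1 / ?L) * ennreal ?L"
      by (simp add: nn_integral_cmult nn_integral_Lnorm[OF assms(1,3)])
    also have "\<dots> = 1" using True by (simp flip: ennreal_mult)
    finally show ?thesis .
  qed
  let ?E = "\<lambda>s. {as \<in> space Q. real m * t \<le> s * (\<Sum>j<m. ?W (as j) - 1)}"
  have E: "emeasure Q (?E s) \<le> ennreal (exp (- bern_rate (1 / 2^19) t * real m))" if "\<bar>s\<bar> = 1" for s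
    unfolding Q_def sample_measure_def
    using True that assms(4) W1 Lambda_exp_abs_qform[OF assms(1,3) True]
    by (intro chernoff_one_sided prob_space_Lambda assms(1)) auto
  have "{as \<in> space Q. \<not> \<bar>l1norm m (Aop d m as M) - ?L\<bar> \<le> t * ?L} \<subseteq> ?E 1 \<union> ?E (-1)"
  proof
    fix as assume as: "as \<in> {as \<in> space Q. \<not> \<bar>l1norm m (Aop d m as M) - ?L\<bar> \<le> t * ?L}"
    define D where "D = l1norm m (Aop d m as M) - ?L"
    have S: "(\<Sum>j<m. ?W (as j) - 1) = real m / ?L * D"
      using assms(2) True by (simp add: D_def l1norm_Aop sum_subtractf field_simps flip: sum_divide_distrib)
    have "real m / ?L * (t * ?L) \<le> real m / ?L * \<bar>D\<bar>"
      using as assms(2) True by (intro mult_left_mono) (auto simp: D_def)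
    then have "real m * t \<le> real m / ?L * \<bar>D\<bar>" using True by simp
    then have "real m * t \<le> real m / ?L * D \<or> real m * t \<le> - (real m / ?L * D)"
      by (cases "0 \<le> D") auto
    then show "as \<in> ?E 1 \<union> ?E (-1)"
      using as unfolding Un_iff mem_Collect_eq S by simp
  qed
  then have "emeasure Q {as \<in> space Q. \<not> \<bar>l1norm m (Aop d m as M) - ?L\<bar> \<le> t * ?L} \<le> emeasure Q (?E 1 \<union> ?E (-1))"
    unfolding Q_def by (intro emeasure_mono) measurable
  also have "\<dots> \<le> emeasure Q (?E 1) + emeasure Q (?E (-1))"
    unfolding Q_def by (intro emeasure_subadditive) measurable
  also have "\<dots> \<le> ennreal (exp (- bern_rate (1 / 2^19) t * real m)) + ennreal (exp (- bern_rate (1 / 2^19) t * real m))"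
    by (intro add_mono E) auto
  finally show ?thesis by (simp flip: ennreal_plus)
next
  case False
  \<comment> \<open>A vanishing norm forces the relevant entries to vanish, so both norms are 0 and
    the event is empty.\<close>
  then have L: "Lnorm e d M = 0" using Lnorm_nonneg[of e d M] by linarith
  have "M i j = 0" if "i < d" "j < d" for i j
    using entry_le_Lnorm[OF assms(1,3) that, of e] by (simp add: L)
  then have "qform d M x = 0" for x by (simp add: qform_def)
  then show ?thesis by (simp add: L l1norm_Aop)
qed

section \<open>The restricted isometry property\<close>

lemma qform_cong: "(\<And>i j. i < d \<Longrightarrow> j < d \<Longrightarrow> A i j = B i j) \<Longrightarrow> qform d A = qform d B"
  by (auto simp: qform_def fun_eq_iff intro!: sum.cong)

lemma l1norm_Aop_diff:
  "\<bar>l1norm m (Aop d m as A) - l1norm m (Aop d m as B)\<bar> \<le> l1norm m (Aop d m as (msub A B))"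
proof -
  have "\<bar>\<Sum>j<m. \<bar>qform d A (as j)\<bar> - \<bar>qform d B (as j)\<bar>\<bar> \<le> (\<Sum>j<m. \<bar>qform d (msub A B) (as j)\<bar>)"
    unfolding qform_msub by (intro order.trans[OF sum_abs] sum_mono) linarith
  then show ?thesis
    unfolding l1norm_Aop
    by (simp add: sum_subtractf divide_right_mono flip: diff_divide_distrib)
qed

lemma l1norm_Aop_scale: "l1norm m (Aop d m as (\<lambda>i j. c * M i j)) = \<bar>c\<bar> * l1norm m (Aop d m as M)"
  by (simp add: l1norm_Aop qform_scale abs_mult flip: sum_distrib_left)

text \<open>The one random quantity needed off the net: together with the largest entry it bounds
  the measurements of all matrices simultaneously.\<close>

definition mean_square :: "nat \<Rightarrow> nat \<Rightarrow> (nat \<Rightarrow> nat \<Rightarrow> real) \<Rightarrow> real" where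
  "mean_square d m as = (\<Sum>j<m. \<Sum>i<d. (as j i)\<^sup>2) / real m"

lemma l1norm_Aop_le:
  assumes "\<And>i j. i < d \<Longrightarrow> j < d \<Longrightarrow> \<bar>M i j\<bar> \<le> c"
  shows "l1norm m (Aop d m as M) \<le> c * real d * mean_square d m as"
proof -
  have "(\<Sum>j<m. \<bar>qform d M (as j)\<bar>) \<le> (\<Sum>j<m. c * real d * (\<Sum>i<d. (as j i)\<^sup>2))"
    using abs_qform_le[OF assms] by (intro sum_mono) auto
  then have "(\<Sum>j<m. \<bar>qform d M (as j)\<bar>) / real m \<le> (c * real d * (\<Sum>j<m. \<Sum>i<d. (as j i)\<^sup>2)) / real m"
    by (intro divide_right_mono) (simp_all add: sum_distrib_left)
  then show ?thesis by (simp add: l1norm_Aop mean_square_def)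
qed

lemma component_square_sample_measurable [measurable]:
  "j < m \<Longrightarrow> (\<lambda>as. \<Sum>i<d. (as j i)\<^sup>2) \<in> borel_measurable (sample_measure e d m)"
proof -
  assume "j < m"
  have "(\<lambda>x. \<Sum>i<d. (x i)\<^sup>2) \<in> borel_measurable (Lambda e d)" by measurable
  then show ?thesis by (rule measurable_compose[OF component_measurable_sample[OF \<open>j < m\<close>]])
qed

lemma mean_square_measurable [measurable]:
  "mean_square d m \<in> borel_measurable (sample_measure e d m)"
  unfolding mean_square_def[abs_def]
  by (rule borel_measurable_divide, rule borel_measurable_sum, rule component_square_sample_measurable) auto

lemma prob_space_sample: "0 < d \<Longrightarrow> prob_space (sample_measure e d m)"
  unfolding sample_measure_def by (intro prob_space_PiM prob_space_Lambda)

lemma mean_square_expectation: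
  assumes "0 < d" "0 < m"
  shows "(\<integral>\<^sup>+as. ennreal (mean_square d m as) \<partial>sample_measure e d m) \<le> 1"
proof -
  interpret prob_space "Lambda e d" by (rule prob_space_Lambda[OF assms(1)])
  have 1: "(\<integral>\<^sup>+as. ennreal (\<Sum>i<d. (as j i)\<^sup>2) \<partial>sample_measure e d m) \<le> 1" if "j < m" for j
  proof -
    have "Lambda e d = distr (sample_measure e d m) (Lambda e d) (\<lambda>as. as j)"
      unfolding sample_measure_def using that prob_space_Lambda[OF assms(1)]
      by (intro distr_PiM_component[symmetric]) auto
    then have "(\<integral>\<^sup>+as. ennreal (\<Sum>i<d. (as j i)\<^sup>2) \<partial>sample_measure e d m) =
      (\<integral>\<^sup>+x. ennreal (\<Sum>i<d. (x i)\<^sup>2) \<partial>Lambda e d)"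
      using nn_integral_distr[OF component_measurable_sample[OF that, of e d], of "\<lambda>x. ennreal (\<Sum>i<d. (x i)\<^sup>2)"]
      by simp
    then show ?thesis using Lambda_norm_second_moment[OF assms(1), of e] by simp
  qed
  have "(\<integral>\<^sup>+as. ennreal (mean_square d m as) \<partial>sample_measure e d m) =
    (\<integral>\<^sup>+as. ennreal (1 / real m) * (\<Sum>j<m. ennreal (\<Sum>i<d. (as j i)\<^sup>2)) \<partial>sample_measure e d m)"
    by (intro nn_integral_cong) (simp add: mean_square_def sum_nonneg flip: ennreal_mult)
  also have "\<dots> = ennreal (1 / real m) * (\<Sum>j<m. \<integral>\<^sup>+as. ennreal (\<Sum>i<d. (as j i)\<^sup>2) \<partial>sample_measure e d m)"
    by (subst nn_integral_cmult, simp, subst nn_integral_sum) auto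
  also have "\<dots> \<le> ennreal (1 / real m) * (\<Sum>j<m. 1)"
    using 1 by (intro mult_left_mono sum_mono) auto
  also have "\<dots> = 1"
    using assms(2) by (simp add: ennreal_of_nat_eq_real_of_nat flip: ennreal_mult)
  finally show ?thesis .
qed

text \<open>Markov's inequality, with a threshold depending on \<rho> only. This event takes half of
  the failure budget and the net takes the other half.\<close>

lemma mean_square_large:
  assumes "0 < d" "0 < m" "0 < \<rho>"
  shows "emeasure (sample_measure e d m) {as \<in> space (sample_measure e d m). \<not> mean_square d m as \<le> 2 / \<rho>} \<le> ennreal (\<rho> / 2)"
proof -
  let ?Q = "sample_measure e d m"
  have "emeasure ?Q {as \<in> space ?Q. \<not> mean_square d m as \<le> 2 / \<rho>} \<le>
    emeasure ?Q {as \<in> space ?Q. 1 \<le> ennreal (\<rho> / 2) * ennreal (mean_square d m as)}"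
  proof (rule emeasure_mono)
    have "1 \<le> \<rho> / 2 * mean_square d m as" if "\<not> mean_square d m as \<le> 2 / \<rho>" for as
      using that assms(3) by (simp add: field_simps)
    moreover have "0 \<le> mean_square d m as" for as by (simp add: mean_square_def sum_nonneg)
    ultimately show "{as \<in> space ?Q. \<not> mean_square d m as \<le> 2 / \<rho>} \<subseteq>
      {as \<in> space ?Q. 1 \<le> ennreal (\<rho> / 2) * ennreal (mean_square d m as)}"
      using assms(3) by (auto simp flip: ennreal_mult ennreal_1 intro!: ennreal_leI)
  qed measurable
  also have "\<dots> \<le> ennreal (\<rho> / 2) * (\<integral>\<^sup>+as. ennreal (mean_square d m as) * indicator (space ?Q) as \<partial>?Q)"
    by (rule nn_integral_Markov_inequality) measurable
  also have "(\<integral>\<^sup>+as. ennreal (mean_square d m as) * indicator (space ?Q) as \<partial>?Q) = (\<integral>\<^sup>+as. ennreal (mean_square d m as) \<partial>?Q)"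
    by (intro nn_integral_cong) auto
  also have "ennreal (\<rho> / 2) * \<dots> \<le> ennreal (\<rho> / 2) * 1"
    by (intro mult_left_mono mean_square_expectation assms) simp
  finally show ?thesis by simp
qed

text \<open>The lower isometry bound is applied to the decoder error, the triangle inequality goes
  through \<open>y\<close>, and the true matrix competes in the minimization. The argument is
  deterministic and \<open>y\<close> is arbitrary.\<close>

lemma RIP_imp_decoder_bound:
  assumes RIP: "RIP e d m as \<delta> X" and "\<delta> < 1" and S: "S \<in> X" "S' \<in> X"
    and opt: "\<forall>T\<in>X. l1norm m (\<lambda>j. Aop d m as S' j - y j) \<le> l1norm m (\<lambda>j. Aop d m as T j - y j)"
  shows "Lnorm e d (msub S' S) \<le> 2 / (1 - \<delta>) * l1norm m (\<lambda>j. y j - Aop d m as S j)"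
proof -
  have "(1 - \<delta>) * Lnorm e d (msub S' S) \<le> l1norm m (Aop d m as (msub S' S))"
    using RIP S by (auto simp: RIP_def)
  also have "\<dots> \<le> l1norm m (\<lambda>j. Aop d m as S' j - y j) + l1norm m (\<lambda>j. y j - Aop d m as S j)"
    unfolding l1norm_def sum.distrib[symmetric]
    by (intro sum_mono) (simp add: Aop_def qform_msub diff_divide_distrib)
  also have "l1norm m (\<lambda>j. Aop d m as S' j - y j) \<le> l1norm m (\<lambda>j. Aop d m as S j - y j)"
    using opt S by blast
  also have "l1norm m (\<lambda>j. Aop d m as S j - y j) = l1norm m (\<lambda>j. y j - Aop d m as S j)"
    by (simp add: l1norm_def abs_minus_commute)
  finally show ?thesis using assms(2) by (simp add: field_simps)
qed

text \<open>On the net the relative error is \<open>\<delta>/2\<close>; passing from a secant to its net point costs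
  \<open>\<delta>/8\<close> in either norm.\<close>

lemma RIP_of_net:
  assumes d: "0 < d" and \<delta>: "0 < \<delta>" "\<delta> < 1" and R: "1 \<le> R"
    and ms: "mean_square d m as \<le> R"
    and sym: "\<And>S. S \<in> X \<Longrightarrow> symmetric d S" "\<And>N. N \<in> Net \<Longrightarrow> symmetric d N"
    and net: "\<And>S1 S2. S1 \<in> X \<Longrightarrow> S2 \<in> X \<Longrightarrow>
      (\<forall>i<d. \<forall>j<d. msub S1 S2 i j = 0) \<or>
      (\<exists>h N N'. 0 < h \<and> symmetric d N \<and> N' \<in> Net \<and> (\<forall>i<d. \<forall>j<d. msub S1 S2 i j = h * N i j) \<and>
        (\<forall>c. (\<forall>i<d. \<forall>j<d. \<bar>N' i j\<bar> \<le> c) \<longrightarrow> (\<forall>i<d. \<forall>j<d. \<bar>msub N N' i j\<bar> \<le> \<epsilon> * c)))"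
    and \<epsilon>: "0 \<le> \<epsilon>" "\<epsilon> * (2^15 * (real d)\<^sup>2 * R) \<le> \<delta> / 8"
    and conc: "\<And>N. N \<in> Net \<Longrightarrow> \<bar>l1norm m (Aop d m as N) - Lnorm e d N\<bar> \<le> \<delta> / 2 * Lnorm e d N"
  shows "RIP e d m as \<delta> X"
proof -
  have main: "\<bar>l1norm m (Aop d m as (msub S1 S2)) - Lnorm e d (msub S1 S2)\<bar> \<le> \<delta> * Lnorm e d (msub S1 S2)"
    if S: "S1 \<in> X" "S2 \<in> X" for S1 S2
    using net[OF S]
  proof (elim disjE exE conjE)
    assume "\<forall>i<d. \<forall>j<d. msub S1 S2 i j = 0"
    then have "qform d (msub S1 S2) = (\<lambda>_. 0)" by (auto simp: qform_def)
    then show ?thesis by (simp add: l1norm_Aop Lnorm_def)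
  next
    fix h N N' assume h: "0 < h" and symN: "symmetric d N" and N': "N' \<in> Net"
      and eq: "\<forall>i<d. \<forall>j<d. msub S1 S2 i j = h * N i j"
      and close: "\<forall>c. (\<forall>i<d. \<forall>j<d. \<bar>N' i j\<bar> \<le> c) \<longrightarrow> (\<forall>i<d. \<forall>j<d. \<bar>msub N N' i j\<bar> \<le> \<epsilon> * c)"
    let ?L = "Lnorm e d N" and ?L' = "Lnorm e d N'"
    let ?A = "l1norm m (Aop d m as N)" and ?A' = "l1norm m (Aop d m as N')"
    have L'0: "0 \<le> ?L'" by (rule Lnorm_nonneg)
    \<comment> \<open>Entries of the net point are at most 2^15 d \<open>?L'\<close>, so relative
      closeness bounds the entries of \<open>msub N N'\<close> by \<open>g\<close>. Another factor
      \<open>d\<close> leads from entries to either norm, hence the d^2 in the condition on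
      \<epsilon>.\<close>
    define g where "g = \<epsilon> * (2^15 * real d * ?L')"
    have g0: "0 \<le> g" using \<epsilon>(1) L'0 by (simp add: g_def)
    have g: "\<bar>msub N N' i j\<bar> \<le> g" if "i < d" "j < d" for i j
      using close entry_le_Lnorm[OF d sym(2)[OF N'], of _ _ e] that unfolding g_def by blast
    have gR: "g * real d * R \<le> \<delta> / 8 * ?L'"
      using mult_right_mono[OF \<epsilon>(2) L'0] by (simp add: g_def power2_eq_square mult_ac)
    have gd: "g * real d \<le> \<delta> / 8 * ?L'"
      using mult_left_mono[OF R, of "g * real d"] g0 gR by simp
    have symD: "symmetric d (msub N N')"
      using symN sym(2)[OF N'] by (simp add: symmetric_def msub_def)
    have 1: "\<bar>?L - ?L'\<bar> \<le> \<delta> / 8 * ?L'"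
    proof -
      have "Lnorm e d (msub N N') \<le> g * real d" by (rule Lnorm_le[OF d symD]) (rule g)
      then show ?thesis using Lnorm_diff[OF d symN sym(2)[OF N'], of e] gd by linarith
    qed
    have lM: "l1norm m (Aop d m as (msub N N')) \<le> g * real d * mean_square d m as"
      by (rule l1norm_Aop_le) (rule g)
    have "g * real d * mean_square d m as \<le> g * real d * R"
      using ms g0 by (intro mult_left_mono) auto
    then have 2: "\<bar>?A - ?A'\<bar> \<le> \<delta> / 8 * ?L'"
      using l1norm_Aop_diff[of m d as N N'] lM gR by linarith
    have 3: "\<bar>?A' - ?L'\<bar> \<le> \<delta> / 2 * ?L'" by (rule conc[OF N'])
    have "\<delta> / 8 * ?L' \<le> 1 / 8 * ?L'" using \<delta> L'0 by (intro mult_right_mono) auto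
    \<comment> \<open>Needed to return from \<open>?L'\<close> to \<open>?L\<close>: the three
      errors add up to 3/4 \<delta> \<open>?L'\<close>, and 3/4 * 8/7 < 1.\<close>
    then have L': "?L' \<le> 8 / 7 * ?L" using 1 by linarith
    have "\<bar>?A - ?L\<bar> \<le> \<delta> / 8 * ?L' + \<delta> / 8 * ?L' + \<delta> / 2 * ?L'" using 1 2 3 by linarith
    also have "\<dots> = \<delta> * (3 / 4 * ?L')" by (simp add: field_simps)
    also have "\<dots> \<le> \<delta> * ?L"
      using L' \<delta> Lnorm_nonneg[of e d N] by (intro mult_left_mono) linarith+
    finally have N: "\<bar>?A - ?L\<bar> \<le> \<delta> * ?L" .
    have q: "qform d (msub S1 S2) = qform d (\<lambda>i j. h * N i j)" using eq by (intro qform_cong) auto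
    have "l1norm m (Aop d m as (msub S1 S2)) = h * ?A" "Lnorm e d (msub S1 S2) = h * ?L"
      using l1norm_Aop_scale[of m d as h N] Lnorm_scale[of e d h N] h
      by (simp_all add: l1norm_Aop Lnorm_def q)
    then show ?thesis
      using mult_left_mono[OF N, of h] h by (simp add: abs_mult mult_ac flip: right_diff_distrib)
  qed
  show ?thesis
    unfolding RIP_def
  proof (intro ballI)
    fix S1 S2 assume "S1 \<in> X" "S2 \<in> X"
    from main[OF this]
    show "(1 - \<delta>) * Lnorm e d (msub S1 S2) \<le> l1norm m (Aop d m as (msub S1 S2)) \<and>
      l1norm m (Aop d m as (msub S1 S2)) \<le> (1 + \<delta>) * Lnorm e d (msub S1 S2)"
      by (simp add: algebra_simps abs_le_iff)
  qed
qed

lemma model_set_symmetric: "S \<in> model_set d k a b \<Longrightarrow> symmetric d S"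
  by (simp add: model_set_def spd_def)

text \<open>Union bound over the net and the event of large \<open>mean_square\<close>. The isometry
  property quantifies over uncountably many pairs, so a measurable event implying it is produced
  from finitely many conditions.\<close>

lemma net_event:
  fixes e :: ensemble
  assumes d: "0 < d" and m: "0 < m" and t: "0 < t" and \<rho>: "0 < \<rho>"
    and Net: "finite Net" "\<And>N. N \<in> Net \<Longrightarrow> symmetric d N"
    and small: "real (card Net) * (2 * exp (- bern_rate (1 / 2^19) t * real m)) \<le> \<rho> / 2"
  defines "Q \<equiv> sample_measure e d m"
  obtains E where "E \<in> sets Q" "measure Q E \<ge> 1 - \<rho>"
    "\<And>as. as \<in> E \<Longrightarrow> mean_square d m as \<le> 2 / \<rho>"
    "\<And>as N. as \<in> E \<Longrightarrow> N \<in> Net \<Longrightarrow> \<bar>l1norm m (Aop d m as N) - Lnorm e d N\<bar> \<le> t * Lnorm e d N"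
proof -
  interpret prob_space Q unfolding Q_def by (rule prob_space_sample[OF d])
  let ?B = "\<lambda>N. {as \<in> space Q. \<not> \<bar>l1norm m (Aop d m as N) - Lnorm e d N\<bar> \<le> t * Lnorm e d N}"
  let ?Z = "{as \<in> space Q. \<not> mean_square d m as \<le> 2 / \<rho>}"
  let ?x = "exp (- bern_rate (1 / 2^19) t * real m)"
  define F where "F = ?Z \<union> (\<Union>N\<in>Net. ?B N)"
  have B[measurable]: "?B N \<in> sets Q" "?Z \<in> sets Q" for N
    unfolding Q_def by measurable
  have F: "F \<in> sets Q" unfolding F_def by (intro sets.Un sets.finite_UN B Net(1))
  have "emeasure Q F \<le> emeasure Q ?Z + emeasure Q (\<Union>N\<in>Net. ?B N)"
    unfolding F_def using B Net(1) by (intro emeasure_subadditive) auto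
  also have "\<dots> \<le> ennreal (\<rho> / 2) + (\<Sum>N\<in>Net. emeasure Q (?B N))"
    using mean_square_large[OF d m \<rho>] B Net(1) unfolding Q_def
    by (intro add_mono emeasure_subadditive_finite) auto
  also have "\<dots> \<le> ennreal (\<rho> / 2) + (\<Sum>N\<in>Net. ennreal (2 * ?x))"
    unfolding Q_def using Net(2) by (intro add_left_mono sum_mono Aop_concentration d m t) auto
  also have "(\<Sum>N\<in>Net. ennreal (2 * ?x)) = ennreal (real (card Net) * (2 * ?x))"
    by (simp add: ennreal_mult ennreal_of_nat_eq_real_of_nat)
  also have "ennreal (\<rho> / 2) + \<dots> \<le> ennreal (\<rho> / 2) + ennreal (\<rho> / 2)"
    using small by (intro add_left_mono ennreal_leI)
  also have "\<dots> = ennreal \<rho>" using \<rho> by (simp flip: ennreal_plus)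
  finally have "measure Q F \<le> \<rho>"
    using \<rho> by (simp add: emeasure_eq_measure)
  then have "measure Q (space Q - F) \<ge> 1 - \<rho>" using prob_compl[OF F] by simp
  moreover have "space Q - F \<in> sets Q" using F by auto
  ultimately show ?thesis by (intro that[of "space Q - F"]) (auto simp: F_def)
qed

text \<open>The entropy of the net: the rounding precision is polynomial in \<open>d\<close>, which costs only
  the factor \<open>ln d\<close> since \<open>d \<ge> 2\<close>.\<close>

lemma net_size_bound:
  fixes c G \<rho> :: real and d n m K :: nat
  assumes d: "2 \<le> d" and n: "1 \<le> n" and c: "0 < c" and G: "1 \<le> G" and \<rho>: "0 < \<rho>" "\<rho> < 1"
    and K: "real K \<le> G * (real d)^8" "1 \<le> K"
    and m: "real m \<ge> ((ln (4 / \<rho>) + 4 * ln (3 * G)) / ln 2 + 40) / c * real n * ln (real d)"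
  shows "real ((d\<^sup>2 * (2 * K + 1)) ^ (4 * n)) * (2 * exp (- c * real m)) \<le> \<rho> / 2"
proof -
  define l where "l = ln (real d)"
  have l: "ln 2 \<le> l" using d by (simp add: l_def)
  have l2: "0 < ln (2::real)" by simp
  have l0: "0 < l" using l l2 by linarith
  have ratio: "1 \<le> l / ln 2" using l l2 by (simp add: le_divide_eq)
  have nl: "1 \<le> real n * (l / ln 2)"
    using mult_mono[of 1 "real n" 1 "l / ln 2"] n ratio by simp
  have r0: "0 \<le> ln (4 / \<rho>)" using \<rho> by simp
  have g0: "0 \<le> ln (3 * G)" using G by simp
  have "real (d\<^sup>2 * (2 * K + 1)) \<le> 3 * G * (real d)^10"
  proof -
    have "real (2 * K + 1) \<le> 3 * (G * (real d)^8)" using K by simp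
    then have "(real d)\<^sup>2 * real (2 * K + 1) \<le> (real d)\<^sup>2 * (3 * (G * (real d)^8))"
      by (rule mult_left_mono) simp
    also have "\<dots> = 3 * G * (real d)^10" by (simp add: mult_ac flip: power_add)
    finally show ?thesis by (simp only: of_nat_mult of_nat_power)
  qed
  also have "\<dots> = exp (ln (3 * G) + 10 * l)"
    using G d exp_of_nat_mult[of 10 l] by (simp add: l_def exp_add)
  finally have base: "real (d\<^sup>2 * (2 * K + 1)) \<le> exp (ln (3 * G) + 10 * l)" .
  have "real ((d\<^sup>2 * (2 * K + 1)) ^ (4 * n)) \<le> exp (ln (3 * G) + 10 * l) ^ (4 * n)"
    unfolding of_nat_power by (intro power_mono base) simp
  also have "\<dots> = exp (4 * real n * (ln (3 * G) + 10 * l))"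
    by (simp flip: exp_of_nat_mult)
  finally have N: "real ((d\<^sup>2 * (2 * K + 1)) ^ (4 * n)) \<le> exp (4 * real n * (ln (3 * G) + 10 * l))" .
  \<comment> \<open>The 10 collects d^2 positions and d^8 values, and 4 * 10 is the 40 in the
    constant. Terms free of \<open>d\<close> are absorbed by the factors \<open>l / ln 2\<close> and
    \<open>n\<close>, both at least 1.\<close>
  have "4 * real n * (ln (3 * G) + 10 * l) + ln (4 / \<rho>) \<le> c * real m"
  proof -
    have "ln (3 * G) \<le> ln (3 * G) * (l / ln 2)" using mult_left_mono[OF ratio g0] by simp
    then have "4 * real n * ln (3 * G) \<le> 4 * real n * (ln (3 * G) * (l / ln 2))"
      by (intro mult_left_mono) auto
    moreover have "ln (4 / \<rho>) \<le> ln (4 / \<rho>) * (real n * (l / ln 2))"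
      using mult_left_mono[OF nl r0] by simp
    moreover have "4 * real n * (ln (3 * G) * (l / ln 2)) + ln (4 / \<rho>) * (real n * (l / ln 2)) + 40 * real n * l =
      ((ln (4 / \<rho>) + 4 * ln (3 * G)) / ln 2 + 40) * real n * l"
      using l2 by (simp add: field_simps)
    moreover have "((ln (4 / \<rho>) + 4 * ln (3 * G)) / ln 2 + 40) * real n * l \<le> c * real m"
      using mult_left_mono[OF m, of c] c by (simp add: l_def)
    ultimately show ?thesis by (simp add: algebra_simps)
  qed
  then have "exp (4 * real n * (ln (3 * G) + 10 * l) - c * real m) \<le> exp (- ln (4 / \<rho>))"
    by simp
  also have "\<dots> = \<rho> / 4" using \<rho> by (simp add: exp_minus)
  finally have "exp (4 * real n * (ln (3 * G) + 10 * l)) * exp (- c * real m) \<le> \<rho> / 4"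
    by (simp add: mult_exp_exp)
  moreover have "real ((d\<^sup>2 * (2 * K + 1)) ^ (4 * n)) * exp (- c * real m) \<le>
    exp (4 * real n * (ln (3 * G) + 10 * l)) * exp (- c * real m)"
    using N by (rule mult_right_mono) simp
  ultimately have "real ((d\<^sup>2 * (2 * K + 1)) ^ (4 * n)) * exp (- c * real m) \<le> \<rho> / 4"
    by (rule order.trans[rotated])
  then show ?thesis by linarith
qed

text \<open>For d = 1 the lower bound on \<open>m\<close> would be 0, hence
  \<open>d \<ge> 2\<close>. A single event serves all model matrices, data and minimizers, since the
  decoder bound follows deterministically from the isometry property.\<close>

theorem theorem3:
  fixes e :: ensemble
  assumes "0 < \<delta>" "\<delta> < 1" "0 < \<rho>" "\<rho> < 1" "\<kappa> \<ge> 1"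
  shows "\<exists>C::real. C > 0 \<and>
    (\<forall>(d::nat) (k::nat) (m::nat) (a::real) (b::real).
       d \<ge> 2 \<longrightarrow> 0 < a \<longrightarrow> a \<le> b \<longrightarrow> b / a = \<kappa> \<longrightarrow>
       real m \<ge> C * real (d + 2 * k) * ln (real d) \<longrightarrow>
       (\<exists>E \<in> sets (sample_measure e d m).
          measure (sample_measure e d m) E \<ge> 1 - \<rho> \<and>
          (\<forall>as \<in> E.
             RIP e d m as \<delta> (model_set d k a b) \<and>
             (\<forall>\<Sigma> \<in> model_set d k a b. \<forall>(n::nat) (xs :: nat \<Rightarrow> nat \<Rightarrow> real) \<Sigma>star.
                \<Sigma>star \<in> model_set d k a b \<longrightarrow>
                (\<forall>\<Sigma>' \<in> model_set d k a b.
                   l1norm m (\<lambda>j. Aop d m as \<Sigma>star j - Aop d m as (sample_cov n xs) j)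
                   \<le> l1norm m (\<lambda>j. Aop d m as \<Sigma>' j - Aop d m as (sample_cov n xs) j)) \<longrightarrow>
                Lnorm e d (msub \<Sigma>star \<Sigma>)
                  \<le> 2 / (1 - \<delta>) * l1norm m (\<lambda>j. Aop d m as (sample_cov n xs) j - Aop d m as \<Sigma> j)))))"
proof -
  define c where "c = bern_rate (1 / 2^19) (\<delta> / 2)"
  have c: "0 < c" unfolding c_def using assms by (intro bern_rate_pos) auto
  \<comment> \<open>With exactly B d^8 rounding levels and R = 2 / \<rho>, the condition on
    \<epsilon> in \<open>RIP_of_net\<close> becomes an equality; 2^19 is 2^15 * 2 * 8.\<close>
  define B where "B = 3 * 2^19 * \<kappa>^3 / (\<rho> * \<delta>)"
  have B: "1 \<le> B"
  proof -
    have "\<rho> * \<delta> \<le> 1 * 1" using assms by (intro mult_mono) auto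
    also have "1 * 1 \<le> 3 * 2^19 * \<kappa>^3" using one_le_power[OF assms(5), of 3] by simp
    finally show ?thesis using assms by (simp add: B_def le_divide_eq)
  qed
  \<comment> \<open>The constant of \<open>net_size_bound\<close> with G = 2 B, because rounding B
    d^8 >= 1 up to an integer at most doubles it. Only \<delta>, \<rho> and \<kappa> enter.\<close>
  define C where "C = ((ln (4 / \<rho>) + 4 * ln (3 * (2 * B))) / ln 2 + 40) / c"
  have C: "0 < C"
    unfolding C_def using assms B c by (intro divide_pos_pos add_nonneg_pos divide_nonneg_pos add_nonneg_nonneg) auto
  have good: "\<exists>E \<in> sets (sample_measure e d m). measure (sample_measure e d m) E \<ge> 1 - \<rho> \<and>
      (\<forall>as \<in> E. RIP e d m as \<delta> (model_set d k a b))"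
    if d2: "d \<ge> 2" and ab: "0 < a" "a \<le> b" and \<kappa>: "b / a = \<kappa>"
      and m: "real m \<ge> C * real (d + 2 * k) * ln (real d)" for d k m a b
  proof -
    have d: "0 < d" using d2 by simp
    have "0 < C * real (d + 2 * k) * ln (real d)" using C d2 by simp
    then have m0: "0 < m" using m by linarith
    define K where "K = nat \<lceil>B * (real d)^8\<rceil>"
    have Bd: "1 \<le> B * (real d)^8"
      using mult_mono[of 1 B 1 "(real d)^8"] B d by simp
    have K1: "B * (real d)^8 \<le> real K" unfolding K_def by (rule real_nat_ceiling_ge)
    have K2: "real K \<le> 2 * B * (real d)^8" unfolding K_def using Bd by linarith
    have K0: "0 < K" using K1 Bd by linarith
    obtain Net where Net: "finite Net" "card Net \<le> (d\<^sup>2 * (2 * K + 1)) ^ (4 * (d + 2 * k))"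
      "\<And>N. N \<in> Net \<Longrightarrow> symmetric d N"
      "\<And>S1 S2. S1 \<in> model_set d k a b \<Longrightarrow> S2 \<in> model_set d k a b \<Longrightarrow>
      (\<forall>i<d. \<forall>j<d. msub S1 S2 i j = 0) \<or>
      (\<exists>h N N'. 0 < h \<and> symmetric d N \<and> N' \<in> Net \<and> (\<forall>i<d. \<forall>j<d. msub S1 S2 i j = h * N i j) \<and>
        (\<forall>c. (\<forall>i<d. \<forall>j<d. \<bar>N' i j\<bar> \<le> c) \<longrightarrow>
          (\<forall>i<d. \<forall>j<d. \<bar>msub N N' i j\<bar> \<le> 3 * (real d)^6 * (b / a)^3 / real K * c)))"
      by (rule secant_net[OF ab d K0]) blast
    have "real (card Net) * (2 * exp (- c * real m)) \<le>
      real ((d\<^sup>2 * (2 * K + 1)) ^ (4 * (d + 2 * k))) * (2 * exp (- c * real m))"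
      using Net(2) by (intro mult_right_mono of_nat_mono) auto
    also have "\<dots> \<le> \<rho> / 2"
      using d2 c B assms K2 K0 m by (intro net_size_bound[where G = "2 * B"]) (auto simp: C_def)
    finally have small: "real (card Net) * (2 * exp (- c * real m)) \<le> \<rho> / 2" .
    obtain E where E: "E \<in> sets (sample_measure e d m)" "measure (sample_measure e d m) E \<ge> 1 - \<rho>"
      "\<And>as. as \<in> E \<Longrightarrow> mean_square d m as \<le> 2 / \<rho>"
      "\<And>as N. as \<in> E \<Longrightarrow> N \<in> Net \<Longrightarrow> \<bar>l1norm m (Aop d m as N) - Lnorm e d N\<bar> \<le> \<delta> / 2 * Lnorm e d N"
      using net_event[OF d m0 _ assms(3) Net(1,3) small[unfolded c_def], of e] assms(1) by auto
    have \<epsilon>: "3 * (real d)^6 * (b / a)^3 / real K * (2^15 * (real d)\<^sup>2 * (2 / \<rho>)) \<le> \<delta> / 8"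
    proof -
      have "3 * (real d)^6 * (b / a)^3 / real K * (2^15 * (real d)\<^sup>2 * (2 / \<rho>)) = \<delta> / 8 * (B * (real d)^8) / real K"
        using assms by (simp add: \<kappa> B_def field_simps flip: power_add)
      also have "\<dots> \<le> \<delta> / 8 * real K / real K"
        using K1 assms by (intro divide_right_mono mult_left_mono) auto
      finally show ?thesis using K0 by simp
    qed
    have "RIP e d m as \<delta> (model_set d k a b)" if as: "as \<in> E" for as
    proof (rule RIP_of_net[OF d assms(1,2) _ E(3)[OF as] model_set_symmetric Net(3,4) _ \<epsilon> E(4)[OF as]])
      show "1 \<le> 2 / \<rho>" using assms by simp
      show "0 \<le> 3 * (real d)^6 * (b / a)^3 / real K" using ab by simp
    qed
    then show ?thesis using E(1,2) by blast
  qed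
  show ?thesis
  proof (intro exI[of _ C] conjI C allI impI)
    fix d k m :: nat and a b :: real
    assume "d \<ge> 2" "0 < a" "a \<le> b" "b / a = \<kappa>" "real m \<ge> C * real (d + 2 * k) * ln (real d)"
    from good[OF this] obtain E where E: "E \<in> sets (sample_measure e d m)"
      "measure (sample_measure e d m) E \<ge> 1 - \<rho>" "\<And>as. as \<in> E \<Longrightarrow> RIP e d m as \<delta> (model_set d k a b)"
      by blast
    show "\<exists>E \<in> sets (sample_measure e d m).
          measure (sample_measure e d m) E \<ge> 1 - \<rho> \<and>
          (\<forall>as \<in> E.
             RIP e d m as \<delta> (model_set d k a b) \<and>
             (\<forall>\<Sigma> \<in> model_set d k a b. \<forall>(n::nat) (xs :: nat \<Rightarrow> nat \<Rightarrow> real) \<Sigma>star.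
                \<Sigma>star \<in> model_set d k a b \<longrightarrow>
                (\<forall>\<Sigma>' \<in> model_set d k a b.
                   l1norm m (\<lambda>j. Aop d m as \<Sigma>star j - Aop d m as (sample_cov n xs) j)
                   \<le> l1norm m (\<lambda>j. Aop d m as \<Sigma>' j - Aop d m as (sample_cov n xs) j)) \<longrightarrow>
                Lnorm e d (msub \<Sigma>star \<Sigma>)
                  \<le> 2 / (1 - \<delta>) * l1norm m (\<lambda>j. Aop d m as (sample_cov n xs) j - Aop d m as \<Sigma> j)))"
    proof (intro bexI[of _ E] conjI ballI E(1,2))
      fix as assume "as \<in> E"
      then show RIP: "RIP e d m as \<delta> (model_set d k a b)" by (rule E(3))
      show "\<forall>(n::nat) (xs :: nat \<Rightarrow> nat \<Rightarrow> real) \<Sigma>star.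
                \<Sigma>star \<in> model_set d k a b \<longrightarrow>
                (\<forall>\<Sigma>' \<in> model_set d k a b.
                   l1norm m (\<lambda>j. Aop d m as \<Sigma>star j - Aop d m as (sample_cov n xs) j)
                   \<le> l1norm m (\<lambda>j. Aop d m as \<Sigma>' j - Aop d m as (sample_cov n xs) j)) \<longrightarrow>
                Lnorm e d (msub \<Sigma>star \<Sigma>)
                  \<le> 2 / (1 - \<delta>) * l1norm m (\<lambda>j. Aop d m as (sample_cov n xs) j - Aop d m as \<Sigma> j)"
        if "\<Sigma> \<in> model_set d k a b" for \<Sigma>
        using RIP_imp_decoder_bound[OF RIP assms(2) that] by blast
    qed
  qed
qed

end
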